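(* Let $R$ be a commutative ring with identity, let $I\trianglelefteq R$ be a splitting ideal and let $n\geq 4$. Then the groups $\mathrm{St}^*(n,R,I)$ and $\mathrm{St}(n,R,I)$ are isomorphic.
   Context: An ideal $I\trianglelefteq R$ is a splitting ideal if the projection $\pi\colon R\to R/I$ has a section $\sigma\colon R/I\to R$ which is a unital ring homomorphism ($\pi\sigma=\mathrm{id}$). Elements of $R^n$ are columns, $e_1,\dots,e_n$ is the standard basis, $u^t$ is the transpose. $\mathrm{E}(n,R)\leq\mathrm{GL}(n,R)$ is the subgroup generated by the elementary transvections $t_{ij}(r)=1+re_{ij}$, $i\ne j$, $r\in R$, and $\mathrm{E}(n,R)e_1$ is the set of first columns of its elements. For $u,v\in R^n$ with $u^tv=0$ put $t(u,v)=1+uv^t$. $\mathrm{St}(n,R)$ is the group with generators $x_{ij}(r)$, $1\le i\neq j\le n$, $r\in R$, and relations $x_{ij}(r)x_{ij}(s)=x_{ij}(r+s)$; $[x_{ij}(r),x_{hk}(s)]=1$ for $h\neq j$, $k\neq i$; $[x_{ij}(r),x_{jk}(s)]=x_{ik}(rs)$ for $i\ne k$, where $[x,y]=xyx^{-1}y^{-1}$. For a splitting ideal $I$, $\mathrm{St}(n,R,I):=\ker(\mathrm{St}(n,R)\to\mathrm{St}(n,R/I))$, the map being induced by $\pi$. For an ideal $I\trianglelefteq R$ and $n\ge4$, $\mathrm{St}^*(n,R,I)$ is the group with generators $F(u,v)$ for all $u\in\mathrm{E}(n,R)e_1$, $v\in I^n$ with $u^tv=0$, and $S(u,v)$ for all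 $u\in I^n$, $v\in\mathrm{E}(n,R)e_1$ with $u^tv=0$, subject to the relations (whenever the generators are defined): (R1) $F(u,v)F(u,w)=F(u,v+w)$; (R2) $S(u,v)S(w,v)=S(u+w,v)$; (R3) $F(u,v)F(u',v')F(u,v)^{-1}=F(t(u,v)u',\,t(v,u)^{-1}v')$; (R4) $F(u,va)=S(ua,v)$ for all $a\in I$ and all $(u,v)$ with $u=Me_1$, $v^t=e_2^tM^{-1}$ for some $M\in\mathrm{E}(n,R)$. *)

theory Defs
  imports "HOL-Algebra.QuotRing" "HOL-Algebra.Generated_Groups"
begin

section \<open>Groups given by generators and relations\<close>

text \<open>
  A letter \<open>(False, x)\<close> stands for the generator \<open>x\<close> and \<open>(True, x)\<close> for its formal inverse.  A relation
  \<open>v = w\<close> is a pair of words.  Pairs in which a letter outside the generating set occurs are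
  ignored.
\<close>

type_synonym 'g word = "(bool \<times> 'g) list"

abbreviation pos :: "'g \<Rightarrow> bool \<times> 'g" where "pos x \<equiv> (False, x)"
abbreviation neg :: "'g \<Rightarrow> bool \<times> 'g" where "neg x \<equiv> (True, x)"

definition words :: "'g set \<Rightarrow> 'g word set" where
  "words X = lists (UNIV \<times> X)"

inductive_set word_cong :: "'g set \<Rightarrow> ('g word \<times> 'g word) set \<Rightarrow> ('g word \<times> 'g word) set"
  for X Q where
  refl: "w \<in> words X \<Longrightarrow> (w, w) \<in> word_cong X Q"
| sym: "(v, w) \<in> word_cong X Q \<Longrightarrow> (w, v) \<in> word_cong X Q"
| trans: "(u, v) \<in> word_cong X Q \<Longrightarrow> (v, w) \<in> word_cong X Q \<Longrightarrow> (u, w) \<in> word_cong X Q"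
| append: "(v, v') \<in> word_cong X Q \<Longrightarrow> (w, w') \<in> word_cong X Q \<Longrightarrow> (v @ w, v' @ w') \<in> word_cong X Q"
| cancel: "x \<in> X \<Longrightarrow> ([(b, x), (\<not> b, x)], []) \<in> word_cong X Q"
| rel: "(v, w) \<in> Q \<Longrightarrow> v \<in> words X \<Longrightarrow> w \<in> words X \<Longrightarrow> (v, w) \<in> word_cong X Q"

abbreviation word_class :: "'g set \<Rightarrow> ('g word \<times> 'g word) set \<Rightarrow> 'g word \<Rightarrow> 'g word set" where
  "word_class X Q w \<equiv> word_cong X Q `` {w}"

definition presented_group ::
    "'g set \<Rightarrow> ('g word \<times> 'g word) set \<Rightarrow> 'g word set monoid" where
  "presented_group X Q =
     \<lparr>carrier = words X // word_cong X Q,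
      mult = (\<lambda>A B. \<Union>v\<in>A. \<Union>w\<in>B. word_class X Q (v @ w)),
      one = word_class X Q []\<rparr>"

lemma word_cong_words:
  "(v, w) \<in> word_cong X Q \<Longrightarrow> v \<in> words X \<and> w \<in> words X"
  by (induction rule: word_cong.induct) (auto simp: words_def)

lemma equiv_word_cong: "equiv (words X) (word_cong X Q)"
proof (rule equivI)
  show "word_cong X Q \<subseteq> words X \<times> words X"
    by (auto dest: word_cong_words)
  show "refl_on (words X) (word_cong X Q)"
    by (auto simp: refl_on_def intro: word_cong.refl)
  show "sym (word_cong X Q)"
    by (rule symI) (rule word_cong.sym)
  show "trans (word_cong X Q)"
    by (rule transI) (rule word_cong.trans)
qed

lemma word_class_eq_iff:
  "v \<in> words X \<Longrightarrow> w \<in> words X \<Longrightarrow>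
     word_class X Q v = word_class X Q w \<longleftrightarrow> (v, w) \<in> word_cong X Q"
  using eq_equiv_class_iff[OF equiv_word_cong] by blast

lemma presented_group_mult_class:
  assumes "v \<in> words X" "w \<in> words X"
  shows "word_class X Q v \<otimes>\<^bsub>presented_group X Q\<^esub> word_class X Q w = word_class X Q (v @ w)"
proof -
  have "word_class X Q (v' @ w') = word_class X Q (v @ w)"
    if "(v, v') \<in> word_cong X Q" "(w, w') \<in> word_cong X Q" for v' w'
    using equiv_class_eq[OF equiv_word_cong word_cong.append[OF that]] by simp
  then show ?thesis
    using assms by (auto simp: presented_group_def intro: word_cong.refl)
qed

lemma word_class_carrier:
  "w \<in> words X \<Longrightarrow> word_class X Q w \<in> carrier (presented_group X Q)"
  by (simp add: presented_group_def quotientI)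

lemma presented_group_cases:
  assumes "A \<in> carrier (presented_group X Q)"
  obtains w where "w \<in> words X" "A = word_class X Q w"
  using assms by (auto simp: presented_group_def elim: quotientE)

lemma words_append: "v \<in> words X \<Longrightarrow> w \<in> words X \<Longrightarrow> v @ w \<in> words X"
  by (simp add: words_def)

lemma words_Nil: "[] \<in> words X"
  by (simp add: words_def)

lemma presented_group_one: "\<one>\<^bsub>presented_group X Q\<^esub> = word_class X Q []"
  by (simp add: presented_group_def)

lemma word_inverse:
  "w \<in> words X \<Longrightarrow>
     map (\<lambda>(b, x). (\<not> b, x)) (rev w) \<in> words X \<and>
     (map (\<lambda>(b, x). (\<not> b, x)) (rev w) @ w, []) \<in> word_cong X Q"
proof (induction w)
  case Nil
  then show ?case by (simp add: words_Nil word_cong.refl)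
next
  case (Cons a w)
  obtain b x where a: "a = (b, x)" by (cases a)
  let ?v = "map (\<lambda>(b, x). (\<not> b, x)) (rev w)"
  from Cons.prems a have x: "x \<in> X" and w: "w \<in> words X" by (auto simp: words_def)
  have v: "?v \<in> words X" and vw: "(?v @ w, []) \<in> word_cong X Q" using Cons.IH w by auto
  have "([(\<not> b, x), (b, x)] @ w, [] @ w) \<in> word_cong X Q"
    using word_cong.append[OF word_cong.cancel[OF x, of "\<not> b"] word_cong.refl[OF w]] by simp
  then have "(?v @ ([(\<not> b, x), (b, x)] @ w), ?v @ ([] @ w)) \<in> word_cong X Q"
    by (rule word_cong.append[OF word_cong.refl[OF v]])
  from word_cong.trans[OF this] vw
  have "(?v @ ([(\<not> b, x), (b, x)] @ w), []) \<in> word_cong X Q" by simp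
  then show ?case using v x a by (auto simp: words_def)
qed

lemma group_presented_group: "group (presented_group X Q)"
proof (rule groupI)
  let ?G = "presented_group X Q"
  note simps = presented_group_mult_class presented_group_one words_append words_Nil
    word_class_carrier
  show "\<one>\<^bsub>?G\<^esub> \<in> carrier ?G"
    by (simp only: simps)
  fix A assume "A \<in> carrier ?G"
  then obtain u where u: "u \<in> words X" and A: "A = word_class X Q u"
    by (rule presented_group_cases)
  show "\<one>\<^bsub>?G\<^esub> \<otimes>\<^bsub>?G\<^esub> A = A"
    unfolding A using u by (simp only: simps append_Nil)
  let ?v = "map (\<lambda>(b, x). (\<not> b, x)) (rev u)"
  have v: "?v \<in> words X" "(?v @ u, []) \<in> word_cong X Q" using word_inverse[OF u] by auto
  have "word_class X Q (?v @ u) = word_class X Q []"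
    by (rule equiv_class_eq[OF equiv_word_cong v(2)])
  then have "word_class X Q ?v \<otimes>\<^bsub>?G\<^esub> A = \<one>\<^bsub>?G\<^esub>"
    unfolding A using u v(1) by (simp only: simps)
  then show "\<exists>B\<in>carrier ?G. B \<otimes>\<^bsub>?G\<^esub> A = \<one>\<^bsub>?G\<^esub>"
    using word_class_carrier[OF v(1)] by (rule bexI)
  fix B assume "B \<in> carrier ?G"
  then obtain v where v: "v \<in> words X" and B: "B = word_class X Q v"
    by (rule presented_group_cases)
  show "A \<otimes>\<^bsub>?G\<^esub> B \<in> carrier ?G"
    unfolding A B using u v by (simp only: simps)
  fix C assume "C \<in> carrier ?G"
  then obtain w where w: "w \<in> words X" and C: "C = word_class X Q w"
    by (rule presented_group_cases)
  show "A \<otimes>\<^bsub>?G\<^esub> B \<otimes>\<^bsub>?G\<^esub> C = A \<otimes>\<^bsub>?G\<^esub> (B \<otimes>\<^bsub>?G\<^esub> C)"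
    unfolding A B C using u v w by (simp only: simps append_assoc)
qed

text \<open>
  The homomorphism of presented groups induced by a map \<open>f\<close> of generators; it is well defined as
  soon as \<open>f\<close> maps generators to generators and relations to relations.
\<close>

definition induced_map ::
    "'h set \<Rightarrow> ('h word \<times> 'h word) set \<Rightarrow> ('g \<Rightarrow> 'h) \<Rightarrow> 'g word set \<Rightarrow> 'h word set" where
  "induced_map Y P f A = (\<Union>w\<in>A. word_class Y P (map (map_prod id f) w))"

lemma map_words:
  "f ` X \<subseteq> Y \<Longrightarrow> w \<in> words X \<Longrightarrow> map (map_prod id f) w \<in> words Y"
  by (fastforce simp: words_def)

lemma map_word_cong:
  assumes f: "f ` X \<subseteq> Y"
    and Q: "map_prod (map (map_prod id f)) (map (map_prod id f)) ` Q \<subseteq> P"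
    and vw: "(v, w) \<in> word_cong X Q"
  shows "(map (map_prod id f) v, map (map_prod id f) w) \<in> word_cong Y P"
  using vw
proof (induction rule: word_cong.induct)
  case (refl w)
  show ?case by (rule word_cong.refl[OF map_words[OF f refl]])
next
  case (sym v w)
  from sym.IH show ?case by (rule word_cong.sym)
next
  case (trans u v w)
  from trans.IH show ?case by (rule word_cong.trans)
next
  case (append v v' w w')
  from word_cong.append[OF append.IH] show ?case by simp
next
  case (cancel x b)
  then have "f x \<in> Y" using f by blast
  from word_cong.cancel[OF this, of b P] show ?case by simp
next
  case (rel v w)
  have "(map (map_prod id f) v, map (map_prod id f) w) \<in> P"
    using imageI[OF rel(1), of "map_prod (map (map_prod id f)) (map (map_prod id f))"] Q by auto
  then show ?case
    by (rule word_cong.rel[OF _ map_words[OF f rel(2)] map_words[OF f rel(3)]])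
qed

lemma induced_map_class:
  assumes f: "f ` X \<subseteq> Y"
    and Q: "map_prod (map (map_prod id f)) (map (map_prod id f)) ` Q \<subseteq> P"
    and w: "w \<in> words X"
  shows "induced_map Y P f (word_class X Q w) = word_class Y P (map (map_prod id f) w)"
proof -
  have "word_class Y P (map (map_prod id f) v) = word_class Y P (map (map_prod id f) w)"
    if "v \<in> word_class X Q w" for v
    using equiv_class_eq[OF equiv_word_cong map_word_cong[OF f Q]] that by blast
  moreover have "w \<in> word_class X Q w"
    using word_cong.refl[OF w] by blast
  ultimately show ?thesis
    unfolding induced_map_def by blast
qed

lemma induced_map_hom:
  assumes f: "f ` X \<subseteq> Y"
    and Q: "map_prod (map (map_prod id f)) (map (map_prod id f)) ` Q \<subseteq> P"
  shows "induced_map Y P f \<in> hom (presented_group X Q) (presented_group Y P)"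
proof (rule homI)
  note simps = induced_map_class[OF f Q] presented_group_mult_class words_append map_append
    map_words[OF f] word_class_carrier
  fix A assume "A \<in> carrier (presented_group X Q)"
  then obtain v where v: "v \<in> words X" and A: "A = word_class X Q v"
    by (rule presented_group_cases)
  show "induced_map Y P f A \<in> carrier (presented_group Y P)"
    unfolding A using v by (simp only: simps)
  fix B assume "B \<in> carrier (presented_group X Q)"
  then obtain w where w: "w \<in> words X" and B: "B = word_class X Q w"
    by (rule presented_group_cases)
  show "induced_map Y P f (A \<otimes>\<^bsub>presented_group X Q\<^esub> B) =
      induced_map Y P f A \<otimes>\<^bsub>presented_group Y P\<^esub> induced_map Y P f B"
    unfolding A B using v w by (simp only: simps)
qed


section \<open>Steinberg groups\<close>

text \<open>The generator \<open>x\<^sub>i\<^sub>j(r)\<close> is the triple \<open>(i, j, r)\<close>.\<close>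

definition St_gens :: "nat \<Rightarrow> ('a, 'b) ring_scheme \<Rightarrow> (nat \<times> nat \<times> 'a) set" where
  "St_gens n R = {(i, j, r). i \<in> {1..n} \<and> j \<in> {1..n} \<and> i \<noteq> j \<and> r \<in> carrier R}"

definition comm_word :: "'g \<Rightarrow> 'g \<Rightarrow> 'g word" where
  "comm_word x y = [pos x, pos y, neg x, neg y]"

definition St_rels ::
    "nat \<Rightarrow> ('a, 'b) ring_scheme \<Rightarrow> ((nat \<times> nat \<times> 'a) word \<times> (nat \<times> nat \<times> 'a) word) set" where
  "St_rels n R =
     {([pos (i, j, r), pos (i, j, s)], [pos (i, j, r \<oplus>\<^bsub>R\<^esub> s)]) | i j r s.
        (i, j, r) \<in> St_gens n R \<and> (i, j, s) \<in> St_gens n R} \<union>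
     {(comm_word (i, j, r) (h, k, s), []) | i j r h k s.
        (i, j, r) \<in> St_gens n R \<and> (h, k, s) \<in> St_gens n R \<and> h \<noteq> j \<and> k \<noteq> i} \<union>
     {(comm_word (i, j, r) (j, k, s), [pos (i, k, r \<otimes>\<^bsub>R\<^esub> s)]) | i j r k s.
        (i, j, r) \<in> St_gens n R \<and> (j, k, s) \<in> St_gens n R \<and> i \<noteq> k}"

definition Steinberg ::
    "nat \<Rightarrow> ('a, 'b) ring_scheme \<Rightarrow> (nat \<times> nat \<times> 'a) word set monoid" where
  "Steinberg n R = presented_group (St_gens n R) (St_rels n R)"

definition St_map ::
    "nat \<Rightarrow> ('c, 'd) ring_scheme \<Rightarrow> ('a \<Rightarrow> 'c) \<Rightarrow>
       (nat \<times> nat \<times> 'a) word set \<Rightarrow> (nat \<times> nat \<times> 'c) word set" where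
  "St_map n S f = induced_map (St_gens n S) (St_rels n S) (\<lambda>(i, j, r). (i, j, f r))"

definition relative_Steinberg ::
    "nat \<Rightarrow> ('a, 'b) ring_scheme \<Rightarrow> 'a set \<Rightarrow> (nat \<times> nat \<times> 'a) word set monoid" where
  "relative_Steinberg n R I =
     (Steinberg n R)
       \<lparr>carrier := kernel (Steinberg n R) (Steinberg n (R Quot I))
                     (St_map n (R Quot I) (\<lambda>r. I +>\<^bsub>R\<^esub> r))\<rparr>"

lemma group_Steinberg: "group (Steinberg n R)"
  by (simp add: Steinberg_def group_presented_group)

lemma St_map_gens:
  assumes "f \<in> ring_hom R S"
  shows "(\<lambda>(i, j, r). (i, j, f r)) ` St_gens n R \<subseteq> St_gens n S"
  using ring_hom_closed[OF assms] by (auto simp: St_gens_def)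

lemma St_map_rels:
  assumes f: "f \<in> ring_hom R S"
  shows "map_prod (map (map_prod id (\<lambda>(i, j, r). (i, j, f r))))
           (map (map_prod id (\<lambda>(i, j, r). (i, j, f r)))) ` St_rels n R \<subseteq> St_rels n S"
proof clarsimp
  fix v w assume vw: "(v, w) \<in> St_rels n R"
  let ?g = "\<lambda>(i :: nat, j :: nat, r). (i, j, f r)"
  have G: "(i, j, f r) \<in> St_gens n S" if "(i, j, r) \<in> St_gens n R" for i j r
    using St_map_gens[OF f, of n] that by force
  have C: "r \<in> carrier R" if "(i, j, r) \<in> St_gens n R" for i j r
    using that by (simp add: St_gens_def)
  from vw consider
    (1) i j r s where "v = [pos (i, j, r), pos (i, j, s)]" "w = [pos (i, j, r \<oplus>\<^bsub>R\<^esub> s)]"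
      "(i, j, r) \<in> St_gens n R" "(i, j, s) \<in> St_gens n R"
  | (2) i j r h k s where "v = comm_word (i, j, r) (h, k, s)" "w = []"
      "(i, j, r) \<in> St_gens n R" "(h, k, s) \<in> St_gens n R" "h \<noteq> j" "k \<noteq> i"
  | (3) i j r k s where "v = comm_word (i, j, r) (j, k, s)" "w = [pos (i, k, r \<otimes>\<^bsub>R\<^esub> s)]"
      "(i, j, r) \<in> St_gens n R" "(j, k, s) \<in> St_gens n R" "i \<noteq> k"
    unfolding St_rels_def by blast
  then show "(map (map_prod id ?g) v, map (map_prod id ?g) w) \<in> St_rels n S"
  proof cases
    case 1
    have eq: "map (map_prod id ?g) v = [pos (i, j, f r), pos (i, j, f s)]"
        "map (map_prod id ?g) w = [pos (i, j, f r \<oplus>\<^bsub>S\<^esub> f s)]"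
      using 1 ring_hom_add[OF f C C] by simp_all
    show "(map (map_prod id ?g) v, map (map_prod id ?g) w) \<in> St_rels n S"
      unfolding eq St_rels_def using G[OF 1(3)] G[OF 1(4)] by blast
  next
    case 2
    have eq: "map (map_prod id ?g) v = comm_word (i, j, f r) (h, k, f s)"
        "map (map_prod id ?g) w = []"
      using 2 by (simp_all add: comm_word_def)
    show "(map (map_prod id ?g) v, map (map_prod id ?g) w) \<in> St_rels n S"
      unfolding eq St_rels_def using G[OF 2(3)] G[OF 2(4)] 2(5,6) by blast
  next
    case 3
    have eq: "map (map_prod id ?g) v = comm_word (i, j, f r) (j, k, f s)"
        "map (map_prod id ?g) w = [pos (i, k, f r \<otimes>\<^bsub>S\<^esub> f s)]"
      using 3 ring_hom_mult[OF f C C] by (simp_all add: comm_word_def)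
    show "(map (map_prod id ?g) v, map (map_prod id ?g) w) \<in> St_rels n S"
      unfolding eq St_rels_def using G[OF 3(3)] G[OF 3(4)] 3(5) by blast
  qed
qed

lemma St_map_hom:
  assumes "f \<in> ring_hom R S"
  shows "St_map n S f \<in> hom (Steinberg n R) (Steinberg n S)"
  unfolding St_map_def Steinberg_def
  by (rule induced_map_hom[OF St_map_gens[OF assms] St_map_rels[OF assms]])

lemma St_map_gen:
  assumes f: "f \<in> ring_hom R S" and g: "(i, j, r) \<in> St_gens n R"
  shows "St_map n S f (word_class (St_gens n R) (St_rels n R) [pos (i, j, r)]) =
         word_class (St_gens n S) (St_rels n S) [pos (i, j, f r)]"
proof -
  have "[pos (i, j, r)] \<in> words (St_gens n R)" using g by (simp add: words_def)
  from induced_map_class[OF St_map_gens[OF f] St_map_rels[OF f] this]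
  show ?thesis by (simp add: St_map_def)
qed

lemma group_relative_Steinberg:
  assumes "ideal I R"
  shows "group (relative_Steinberg n R I)"
proof -
  interpret group_hom "Steinberg n R" "Steinberg n (R Quot I)"
      "St_map n (R Quot I) (\<lambda>r. I +>\<^bsub>R\<^esub> r)"
    unfolding group_hom_def group_hom_axioms_def
    using St_map_hom[OF ideal.rcos_ring_hom[OF assms]] by (simp add: group_Steinberg)
  show ?thesis
    unfolding relative_Steinberg_def
    by (rule subgroup.subgroup_is_group[OF subgroup_kernel G.group_axioms])
qed


section \<open>Columns and matrices over a ring\<close>

text \<open>
  Columns are extensional functions on \<open>{1..n}\<close>, matrices are extensional functions on
  \<open>{1..n} \<times> {1..n}\<close>, so that equality of functions is equality of columns and matrices.
\<close>

type_synonym 'a column = "nat \<Rightarrow> 'a"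
type_synonym 'a matrix = "nat \<times> nat \<Rightarrow> 'a"

definition columns :: "nat \<Rightarrow> 'a set \<Rightarrow> 'a column set" where
  "columns n A = {1..n} \<rightarrow>\<^sub>E A"

definition unit_col :: "nat \<Rightarrow> ('a, 'b) ring_scheme \<Rightarrow> nat \<Rightarrow> 'a column" where
  "unit_col n R k = (\<lambda>i\<in>{1..n}. if i = k then \<one>\<^bsub>R\<^esub> else \<zero>\<^bsub>R\<^esub>)"

definition col_add :: "nat \<Rightarrow> ('a, 'b) ring_scheme \<Rightarrow> 'a column \<Rightarrow> 'a column \<Rightarrow> 'a column" where
  "col_add n R u v = (\<lambda>i\<in>{1..n}. u i \<oplus>\<^bsub>R\<^esub> v i)"

definition col_scale :: "nat \<Rightarrow> ('a, 'b) ring_scheme \<Rightarrow> 'a column \<Rightarrow> 'a \<Rightarrow> 'a column" where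
  "col_scale n R u a = (\<lambda>i\<in>{1..n}. u i \<otimes>\<^bsub>R\<^esub> a)"

definition col_dot :: "nat \<Rightarrow> ('a, 'b) ring_scheme \<Rightarrow> 'a column \<Rightarrow> 'a column \<Rightarrow> 'a" where
  "col_dot n R u v = (\<Oplus>\<^bsub>R\<^esub>i\<in>{1..n}. u i \<otimes>\<^bsub>R\<^esub> v i)"

definition mat_col :: "nat \<Rightarrow> ('a, 'b) ring_scheme \<Rightarrow> 'a matrix \<Rightarrow> 'a column \<Rightarrow> 'a column" where
  "mat_col n R M u = (\<lambda>i\<in>{1..n}. \<Oplus>\<^bsub>R\<^esub>j\<in>{1..n}. M (i, j) \<otimes>\<^bsub>R\<^esub> u j)"

text \<open>The column \<open>v\<close> with \<open>v\<^sup>t = u\<^sup>t M\<close>.\<close>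

definition row_mat :: "nat \<Rightarrow> ('a, 'b) ring_scheme \<Rightarrow> 'a column \<Rightarrow> 'a matrix \<Rightarrow> 'a column" where
  "row_mat n R u M = (\<lambda>j\<in>{1..n}. \<Oplus>\<^bsub>R\<^esub>i\<in>{1..n}. u i \<otimes>\<^bsub>R\<^esub> M (i, j))"

definition mat_monoid :: "nat \<Rightarrow> ('a, 'b) ring_scheme \<Rightarrow> 'a matrix monoid" where
  "mat_monoid n R =
     \<lparr>carrier = {1..n} \<times> {1..n} \<rightarrow>\<^sub>E carrier R,
      mult = (\<lambda>M N. \<lambda>(i, k)\<in>{1..n} \<times> {1..n}. \<Oplus>\<^bsub>R\<^esub>j\<in>{1..n}. M (i, j) \<otimes>\<^bsub>R\<^esub> N (j, k)),
      one = (\<lambda>(i, j)\<in>{1..n} \<times> {1..n}. if i = j then \<one>\<^bsub>R\<^esub> else \<zero>\<^bsub>R\<^esub>)\<rparr>"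

definition GL :: "nat \<Rightarrow> ('a, 'b) ring_scheme \<Rightarrow> 'a matrix monoid" where
  "GL n R = units_of (mat_monoid n R)"

lemma (in semiring) finsum_swap:
  assumes "finite A" "finite B" "\<And>i j. i \<in> A \<Longrightarrow> j \<in> B \<Longrightarrow> f i j \<in> carrier R"
  shows "(\<Oplus>i\<in>A. \<Oplus>j\<in>B. f i j) = (\<Oplus>j\<in>B. \<Oplus>i\<in>A. f i j)"
  using assms(1,3)
proof (induction A rule: finite_induct)
  case empty
  then show ?case by (simp add: finsum_zero)
next
  case (insert a A)
  have "(\<Oplus>i\<in>insert a A. \<Oplus>j\<in>B. f i j) = (\<Oplus>j\<in>B. f a j) \<oplus> (\<Oplus>i\<in>A. \<Oplus>j\<in>B. f i j)"
    using insert.hyps insert.prems by (intro finsum_insert) (auto intro!: finsum_closed)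
  also have "\<dots> = (\<Oplus>j\<in>B. f a j) \<oplus> (\<Oplus>j\<in>B. \<Oplus>i\<in>A. f i j)"
    using insert by simp
  also have "\<dots> = (\<Oplus>j\<in>B. f a j \<oplus> (\<Oplus>i\<in>A. f i j))"
    using insert.prems by (intro finsum_addf[symmetric]) (auto intro!: finsum_closed)
  also have "\<dots> = (\<Oplus>j\<in>B. \<Oplus>i\<in>insert a A. f i j)"
    using insert.hyps insert.prems
    by (intro finsum_cong') (auto intro!: finsum_closed finsum_insert[symmetric])
  finally show ?case .
qed

lemma (in ring) monoid_mat_monoid: "Group.monoid (mat_monoid n R)"
proof (rule monoidI)
  let ?M = "mat_monoid n R"
  have cl: "M (i, j) \<in> carrier R" if "M \<in> carrier ?M" "i \<in> {1..n}" "j \<in> {1..n}" for M i j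
    using that by (auto simp: mat_monoid_def)
  show "\<one>\<^bsub>?M\<^esub> \<in> carrier ?M"
    by (auto simp: mat_monoid_def)
  fix M assume M: "M \<in> carrier ?M"
  have ext: "M p = undefined" if "p \<notin> {1..n} \<times> {1..n}" for p
    by (rule PiE_arb[OF _ that, of M "\<lambda>_. carrier R"]) (use M in \<open>simp add: mat_monoid_def\<close>)
  show "\<one>\<^bsub>?M\<^esub> \<otimes>\<^bsub>?M\<^esub> M = M"
  proof
    fix p
    show "(\<one>\<^bsub>?M\<^esub> \<otimes>\<^bsub>?M\<^esub> M) p = M p"
    proof (cases "p \<in> {1..n} \<times> {1..n}")
      case True
      then obtain i k where p: "p = (i, k)" "i \<in> {1..n}" "k \<in> {1..n}" by blast
      have "(\<one>\<^bsub>?M\<^esub> \<otimes>\<^bsub>?M\<^esub> M) p = (\<Oplus>j\<in>{1..n}. if i = j then M (j, k) else \<zero>)"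
        using p cl[OF M] by (auto simp: mat_monoid_def intro!: finsum_cong')
      also have "\<dots> = M (i, k)"
        using p cl[OF M] by (intro finsum_singleton) auto
      finally show ?thesis using p by simp
    qed (auto simp: ext mat_monoid_def)
  qed
  show "M \<otimes>\<^bsub>?M\<^esub> \<one>\<^bsub>?M\<^esub> = M"
  proof
    fix p
    show "(M \<otimes>\<^bsub>?M\<^esub> \<one>\<^bsub>?M\<^esub>) p = M p"
    proof (cases "p \<in> {1..n} \<times> {1..n}")
      case True
      then obtain i k where p: "p = (i, k)" "i \<in> {1..n}" "k \<in> {1..n}" by blast
      have "(M \<otimes>\<^bsub>?M\<^esub> \<one>\<^bsub>?M\<^esub>) p = (\<Oplus>j\<in>{1..n}. if k = j then M (i, j) else \<zero>)"
        using p cl[OF M] by (auto simp: mat_monoid_def intro!: finsum_cong')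
      also have "\<dots> = M (i, k)"
        using p cl[OF M] by (intro finsum_singleton) auto
      finally show ?thesis using p by simp
    qed (auto simp: ext mat_monoid_def)
  qed
  fix N assume N: "N \<in> carrier ?M"
  show "M \<otimes>\<^bsub>?M\<^esub> N \<in> carrier ?M"
    using cl[OF M] cl[OF N] by (auto simp: mat_monoid_def intro!: finsum_closed)
  fix L assume L: "L \<in> carrier ?M"
  show "M \<otimes>\<^bsub>?M\<^esub> N \<otimes>\<^bsub>?M\<^esub> L = M \<otimes>\<^bsub>?M\<^esub> (N \<otimes>\<^bsub>?M\<^esub> L)"
  proof
    fix p
    show "(M \<otimes>\<^bsub>?M\<^esub> N \<otimes>\<^bsub>?M\<^esub> L) p = (M \<otimes>\<^bsub>?M\<^esub> (N \<otimes>\<^bsub>?M\<^esub> L)) p"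
    proof (cases "p \<in> {1..n} \<times> {1..n}")
      case True
      then obtain i k where p: "p = (i, k)" "i \<in> {1..n}" "k \<in> {1..n}" by blast
      note c = cl[OF M] cl[OF N] cl[OF L]
      have "(M \<otimes>\<^bsub>?M\<^esub> N \<otimes>\<^bsub>?M\<^esub> L) p =
          (\<Oplus>h\<in>{1..n}. (\<Oplus>j\<in>{1..n}. M (i, j) \<otimes> N (j, h)) \<otimes> L (h, k))"
        using p c by (auto simp: mat_monoid_def intro!: finsum_cong' finsum_closed)
      also have "\<dots> = (\<Oplus>h\<in>{1..n}. \<Oplus>j\<in>{1..n}. M (i, j) \<otimes> N (j, h) \<otimes> L (h, k))"
        using p c by (auto intro!: finsum_cong' finsum_closed finsum_ldistr)
      also have "\<dots> = (\<Oplus>j\<in>{1..n}. \<Oplus>h\<in>{1..n}. M (i, j) \<otimes> N (j, h) \<otimes> L (h, k))"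
        using p c by (intro finsum_swap) auto
      also have "\<dots> = (\<Oplus>j\<in>{1..n}. \<Oplus>h\<in>{1..n}. M (i, j) \<otimes> (N (j, h) \<otimes> L (h, k)))"
        using p c by (auto intro!: finsum_cong' finsum_closed simp: m_assoc)
      also have "\<dots> = (\<Oplus>j\<in>{1..n}. M (i, j) \<otimes> (\<Oplus>h\<in>{1..n}. N (j, h) \<otimes> L (h, k)))"
        using p c by (auto intro!: finsum_cong' finsum_closed finsum_rdistr[symmetric])
      also have "\<dots> = (M \<otimes>\<^bsub>?M\<^esub> (N \<otimes>\<^bsub>?M\<^esub> L)) p"
        using p c by (auto simp: mat_monoid_def intro!: finsum_cong' finsum_closed)
      finally show ?thesis .
    qed (auto simp: mat_monoid_def)
  qed
qed

lemma (in ring) group_GL: "group (GL n R)"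
  unfolding GL_def by (rule monoid.units_group[OF monoid_mat_monoid])

text \<open>The matrix \<open>1 + u v\<^sup>t\<close>.\<close>

definition transv :: "nat \<Rightarrow> ('a, 'b) ring_scheme \<Rightarrow> 'a column \<Rightarrow> 'a column \<Rightarrow> 'a matrix" where
  "transv n R u v =
     (\<lambda>(i, j)\<in>{1..n} \<times> {1..n}. (if i = j then \<one>\<^bsub>R\<^esub> else \<zero>\<^bsub>R\<^esub>) \<oplus>\<^bsub>R\<^esub> u i \<otimes>\<^bsub>R\<^esub> v j)"

definition elem_transv :: "nat \<Rightarrow> ('a, 'b) ring_scheme \<Rightarrow> nat \<Rightarrow> nat \<Rightarrow> 'a \<Rightarrow> 'a matrix" where
  "elem_transv n R i j r =
     (\<lambda>(h, k)\<in>{1..n} \<times> {1..n}.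
        (if h = k then \<one>\<^bsub>R\<^esub> else \<zero>\<^bsub>R\<^esub>) \<oplus>\<^bsub>R\<^esub> (if h = i \<and> k = j then r else \<zero>\<^bsub>R\<^esub>))"

definition elem_set :: "nat \<Rightarrow> ('a, 'b) ring_scheme \<Rightarrow> 'a matrix set" where
  "elem_set n R =
     generate (GL n R)
       {elem_transv n R i j r | i j r.
          i \<in> {1..n} \<and> j \<in> {1..n} \<and> i \<noteq> j \<and> r \<in> carrier R}"

definition elem_cols :: "nat \<Rightarrow> ('a, 'b) ring_scheme \<Rightarrow> 'a column set" where
  "elem_cols n R = {mat_col n R M (unit_col n R 1) | M. M \<in> elem_set n R}"


section \<open>The relative Steinberg group in another presentation\<close>

datatype 'a star_gen = F "'a column" "'a column" | S "'a column" "'a column"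

definition star_gens :: "nat \<Rightarrow> ('a, 'b) ring_scheme \<Rightarrow> 'a set \<Rightarrow> 'a star_gen set" where
  "star_gens n R I =
     {F u v | u v. u \<in> elem_cols n R \<and> v \<in> columns n I \<and> col_dot n R u v = \<zero>\<^bsub>R\<^esub>} \<union>
     {S u v | u v. u \<in> columns n I \<and> v \<in> elem_cols n R \<and> col_dot n R u v = \<zero>\<^bsub>R\<^esub>}"

definition star_rels ::
    "nat \<Rightarrow> ('a, 'b) ring_scheme \<Rightarrow> 'a set \<Rightarrow> ('a star_gen word \<times> 'a star_gen word) set" where
  "star_rels n R I =
     {([pos (F u v), pos (F u w)], [pos (F u (col_add n R v w))]) | u v w.
        F u v \<in> star_gens n R I \<and> F u w \<in> star_gens n R I} \<union>
     {([pos (S u v), pos (S w v)], [pos (S (col_add n R u w) v)]) | u v w.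
        S u v \<in> star_gens n R I \<and> S w v \<in> star_gens n R I} \<union>
     {([pos (F u v), pos (F u' v'), neg (F u v)],
       [pos (F (mat_col n R (transv n R u v) u')
               (mat_col n R (inv\<^bsub>GL n R\<^esub> (transv n R v u)) v'))]) | u v u' v'.
        F u v \<in> star_gens n R I \<and> F u' v' \<in> star_gens n R I} \<union>
     {([pos (F u (col_scale n R v a))], [pos (S (col_scale n R u a) v)]) | u v a.
        a \<in> I \<and>
        (\<exists>M\<in>elem_set n R. u = mat_col n R M (unit_col n R 1) \<and>
                          v = row_mat n R (unit_col n R 2) (inv\<^bsub>GL n R\<^esub> M))}"

definition star_Steinberg ::
    "nat \<Rightarrow> ('a, 'b) ring_scheme \<Rightarrow> 'a set \<Rightarrow> 'a star_gen word set monoid" where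
  "star_Steinberg n R I = presented_group (star_gens n R I) (star_rels n R I)"


section \<open>Splitting ideals\<close>

definition splitting_ideal :: "'a set \<Rightarrow> ('a, 'b) ring_scheme \<Rightarrow> bool" where
  "splitting_ideal I R \<longleftrightarrow>
     ideal I R \<and>
     (\<exists>\<sigma>\<in>ring_hom (R Quot I) R. \<forall>x\<in>carrier (R Quot I). I +>\<^bsub>R\<^esub> \<sigma> x = x)"

end

theory Submission
  imports Defs
begin

text \<open>
  The heart of the matter is that the conjugates of root elements form well-defined transvections in
  \<open>St(n,R)\<close>.  For a column \<open>u\<close> consider the subgroup \<open>stab u\<close> generated by explicit lifts of the
  transvections \<open>1 + u v\<^sup>t\<close> with \<open>v = c (u\<^sub>q e\<^sub>p - u\<^sub>p e\<^sub>q)\<close> a Koszul vector.  In a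
  conjugation by \<open>x\<^sub>i\<^sub>j(a)\<close> either \<open>{i, j}\<close> and \<open>{p, q}\<close> are disjoint, which is harmless, or at most three
  indices are involved, so that \<open>n \<ge> 4\<close> leaves a free one to work with; one finds that the conjugation maps \<open>stab u\<close> into \<open>stab (t\<^sub>i\<^sub>j(a) u)\<close>.  For \<open>u = e\<^sub>1\<close> the subgroup consists of the row
  elements \<open>\<Prod>\<^sub>j x\<^sub>1\<^sub>j(b\<^sub>j)\<close>, on which the map to matrices is injective.  Hence, if the image \<open>M\<close> of \<open>g\<close>
  fixes \<open>e\<^sub>1\<close>, conjugation by \<open>g\<close> acts on row elements exactly as \<open>M\<close> does on rows, and
  \<open>F(u,v)\<close> can be sent to a conjugate of a row element.  The generators \<open>S(u,v)\<close> are treated by the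
  same argument after the substitution \<open>x\<^sub>i\<^sub>j(r) \<mapsto> x\<^sub>j\<^sub>i(-r)\<close>.  This gives a homomorphism
  \<open>St\<^sup>*(n,R,I) \<rightarrow> St(n,R)\<close>.

  To invert it, write \<open>\<rho>\<close> for the composite \<open>R \<rightarrow> R/I \<rightarrow> R\<close>, let \<open>St(n,R)\<close> act on \<open>St\<^sup>*(n,R,I)\<close> through
  matrices, and send \<open>x\<^sub>i\<^sub>j(r)\<close> to \<open>(F(e\<^sub>i, (r - \<rho> r) e\<^sub>j), x\<^sub>i\<^sub>j(\<rho> r))\<close> in the semidirect product.  The
  Steinberg relations hold there, because conjugation in \<open>St\<^sup>*(n,R,I)\<close> is given by the matrix action.
\<close>

section \<open>The universal property of presented groups\<close>

text \<open>The obstacle is the kernel of St(n,R) -> GL(n,R): two elements with the same matrix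
  might conjugate a row element differently. A single lift of 1 + u v^t is therefore not followed
  along a conjugation; only \<open>stab u\<close> is, and uniqueness is recovered over e_1. For M =
  1 the outcome is that the kernel commutes with row elements, so nothing about it has to be known
  beforehand. Koszul vectors serve because they are orthogonal to u by a polynomial identity, and a
  shear turns a Koszul vector of u into a sum of at most two for the sheared column.

  The homomorphism \<open>kappa\<close> to St(n,R) and the matrix action form a crossed module;
  equivariance makes (s, h) |-> kappa(s) h multiplicative on the semidirect product. The map into
  the semidirect product is a section of it, sends kappa(s) to (s, 1), and has as second component
  the endomorphism induced by \<open>rho\<close>. Hence \<open>kappa\<close> is injective and its
  image is the kernel of that endomorphism.\<close>

definition word_eval :: "('h, 'c) monoid_scheme \<Rightarrow> ('g \<Rightarrow> 'h) \<Rightarrow> 'g word \<Rightarrow> 'h" where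
  "word_eval H f w =
     foldr (\<lambda>(b, x) z. (if b then inv\<^bsub>H\<^esub> f x else f x) \<otimes>\<^bsub>H\<^esub> z) w \<one>\<^bsub>H\<^esub>"

abbreviation gen_class :: "'g set \<Rightarrow> ('g word \<times> 'g word) set \<Rightarrow> 'g \<Rightarrow> 'g word set" where
  "gen_class X Q x \<equiv> word_class X Q [pos x]"

text \<open>A group element is a set of words, so one representative is picked and evaluated; the
  value is meaningful where \<open>word_eval_cong\<close> applies, that is, when \<open>f\<close>
  respects the relations.\<close>

definition presented_lift :: "('h, 'c) monoid_scheme \<Rightarrow> ('g \<Rightarrow> 'h) \<Rightarrow> 'g word set \<Rightarrow> 'h" where
  "presented_lift H f A = word_eval H f (SOME w. w \<in> A)"

lemma word_eval_Nil [simp]: "word_eval H f [] = \<one>\<^bsub>H\<^esub>"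
  by (simp add: word_eval_def)

lemma word_eval_Cons [simp]:
  "word_eval H f ((b, x) # w) = (if b then inv\<^bsub>H\<^esub> f x else f x) \<otimes>\<^bsub>H\<^esub> word_eval H f w"
  by (simp add: word_eval_def)

lemma words_Cons: "(b, x) # w \<in> words X \<longleftrightarrow> x \<in> X \<and> w \<in> words X"
  by (auto simp: words_def)

context group
begin

lemma word_eval_closed:
  "f \<in> X \<rightarrow> carrier G \<Longrightarrow> w \<in> words X \<Longrightarrow> word_eval G f w \<in> carrier G"
  by (induction w) (auto simp: words_Cons Pi_iff)

lemma word_eval_append:
  assumes f: "f \<in> X \<rightarrow> carrier G"
  shows "v \<in> words X \<Longrightarrow> w \<in> words X \<Longrightarrow>
    word_eval G f (v @ w) = word_eval G f v \<otimes> word_eval G f w"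
proof (induction v)
  case Nil
  then show ?case using word_eval_closed[OF f] by simp
next
  case (Cons a v)
  obtain b x where a: "a = (b, x)" by (cases a)
  have "f x \<in> carrier G" "v \<in> words X" using Cons.prems f by (auto simp: a words_Cons)
  then show ?case
    using Cons word_eval_closed[OF f] by (auto simp: a m_assoc)
qed

text \<open>Relations are demanded only on pairs of words over \<open>X\<close>, because
  \<open>word_cong\<close> ignores all other pairs. \<open>star_lift\<close> relies on this: from
  the word conditions it gets that the right-hand sides of its relations are generators.\<close>

lemma word_eval_cong:
  assumes f: "f \<in> X \<rightarrow> carrier G"
    and Q: "\<And>v w. (v, w) \<in> Q \<Longrightarrow> v \<in> words X \<Longrightarrow> w \<in> words X \<Longrightarrow> word_eval G f v = word_eval G f w"
    and vw: "(v, w) \<in> word_cong X Q"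
  shows "word_eval G f v = word_eval G f w"
  using vw
proof (induction rule: word_cong.induct)
  case (append v v' w w')
  then show ?case
    using word_cong_words[OF append.hyps(1)] word_cong_words[OF append.hyps(2)]
    by (simp add: word_eval_append[OF f])
next
  case (cancel x b)
  then have "f x \<in> carrier G" using f by blast
  then show ?case by simp
qed (use Q in auto)

lemma presented_lift_class:
  assumes f: "f \<in> X \<rightarrow> carrier G"
    and Q: "\<And>v w. (v, w) \<in> Q \<Longrightarrow> v \<in> words X \<Longrightarrow> w \<in> words X \<Longrightarrow> word_eval G f v = word_eval G f w"
    and w: "w \<in> words X"
  shows "presented_lift G f (word_class X Q w) = word_eval G f w"
proof -
  have "w \<in> word_class X Q w" using word_cong.refl[OF w] by blast
  then have "(SOME v. v \<in> word_class X Q w) \<in> word_class X Q w" by (rule someI)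
  then have "(w, SOME v. v \<in> word_class X Q w) \<in> word_cong X Q" by simp
  from word_eval_cong[OF f Q this] show ?thesis by (simp add: presented_lift_def)
qed

lemma presented_lift_hom:
  assumes f: "f \<in> X \<rightarrow> carrier G"
    and Q: "\<And>v w. (v, w) \<in> Q \<Longrightarrow> v \<in> words X \<Longrightarrow> w \<in> words X \<Longrightarrow> word_eval G f v = word_eval G f w"
  shows "presented_lift G f \<in> hom (presented_group X Q) G"
proof (rule homI)
  note lift = presented_lift_class[OF f Q]
  fix A assume "A \<in> carrier (presented_group X Q)"
  then obtain v where v: "v \<in> words X" "A = word_class X Q v" by (rule presented_group_cases)
  then show "presented_lift G f A \<in> carrier G" by (simp add: lift word_eval_closed[OF f])
  fix B assume "B \<in> carrier (presented_group X Q)"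
  then obtain w where w: "w \<in> words X" "B = word_class X Q w" by (rule presented_group_cases)
  have "presented_lift G f (A \<otimes>\<^bsub>presented_group X Q\<^esub> B) = word_eval G f (v @ w)"
    using v w by (simp add: presented_group_mult_class lift words_append)
  then show "presented_lift G f (A \<otimes>\<^bsub>presented_group X Q\<^esub> B)
      = presented_lift G f A \<otimes> presented_lift G f B"
    using v w by (simp add: lift word_eval_append[OF f])
qed

lemma presented_lift_gen:
  assumes f: "f \<in> X \<rightarrow> carrier G"
    and Q: "\<And>v w. (v, w) \<in> Q \<Longrightarrow> v \<in> words X \<Longrightarrow> w \<in> words X \<Longrightarrow> word_eval G f v = word_eval G f w"
    and x: "x \<in> X"
  shows "presented_lift G f (gen_class X Q x) = f x"
proof -
  have "f x \<in> carrier G" using f x by blast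
  moreover have "[pos x] \<in> words X" using x by (simp add: words_def)
  ultimately show ?thesis using presented_lift_class[OF f Q] by simp
qed

end

lemma gen_class_closed: "x \<in> X \<Longrightarrow> gen_class X Q x \<in> carrier (presented_group X Q)"
  by (rule word_class_carrier) (simp add: words_def)

lemma gen_class_inv:
  assumes x: "x \<in> X"
  shows "inv\<^bsub>presented_group X Q\<^esub> gen_class X Q x = word_class X Q [neg x]"
proof -
  interpret group "presented_group X Q" by (rule group_presented_group)
  have w: "[pos x] \<in> words X" "[neg x] \<in> words X" "[] \<in> words X" "[neg x, pos x] \<in> words X"
    using x by (auto simp: words_def)
  have "word_class X Q [neg x] \<otimes>\<^bsub>presented_group X Q\<^esub> gen_class X Q x = \<one>\<^bsub>presented_group X Q\<^esub>"
    using word_cong.cancel[OF x, of True Q] w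
    by (simp add: presented_group_mult_class presented_group_one word_class_eq_iff)
  then show ?thesis
    using inv_equality word_class_carrier w by metis
qed

lemma word_class_eval:
  "w \<in> words X \<Longrightarrow> word_class X Q w = word_eval (presented_group X Q) (gen_class X Q) w"
proof (induction w)
  case Nil
  then show ?case by (simp add: presented_group_one)
next
  case (Cons a w)
  obtain b x where a: "a = (b, x)" by (cases a)
  have x: "x \<in> X" and w: "w \<in> words X" using Cons.prems by (auto simp: a words_Cons)
  have "[(b, x)] \<in> words X" using x by (simp add: words_def)
  from presented_group_mult_class[OF this w, of Q]
  have "word_class X Q (a # w) = word_class X Q [(b, x)] \<otimes>\<^bsub>presented_group X Q\<^esub> word_class X Q w"
    by (simp add: a)
  also have "word_class X Q [(b, x)] = (if b then inv\<^bsub>presented_group X Q\<^esub> gen_class X Q x else gen_class X Q x)"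
    using gen_class_inv[OF x, of Q] by simp
  finally show ?case using Cons.IH[OF w] by (simp add: a)
qed

lemma presented_group_rel:
  assumes "(v, w) \<in> Q" "v \<in> words X" "w \<in> words X"
  shows "word_eval (presented_group X Q) (gen_class X Q) v
    = word_eval (presented_group X Q) (gen_class X Q) w"
  using word_cong.rel[OF assms] assms by (simp add: word_class_eq_iff flip: word_class_eval)

lemma presented_group_induct [consumes 1, case_names one gen inv_gen]:
  fixes P :: "'g word set \<Rightarrow> bool"
  assumes A: "A \<in> carrier (presented_group X Q)"
    and one: "P \<one>\<^bsub>presented_group X Q\<^esub>"
    and gen: "\<And>x A. x \<in> X \<Longrightarrow> A \<in> carrier (presented_group X Q) \<Longrightarrow> P A \<Longrightarrow>
      P (gen_class X Q x \<otimes>\<^bsub>presented_group X Q\<^esub> A)"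
    and inv_gen: "\<And>x A. x \<in> X \<Longrightarrow> A \<in> carrier (presented_group X Q) \<Longrightarrow> P A \<Longrightarrow>
      P (inv\<^bsub>presented_group X Q\<^esub> gen_class X Q x \<otimes>\<^bsub>presented_group X Q\<^esub> A)"
  shows "P A"
proof -
  interpret group "presented_group X Q" by (rule group_presented_group)
  have "P (word_eval (presented_group X Q) (gen_class X Q) w)" if "w \<in> words X" for w
    using that
  proof (induction w)
    case (Cons a w)
    obtain b x where a: "a = (b, x)" by (cases a)
    have "x \<in> X" and w: "w \<in> words X" using Cons.prems by (auto simp: a words_Cons)
    moreover have "gen_class X Q \<in> X \<rightarrow> carrier (presented_group X Q)"
      by (auto intro: gen_class_closed)
    ultimately show ?case
      using Cons.IH gen inv_gen word_eval_closed[of "gen_class X Q" X w] by (simp add: a)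
  qed (simp add: one)
  then show ?thesis
    using presented_group_cases[OF A] word_class_eval by metis
qed

lemma presented_group_hom_eqI:
  assumes h: "h \<in> hom (presented_group X Q) H" and k: "k \<in> hom (presented_group X Q) H"
    and H: "group H"
    and gen: "\<And>x. x \<in> X \<Longrightarrow> h (gen_class X Q x) = k (gen_class X Q x)"
    and A: "A \<in> carrier (presented_group X Q)"
  shows "h A = k A"
proof -
  interpret h: group_hom "presented_group X Q" H h
    using h H by (simp add: group_hom_def group_hom_axioms_def group_presented_group)
  interpret k: group_hom "presented_group X Q" H k
    using k H by (simp add: group_hom_def group_hom_axioms_def group_presented_group)
  show ?thesis
    using A
  proof (induction rule: presented_group_induct)
    case one
    then show ?case by simp
  next
    case (gen x A)
    then show ?case using assms(4) by (simp add: gen_class_closed)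
  next
    case (inv_gen x A)
    then show ?case using assms(4) by (simp add: gen_class_closed)
  qed
qed

section \<open>Abelian stabilisers in Steinberg groups\<close>

context group
begin

definition cj :: "'a \<Rightarrow> 'a \<Rightarrow> 'a" where
  "cj g y = g \<otimes> y \<otimes> inv g"

definition cmt :: "'a \<Rightarrow> 'a \<Rightarrow> 'a" where
  "cmt y z = y \<otimes> z \<otimes> inv y \<otimes> inv z"

text \<open>The list fixes the order of the factors. Where the order turns out not to matter, this
  is derived from explicit commutation hypotheses.\<close>

definition lprod :: "('i \<Rightarrow> 'a) \<Rightarrow> 'i list \<Rightarrow> 'a" where
  "lprod f L = foldr (\<lambda>i z. f i \<otimes> z) L \<one>"

lemma lprod_simps [simp]:
  "lprod f [] = \<one>" "lprod f (i # L) = f i \<otimes> lprod f L"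
  by (simp_all add: lprod_def)

lemma lprod_closed [simp]: "(\<And>i. f i \<in> carrier G) \<Longrightarrow> lprod f L \<in> carrier G"
  by (induction L) auto

lemma lprod_cong: "(\<And>i. i \<in> set L \<Longrightarrow> f i = g i) \<Longrightarrow> lprod f L = lprod g L"
  by (induction L) auto

lemma cj_closed [simp]: "g \<in> carrier G \<Longrightarrow> y \<in> carrier G \<Longrightarrow> cj g y \<in> carrier G"
  by (simp add: cj_def)

lemma cmt_closed [simp]: "g \<in> carrier G \<Longrightarrow> y \<in> carrier G \<Longrightarrow> cmt g y \<in> carrier G"
  by (simp add: cmt_def)

lemma cj_one [simp]: "g \<in> carrier G \<Longrightarrow> cj g \<one> = \<one>"
  by (simp add: cj_def)

lemma one_cj [simp]: "y \<in> carrier G \<Longrightarrow> cj \<one> y = y"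
  by (simp add: cj_def)

lemma inv_cancel_left [simp]:
  "g \<in> carrier G \<Longrightarrow> y \<in> carrier G \<Longrightarrow> inv g \<otimes> (g \<otimes> y) = y"
  "g \<in> carrier G \<Longrightarrow> y \<in> carrier G \<Longrightarrow> g \<otimes> (inv g \<otimes> y) = y"
  by (simp_all flip: m_assoc)

lemma cj_mult:
  "g \<in> carrier G \<Longrightarrow> y \<in> carrier G \<Longrightarrow> z \<in> carrier G \<Longrightarrow> cj g (y \<otimes> z) = cj g y \<otimes> cj g z"
  by (simp add: cj_def m_assoc)

lemma cj_inv: "g \<in> carrier G \<Longrightarrow> y \<in> carrier G \<Longrightarrow> cj g (inv y) = inv (cj g y)"
  by (simp add: cj_def m_assoc inv_mult_group)

lemma cj_cj: "g \<in> carrier G \<Longrightarrow> h \<in> carrier G \<Longrightarrow> y \<in> carrier G \<Longrightarrow> cj g (cj h y) = cj (g \<otimes> h) y"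
  by (simp add: cj_def m_assoc inv_mult_group)

lemma cj_cmt:
  "g \<in> carrier G \<Longrightarrow> y \<in> carrier G \<Longrightarrow> z \<in> carrier G \<Longrightarrow> cj g (cmt y z) = cmt (cj g y) (cj g z)"
  by (simp add: cmt_def cj_mult cj_inv)

lemma cj_eq_iff:
  assumes "g \<in> carrier G" "y \<in> carrier G" "z \<in> carrier G"
  shows "cj g y = z \<longleftrightarrow> g \<otimes> y = z \<otimes> g"
  unfolding cj_def using assms by (metis inv_solve_right m_closed)

lemma cj_triv_iff:
  "g \<in> carrier G \<Longrightarrow> y \<in> carrier G \<Longrightarrow> cj g y = y \<longleftrightarrow> g \<otimes> y = y \<otimes> g"
  by (rule cj_eq_iff)

lemma cj_lprod:
  "g \<in> carrier G \<Longrightarrow> (\<And>i. f i \<in> carrier G) \<Longrightarrow> cj g (lprod f L) = lprod (\<lambda>i. cj g (f i)) L"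
  by (induction L) (simp_all add: cj_mult)

lemma commute_mult:
  assumes "g \<in> carrier G" "y \<in> carrier G" "z \<in> carrier G"
    "g \<otimes> y = y \<otimes> g" "g \<otimes> z = z \<otimes> g"
  shows "g \<otimes> (y \<otimes> z) = (y \<otimes> z) \<otimes> g"
  using assms by (metis m_assoc)

lemma commute_lprod:
  assumes "g \<in> carrier G" "\<And>i. f i \<in> carrier G" "\<And>i. i \<in> set L \<Longrightarrow> g \<otimes> f i = f i \<otimes> g"
  shows "g \<otimes> lprod f L = lprod f L \<otimes> g"
  using assms(3) by (induction L) (simp_all add: assms(1,2) commute_mult)

lemma mult_left_commute:
  assumes "y \<in> carrier G" "z \<in> carrier G" "w \<in> carrier G" "y \<otimes> z = z \<otimes> y"
  shows "y \<otimes> (z \<otimes> w) = z \<otimes> (y \<otimes> w)"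
  using assms by (metis m_assoc)

lemma lprod_mult:
  assumes f: "\<And>i. f i \<in> carrier G" and g: "\<And>i. g i \<in> carrier G"
    and c: "\<And>i j. i \<in> set L \<Longrightarrow> j \<in> set L \<Longrightarrow> g i \<otimes> f j = f j \<otimes> g i"
  shows "lprod (\<lambda>i. f i \<otimes> g i) L = lprod f L \<otimes> lprod g L"
  using c
proof (induction L)
  case (Cons a L)
  have "g a \<otimes> lprod f L = lprod f L \<otimes> g a"
    using Cons.prems by (intro commute_lprod f g) auto
  then have "g a \<otimes> (lprod f L \<otimes> lprod g L) = lprod f L \<otimes> (g a \<otimes> lprod g L)"
    by (intro mult_left_commute) (simp_all add: f g)
  then show ?case
    using Cons by (simp add: f g m_assoc)
qed simp

lemma lprod_one: "(\<And>i. i \<in> set L \<Longrightarrow> f i = \<one>) \<Longrightarrow> lprod f L = \<one>"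
  by (induction L) auto

lemma lprod_single:
  assumes "distinct L" "i \<in> set L" "\<And>i. f i \<in> carrier G"
    "\<And>j. j \<in> set L \<Longrightarrow> j \<noteq> i \<Longrightarrow> f j = \<one>"
  shows "lprod f L = f i"
  using assms
proof (induction L)
  case (Cons a L)
  show ?case
  proof (cases "a = i")
    case True
    then have "lprod f L = \<one>" using Cons.prems by (intro lprod_one) auto
    then show ?thesis using True Cons.prems(3) by simp
  next
    case False
    then show ?thesis using Cons by auto
  qed
qed simp

lemma lprod_in_subgroup:
  "subgroup H G \<Longrightarrow> (\<And>i. i \<in> set L \<Longrightarrow> f i \<in> H) \<Longrightarrow> lprod f L \<in> H"
  by (induction L) (auto intro: subgroup.one_closed subgroup.m_closed)

text \<open>In [A D, B] the factor D passes through B and cancels. This fact and its mirror image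
  below discard the correction that conjugation by a root element adds to one argument of a
  block.\<close>

lemma cmt_mult_commute_right:
  assumes "A \<in> carrier G" "B \<in> carrier G" "D \<in> carrier G" "D \<otimes> B = B \<otimes> D"
  shows "cmt (A \<otimes> D) B = cmt A B"
proof -
  have "D \<otimes> (B \<otimes> inv D) = B"
    using assms by (metis inv_closed m_assoc r_inv r_one)
  then have "D \<otimes> (B \<otimes> (inv D \<otimes> (inv A \<otimes> inv B))) = B \<otimes> (inv A \<otimes> inv B)"
    using assms by (metis inv_closed m_assoc m_closed)
  then show ?thesis
    using assms by (simp add: cmt_def inv_mult_group m_assoc)
qed

lemma cmt_commute_mult_right:
  assumes "A \<in> carrier G" "B \<in> carrier G" "D \<in> carrier G" "D \<otimes> A = A \<otimes> D"
  shows "cmt A (B \<otimes> D) = cmt A B"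
proof -
  have "D \<otimes> (inv A \<otimes> inv D) = inv A"
    using assms by (metis inv_closed inv_mult_group m_assoc r_inv r_one m_closed inv_solve_left)
  then have "D \<otimes> (inv A \<otimes> (inv D \<otimes> inv B)) = inv A \<otimes> inv B"
    using assms by (metis inv_closed m_assoc m_closed)
  then show ?thesis
    using assms by (simp add: cmt_def inv_mult_group m_assoc)
qed

lemma cmt_mult_left:
  assumes "A \<in> carrier G" "B \<in> carrier G" "C \<in> carrier G"
  shows "cmt (C \<otimes> A) B = cj C (cmt A B) \<otimes> cmt C B"
  using assms by (simp add: cmt_def cj_def inv_mult_group m_assoc)

lemma cmt_mult_right:
  assumes "A \<in> carrier G" "B \<in> carrier G" "C \<in> carrier G"
  shows "cmt A (B \<otimes> C) = cmt A B \<otimes> cj B (cmt A C)"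
  using assms by (simp add: cmt_def cj_def inv_mult_group m_assoc)

lemma cmt_eq_cj: "cmt A B = cj A B \<otimes> inv B"
  by (simp add: cmt_def cj_def)

end

text \<open>The system is abstract because it is used twice, for \<open>x_ij(r)\<close> and for
  \<open>x_ji(-r)\<close>. The family \<open>x\<close> is total and trivial on bad index pairs, so
  that products over all indices need no side conditions; the commutator relations are written as
  equations between products, free of inverses.\<close>

locale steinberg_system = group G + R: cring R for G (structure) and R (structure) +
  fixes n :: nat and x :: "nat \<Rightarrow> nat \<Rightarrow> 'c \<Rightarrow> 'a"
  assumes n: "4 \<le> n"
    and x_closed [simp]: "x i j r \<in> carrier G"
    and x_invalid: "\<not> (i \<in> {1..n} \<and> j \<in> {1..n} \<and> i \<noteq> j) \<Longrightarrow> x i j r = \<one>"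
    and x_add: "r \<in> carrier R \<Longrightarrow> s \<in> carrier R \<Longrightarrow> x i j (r \<oplus>\<^bsub>R\<^esub> s) = x i j r \<otimes> x i j s"
    and x_commute: "h \<noteq> j \<Longrightarrow> k \<noteq> i \<Longrightarrow> x i j r \<otimes> x h k s = x h k s \<otimes> x i j r"
    and x_trans: "distinct [i, j, k] \<Longrightarrow> {i, j, k} \<subseteq> {1..n} \<Longrightarrow> r \<in> carrier R \<Longrightarrow> s \<in> carrier R \<Longrightarrow>
      x i j r \<otimes> x j k s = x i k (r \<otimes>\<^bsub>R\<^esub> s) \<otimes> (x j k s \<otimes> x i j r)"
begin

abbreviation rmult (infixl "\<cdot>" 70) where "r \<cdot> s \<equiv> r \<otimes>\<^bsub>R\<^esub> s"
abbreviation radd (infixl "\<boxplus>" 65) where "r \<boxplus> s \<equiv> r \<oplus>\<^bsub>R\<^esub> s"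
abbreviation rminus ("\<ominus>\<^sub>R _" [81] 80) where "\<ominus>\<^sub>R r \<equiv> \<ominus>\<^bsub>R\<^esub> r"

lemma x_same [simp]: "x i i r = \<one>"
  by (simp add: x_invalid)

lemma x_zero [simp]: "x i j \<zero>\<^bsub>R\<^esub> = \<one>"
  using x_add[of "\<zero>\<^bsub>R\<^esub>" "\<zero>\<^bsub>R\<^esub>" i j] by simp

lemma x_inv: "r \<in> carrier R \<Longrightarrow> inv (x i j r) = x i j (\<ominus>\<^sub>R r)"
  using x_add[of "\<ominus>\<^sub>R r" r i j] by (simp add: R.l_neg inv_equality)

lemma x_cancel [simp]:
  "r \<in> carrier R \<Longrightarrow> x i j (\<ominus>\<^sub>R r) \<otimes> x i j r = \<one>"
  "r \<in> carrier R \<Longrightarrow> x i j r \<otimes> x i j (\<ominus>\<^sub>R r) = \<one>"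
  "r \<in> carrier R \<Longrightarrow> y \<in> carrier G \<Longrightarrow> x i j (\<ominus>\<^sub>R r) \<otimes> (x i j r \<otimes> y) = y"
  "r \<in> carrier R \<Longrightarrow> y \<in> carrier G \<Longrightarrow> x i j r \<otimes> (x i j (\<ominus>\<^sub>R r) \<otimes> y) = y"
  by (simp_all flip: x_inv)

lemma x_left_commute:
  "h \<noteq> j \<Longrightarrow> k \<noteq> i \<Longrightarrow> y \<in> carrier G \<Longrightarrow>
    x i j r \<otimes> (x h k s \<otimes> y) = x h k s \<otimes> (x i j r \<otimes> y)"
  by (simp add: mult_left_commute x_commute)

lemma cj_x_commute: "h \<noteq> j \<Longrightarrow> k \<noteq> i \<Longrightarrow> cj (x i j r) (x h k s) = x h k s"
  by (simp add: cj_triv_iff x_commute)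

lemma cj_x_left:
  "distinct [i, j, k] \<Longrightarrow> {i, j, k} \<subseteq> {1..n} \<Longrightarrow> r \<in> carrier R \<Longrightarrow> s \<in> carrier R \<Longrightarrow>
    cj (x i j r) (x j k s) = x i k (r \<cdot> s) \<otimes> x j k s"
  by (simp add: cj_eq_iff x_trans m_assoc)

lemma cj_x_right:
  assumes "distinct [i, j, k]" "{i, j, k} \<subseteq> {1..n}" "r \<in> carrier R" "s \<in> carrier R"
  shows "cj (x j k s) (x i j r) = x i k (\<ominus>\<^sub>R (r \<cdot> s)) \<otimes> x i j r"
proof -
  have "x i k (\<ominus>\<^sub>R (r \<cdot> s)) \<otimes> (x i k (r \<cdot> s) \<otimes> (x j k s \<otimes> x i j r)) = x j k s \<otimes> x i j r"
    using assms x_inv[of "r \<cdot> s" i k, symmetric] by simp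
  then have "x i k (\<ominus>\<^sub>R (r \<cdot> s)) \<otimes> (x i j r \<otimes> x j k s) = x j k s \<otimes> x i j r"
    using x_trans[OF assms] by simp
  then show ?thesis
    by (simp add: cj_eq_iff m_assoc)
qed

section \<open>Lifts of two-by-two blocks\<close>

definition colpart :: "nat \<Rightarrow> nat \<Rightarrow> nat \<Rightarrow> 'c \<Rightarrow> 'c \<Rightarrow> 'a" where
  "colpart k p q s t = x p k s \<otimes> x q k t"

definition rowpart :: "nat \<Rightarrow> nat \<Rightarrow> nat \<Rightarrow> 'c \<Rightarrow> 'c \<Rightarrow> 'c \<Rightarrow> 'a" where
  "rowpart k p q s t c = x k p (c \<cdot> t) \<otimes> x k q (\<ominus>\<^sub>R (c \<cdot> s))"

text \<open>
  A lift of the \<open>2 \<times> 2\<close> block \<open>1 + w (t, -s)\<close> in rows and columns \<open>p, q\<close>, where \<open>w = c (s, t)\<^sup>t\<close>,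
  obtained with the help of an auxiliary index \<open>k\<close>.
\<close>

definition block :: "nat \<Rightarrow> nat \<Rightarrow> nat \<Rightarrow> 'c \<Rightarrow> 'c \<Rightarrow> 'c \<Rightarrow> 'a" where
  "block k p q s t c = cmt (colpart k p q s t) (rowpart k p q s t c)"

lemma parts_closed [simp]:
  "colpart k p q s t \<in> carrier G" "rowpart k p q s t c \<in> carrier G" "block k p q s t c \<in> carrier G"
  by (simp_all add: colpart_def rowpart_def block_def)

text \<open>\<open>x_kl(a)\<close> commutes with the row part and multiplies the column part by
  \<open>D\<close>, whose entries sit in column l. Conjugating \<open>D\<close> by the two factors
  of the row part creates opposite entries at (k, l), since the row (t, -s) annihilates the column
  (s, t)^t; so \<open>D\<close> commutes with the row part and drops out of the commutator.\<close>

lemma block_commute_col: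
  assumes d: "distinct [p, q, k, l]" and v: "{p, q, k, l} \<subseteq> {1..n}"
    and c: "s \<in> carrier R" "t \<in> carrier R" "c \<in> carrier R" "a \<in> carrier R"
  shows "cj (x k l a) (block k p q s t c) = block k p q s t c"
proof -
  define D where "D = x p l (\<ominus>\<^sub>R (s \<cdot> a)) \<otimes> x q l (\<ominus>\<^sub>R (t \<cdot> a))"
  have [simp]: "D \<in> carrier G" by (simp add: D_def)
  have "cj (x k l a) (colpart k p q s t)
      = (x p l (\<ominus>\<^sub>R (s \<cdot> a)) \<otimes> x p k s) \<otimes> (x q l (\<ominus>\<^sub>R (t \<cdot> a)) \<otimes> x q k t)"
    using d v c by (simp add: colpart_def cj_mult cj_x_right)
  also have "\<dots> = colpart k p q s t \<otimes> D"
    unfolding D_def colpart_def using d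
    by (simp add: m_assoc x_commute mult_left_commute)
  finally have 1: "cj (x k l a) (colpart k p q s t) = colpart k p q s t \<otimes> D" .
  have 2: "cj (x k l a) (rowpart k p q s t c) = rowpart k p q s t c"
    using d v c by (simp add: rowpart_def cj_mult cj_x_commute)
  have "cj (x k q (\<ominus>\<^sub>R (c \<cdot> s))) D
      = x p l (\<ominus>\<^sub>R (s \<cdot> a)) \<otimes> (x k l (c \<cdot> s \<cdot> (t \<cdot> a)) \<otimes> x q l (\<ominus>\<^sub>R (t \<cdot> a)))"
    using d v c by (simp add: D_def cj_mult cj_x_commute cj_x_left R.l_minus R.r_minus)
  also have "cj (x k p (c \<cdot> t)) \<dots>
      = x k l (\<ominus>\<^sub>R (c \<cdot> s \<cdot> (t \<cdot> a))) \<otimes> x p l (\<ominus>\<^sub>R (s \<cdot> a)) \<otimes>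
        (x k l (c \<cdot> s \<cdot> (t \<cdot> a)) \<otimes> x q l (\<ominus>\<^sub>R (t \<cdot> a)))"
    using d v c
    by (simp add: D_def cj_mult cj_x_commute cj_x_left R.l_minus R.r_minus R.m_ac)
  also have "\<dots> = D"
    using d c by (simp add: D_def m_assoc x_left_commute[of k l l p])
  finally have "cj (rowpart k p q s t c) D = D"
    by (simp add: rowpart_def cj_cj D_def)
  then have "D \<otimes> rowpart k p q s t c = rowpart k p q s t c \<otimes> D"
    by (simp add: cj_triv_iff)
  then show ?thesis
    unfolding block_def by (simp add: cj_cmt 1 2 cmt_mult_commute_right)
qed

text \<open>The transposed situation: the row part picks up \<open>D\<close>, and the same
  orthogonality makes \<open>D\<close> commute with the column part.\<close>

lemma block_commute_row:
  assumes d: "distinct [p, q, k, l]" and v: "{p, q, k, l} \<subseteq> {1..n}"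
    and c: "s \<in> carrier R" "t \<in> carrier R" "c \<in> carrier R" "a \<in> carrier R"
  shows "cj (x l k a) (block k p q s t c) = block k p q s t c"
proof -
  define D where "D = x l p (a \<cdot> (c \<cdot> t)) \<otimes> x l q (\<ominus>\<^sub>R (a \<cdot> (c \<cdot> s)))"
  have [simp]: "D \<in> carrier G" by (simp add: D_def)
  have "cj (x l k a) (rowpart k p q s t c)
      = (x l p (a \<cdot> (c \<cdot> t)) \<otimes> x k p (c \<cdot> t)) \<otimes> (x l q (\<ominus>\<^sub>R (a \<cdot> (c \<cdot> s))) \<otimes> x k q (\<ominus>\<^sub>R (c \<cdot> s)))"
    using d v c by (simp add: rowpart_def cj_mult cj_x_left R.r_minus)
  also have "\<dots> = rowpart k p q s t c \<otimes> D"
    unfolding D_def rowpart_def using d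
    by (simp add: m_assoc x_commute mult_left_commute)
  finally have 1: "cj (x l k a) (rowpart k p q s t c) = rowpart k p q s t c \<otimes> D" .
  have 2: "cj (x l k a) (colpart k p q s t) = colpart k p q s t"
    using d v c by (simp add: colpart_def cj_mult cj_x_commute)
  have "cj (x q k t) D
      = x l p (a \<cdot> (c \<cdot> t)) \<otimes> (x l k (a \<cdot> (c \<cdot> s) \<cdot> t) \<otimes> x l q (\<ominus>\<^sub>R (a \<cdot> (c \<cdot> s))))"
    using d v c by (simp add: D_def cj_mult cj_x_commute cj_x_right R.l_minus R.r_minus)
  also have "cj (x p k s) \<dots>
      = x l k (\<ominus>\<^sub>R (a \<cdot> (c \<cdot> s) \<cdot> t)) \<otimes> x l p (a \<cdot> (c \<cdot> t)) \<otimes>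
        (x l k (a \<cdot> (c \<cdot> s) \<cdot> t) \<otimes> x l q (\<ominus>\<^sub>R (a \<cdot> (c \<cdot> s))))"
    using d v c
    by (simp add: D_def cj_mult cj_x_commute cj_x_right R.l_minus R.r_minus R.m_ac)
  also have "\<dots> = D"
    using d c by (simp add: D_def m_assoc x_left_commute[of l p k l])
  finally have "cj (colpart k p q s t) D = D"
    by (simp add: colpart_def cj_cj D_def)
  then have "D \<otimes> colpart k p q s t = colpart k p q s t \<otimes> D"
    by (simp add: cj_triv_iff)
  then show ?thesis
    unfolding block_def by (simp add: cj_cmt 1 2 cmt_commute_mult_right)
qed

text \<open>\<open>w\<close> is a Weyl element carrying the auxiliary index k to l in both parts.
  Each of its three factors fixes the block by the two preceding facts, so the block for k equals
  the block for l. This costs a fourth index.\<close>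

lemma block_index_eq:
  assumes d: "distinct [p, q, k, l]" and v: "{p, q, k, l} \<subseteq> {1..n}"
    and c: "s \<in> carrier R" "t \<in> carrier R" "c \<in> carrier R"
  shows "block k p q s t c = block l p q s t c"
proof -
  define w where "w = x k l (\<ominus>\<^sub>R \<one>\<^bsub>R\<^esub>) \<otimes> (x l k \<one>\<^bsub>R\<^esub> \<otimes> x k l (\<ominus>\<^sub>R \<one>\<^bsub>R\<^esub>))"
  have [simp]: "w \<in> carrier G" by (simp add: w_def)
  have w: "cj w y = cj (x k l (\<ominus>\<^sub>R \<one>\<^bsub>R\<^esub>)) (cj (x l k \<one>\<^bsub>R\<^esub>) (cj (x k l (\<ominus>\<^sub>R \<one>\<^bsub>R\<^esub>)) y))"
    if "y \<in> carrier G" for y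
    using that by (simp add: w_def cj_cj)
  have col: "cj w (x i k r) = x i l r" if "i \<in> {1..n}" "i \<noteq> k" "i \<noteq> l" "r \<in> carrier R" for i r
    using that d v
    by (simp add: w cj_mult cj_x_right cj_x_commute R.r_minus m_assoc x_commute[of i l k i] x_left_commute[of i l k i])
  have row: "cj w (x k j r) = x l j r" if "j \<in> {1..n}" "j \<noteq> k" "j \<noteq> l" "r \<in> carrier R" for j r
    using that d v
    by (simp add: w cj_mult cj_x_left cj_x_commute R.l_minus m_assoc x_commute[of k j j l] x_left_commute[of k j j l])
  have "cj w (colpart k p q s t) = colpart l p q s t"
    using d v c by (simp add: colpart_def cj_mult col)
  moreover have "cj w (rowpart k p q s t c) = rowpart l p q s t c"
    using d v c by (simp add: rowpart_def cj_mult row)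
  moreover have "cj w (block k p q s t c) = block k p q s t c"
    using block_commute_row[OF d v c] block_commute_col[OF d v c] by (simp add: w)
  ultimately show ?thesis
    unfolding block_def by (simp add: cj_cmt)
qed

lemma block_swap:
  assumes "p \<noteq> q" "s \<in> carrier R" "t \<in> carrier R" "c \<in> carrier R"
    "p \<noteq> k" "q \<noteq> k"
  shows "block k q p t s (\<ominus>\<^sub>R c) = block k p q s t c"
proof -
  have "colpart k q p t s = colpart k p q s t"
    using assms by (simp add: colpart_def x_commute)
  moreover have "rowpart k q p t s (\<ominus>\<^sub>R c) = rowpart k p q s t c"
    using assms by (simp add: rowpart_def x_commute R.l_minus R.r_minus)
  ultimately show ?thesis by (simp add: block_def)
qed

text \<open>A shear in the plane of p and q preserves the symplectic form, so the column (s, t)^t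
  and the row (t, -s) change consistently and c stays the same.\<close>

lemma cj_block_inner:
  assumes d: "distinct [p, q, k]" and v: "{p, q, k} \<subseteq> {1..n}"
    and c: "s \<in> carrier R" "t \<in> carrier R" "c \<in> carrier R" "a \<in> carrier R"
  shows "cj (x p q a) (block k p q s t c) = block k p q (s \<boxplus> a \<cdot> t) t c"
proof -
  have "cj (x p q a) (colpart k p q s t) = colpart k p q (s \<boxplus> a \<cdot> t) t"
    using d v c by (simp add: colpart_def cj_mult cj_x_left cj_x_commute x_add m_assoc)
  moreover have "cj (x p q a) (rowpart k p q s t c) = rowpart k p q (s \<boxplus> a \<cdot> t) t c"
    using d v c
    by (simp add: rowpart_def cj_mult cj_x_right cj_x_commute x_add m_assoc
        R.r_distr R.minus_add R.l_minus R.r_minus R.m_ac x_commute[of k p q k] x_left_commute[of k p q k] x_left_commute[of k q q k])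
  ultimately show ?thesis by (simp add: block_def cj_cmt)
qed

text \<open>The column part gains a factor \<open>x_ik(as)\<close>. By
  \<open>block_commute_row\<close> this factor does not move the block, and its commutator with the
  row part is the row that appears at i.\<close>

lemma cj_block_outer:
  assumes d: "distinct [p, q, k, i]" and v: "{p, q, k, i} \<subseteq> {1..n}"
    and c: "s \<in> carrier R" "t \<in> carrier R" "c \<in> carrier R" "a \<in> carrier R"
  shows "cj (x i p a) (block k p q s t c) =
    block k p q s t c \<otimes> (x i p (a \<cdot> s \<cdot> (c \<cdot> t)) \<otimes> x i q (\<ominus>\<^sub>R (a \<cdot> s \<cdot> (c \<cdot> s))))"
proof -
  have "cj (x i p a) (colpart k p q s t) = x i k (a \<cdot> s) \<otimes> colpart k p q s t"
    using d v c by (simp add: colpart_def cj_mult cj_x_left cj_x_commute m_assoc)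
  moreover have "cj (x i p a) (rowpart k p q s t c) = rowpart k p q s t c"
    using d v c by (simp add: rowpart_def cj_mult cj_x_commute)
  ultimately have "cj (x i p a) (block k p q s t c)
      = cmt (x i k (a \<cdot> s) \<otimes> colpart k p q s t) (rowpart k p q s t c)"
    by (simp add: block_def cj_cmt)
  also have "\<dots> = cj (x i k (a \<cdot> s)) (block k p q s t c) \<otimes> cmt (x i k (a \<cdot> s)) (rowpart k p q s t c)"
    by (simp add: cmt_mult_left block_def)
  also have "cj (x i k (a \<cdot> s)) (block k p q s t c) = block k p q s t c"
    using d v c by (intro block_commute_row) auto
  also have "cmt (x i k (a \<cdot> s)) (rowpart k p q s t c)
      = x i p (a \<cdot> s \<cdot> (c \<cdot> t)) \<otimes> x i q (\<ominus>\<^sub>R (a \<cdot> s \<cdot> (c \<cdot> s)))"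
  proof -
    have "cj (x i k (a \<cdot> s)) (rowpart k p q s t c)
      = x i p (a \<cdot> s \<cdot> (c \<cdot> t)) \<otimes> x i q (\<ominus>\<^sub>R (a \<cdot> s \<cdot> (c \<cdot> s))) \<otimes> rowpart k p q s t c"
      using d v c
      by (simp add: rowpart_def cj_mult cj_x_left R.r_minus m_assoc x_commute mult_left_commute)
    then show ?thesis by (simp add: cmt_eq_cj m_assoc)
  qed
  finally show ?thesis .
qed

end

context group begin

lemma lprod_times_single:
  assumes "distinct L" "j \<in> set L" "\<And>h. f h \<in> carrier G" "y \<in> carrier G"
    "\<And>h. h \<in> set L \<Longrightarrow> y \<otimes> f h = f h \<otimes> y"
  shows "lprod (\<lambda>h. f h \<otimes> (if h = j then y else \<one>)) L = lprod f L \<otimes> y"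
proof -
  have "lprod (\<lambda>h. f h \<otimes> (if h = j then y else \<one>)) L
      = lprod f L \<otimes> lprod (\<lambda>h. if h = j then y else \<one>) L"
    using assms by (intro lprod_mult) auto
  also have "lprod (\<lambda>h. if h = j then y else \<one>) L = y"
    using lprod_single[of L j "\<lambda>h. if h = j then y else \<one>"] assms by simp
  finally show ?thesis .
qed

lemma cj_lprod_left:
  assumes f: "\<And>i. f i \<in> carrier G" and g: "\<And>i. g i \<in> carrier G" and B: "B \<in> carrier G"
    and e: "\<And>i. i \<in> set L \<Longrightarrow> cj (f i) B = g i \<otimes> B"
    and c: "\<And>i j. i \<in> set L \<Longrightarrow> j \<in> set L \<Longrightarrow> f i \<otimes> g j = g j \<otimes> f i"
    and d: "\<And>i j. i \<in> set L \<Longrightarrow> j \<in> set L \<Longrightarrow> g i \<otimes> g j = g j \<otimes> g i"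
  shows "cj (lprod f L) B = lprod g L \<otimes> B"
  using e c d
proof (induction L)
  case (Cons a L)
  have "f a \<otimes> lprod g L = lprod g L \<otimes> f a"
    by (intro commute_lprod f g) (use Cons.prems in auto)
  then have 1: "cj (f a) (lprod g L) = lprod g L"
    by (simp add: cj_triv_iff f g)
  have "g a \<otimes> lprod g L = lprod g L \<otimes> g a"
    by (intro commute_lprod g) (use Cons.prems in auto)
  then show ?case
    using Cons mult_left_commute[of "g a" "lprod g L" B]
    by (simp add: f g B cj_mult 1 m_assoc flip: cj_cj)
qed (simp add: B)

end

definition indices :: "nat \<Rightarrow> nat list" where
  "indices n = [1..<Suc n]"

lemma set_indices [simp]: "set (indices n) = {1..n}"
  by (auto simp: indices_def)

lemma distinct_indices [simp]: "distinct (indices n)"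
  by (simp add: indices_def)

section \<open>Koszul elements and their conjugates under root elements\<close>

context steinberg_system begin

text \<open>Four values cannot all lie among three indices. This is where \<open>4 \<le> n\<close>
  pays off: the case distinctions below occupy at most three indices and ask for one more.\<close>

lemma fresh_index:
  obtains l where "l \<in> {1..n}" "l \<noteq> i" "l \<noteq> j" "l \<noteq> k"
proof -
  have "1 \<notin> {i, j, k} \<or> 2 \<notin> {i, j, k} \<or> 3 \<notin> {i, j, k} \<or> 4 \<notin> {i, j, k}" by auto
  then show thesis
    using that[of 1] that[of 2] that[of 3] that[of 4] n by (elim disjE) auto
qed

text \<open>Weaker than membership in \<open>columns\<close>: values outside 1..n are unconstrained,
  so updated functions need no extensionality argument.\<close>

definition vec :: "(nat \<Rightarrow> 'c) \<Rightarrow> bool" where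
  "vec u \<longleftrightarrow> (\<forall>i\<in>{1..n}. u i \<in> carrier R)"

lemma vecD: "vec u \<Longrightarrow> i \<in> {1..n} \<Longrightarrow> u i \<in> carrier R"
  by (simp add: vec_def)

abbreviation idx :: "nat list" where "idx \<equiv> indices n"

abbreviation shear :: "nat \<Rightarrow> nat \<Rightarrow> 'c \<Rightarrow> (nat \<Rightarrow> 'c) \<Rightarrow> nat \<Rightarrow> 'c" where
  "shear i j a u \<equiv> u(i := u i \<boxplus> a \<cdot> u j)"

lemma vec_shear: "vec u \<Longrightarrow> i \<in> {1..n} \<Longrightarrow> j \<in> {1..n} \<Longrightarrow> a \<in> carrier R \<Longrightarrow> vec (shear i j a u)"
  by (auto simp: vec_def)

text \<open>The entries of u v^t in row i. Rows p and q are left out: the two-by-two block there has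
  diagonal entries and is supplied by \<open>block\<close>.\<close>

definition outer :: "nat \<Rightarrow> nat \<Rightarrow> (nat \<Rightarrow> 'c) \<Rightarrow> 'c \<Rightarrow> nat \<Rightarrow> 'a" where
  "outer p q u c i =
     (if i = p \<or> i = q then \<one> else x i p (u i \<cdot> (c \<cdot> u q)) \<otimes> x i q (\<ominus>\<^sub>R (u i \<cdot> (c \<cdot> u p))))"

text \<open>A lift of \<open>1 + u v\<^sup>t\<close> for the Koszul vector \<open>v = c (u\<^sub>q e\<^sub>p - u\<^sub>p e\<^sub>q)\<close>.\<close>

definition koszul :: "nat \<Rightarrow> nat \<Rightarrow> nat \<Rightarrow> (nat \<Rightarrow> 'c) \<Rightarrow> 'c \<Rightarrow> 'a" where
  "koszul k p q u c = block k p q (u p) (u q) c \<otimes> lprod (outer p q u c) idx"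

text \<open>A lift of 1 + u e_l^t with the l-th entry of u omitted, since \<open>x l l\<close> is
  trivial.\<close>

definition colall :: "nat \<Rightarrow> (nat \<Rightarrow> 'c) \<Rightarrow> 'a" where
  "colall l u = lprod (\<lambda>i. x i l (u i)) idx"

lemma outer_closed [simp]: "outer p q u c i \<in> carrier G"
  by (simp add: outer_def)

lemma koszul_closed [simp]: "koszul k p q u c \<in> carrier G"
  by (simp add: koszul_def)

lemma colall_closed [simp]: "colall k u \<in> carrier G"
  by (simp add: colall_def)

lemma outer_commute_gen:
  assumes "i \<noteq> p" "i \<noteq> q" "j \<noteq> p" "j \<noteq> q"
  shows "x i p r \<otimes> x i q s \<otimes> (x j p r' \<otimes> x j q s') = x j p r' \<otimes> x j q s' \<otimes> (x i p r \<otimes> x i q s)"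
proof -
  have *: "x i h r \<otimes> (x j p r' \<otimes> x j q s') = x j p r' \<otimes> x j q s' \<otimes> x i h r" if "h = p \<or> h = q" for h r
    using that assms by (intro commute_mult x_closed x_commute) auto
  show ?thesis
    using commute_mult[of "x j p r' \<otimes> x j q s'" "x i p r" "x i q s"] *[of p r] *[of q s] by simp
qed

lemma outer_commute:
  assumes "i \<noteq> p" "i \<noteq> q"
  shows "x i p r \<otimes> x i q s \<otimes> outer p q u c j = outer p q u c j \<otimes> (x i p r \<otimes> x i q s)"
  using assms by (auto simp: outer_def outer_commute_gen)

lemma koszul_index_eq:
  assumes "distinct [p, q, k]" "distinct [p, q, l]" "{p, q, k, l} \<subseteq> {1..n}" "vec u" "c \<in> carrier R"
  shows "koszul k p q u c = koszul l p q u c"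
proof (cases "k = l")
  case False
  then show ?thesis
    using assms block_index_eq[of p q k l "u p" "u q" c] by (simp add: koszul_def vecD)
qed simp

lemma koszul_swap:
  assumes "distinct [p, q, k]" "{p, q, k} \<subseteq> {1..n}" "vec u" "c \<in> carrier R"
  shows "koszul k q p u (\<ominus>\<^sub>R c) = koszul k p q u c"
proof -
  have "outer q p u (\<ominus>\<^sub>R c) i = outer p q u c i" if "i \<in> set idx" for i
  proof -
    have "i \<in> {1..n}" using that by auto
    then show ?thesis
      using assms by (auto simp: outer_def vecD R.l_minus R.r_minus x_commute)
  qed
  then have "lprod (outer q p u (\<ominus>\<^sub>R c)) idx = lprod (outer p q u c) idx"
    by (rule lprod_cong)
  then show ?thesis
    using assms block_swap[of p q "u p" "u q" c k] by (simp add: koszul_def vecD)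
qed

text \<open>With i as auxiliary index the block is fixed by \<open>block_commute_col\<close>. The
  Koszul vector involves neither u_i nor u_j, so only row i changes: it gains a times row j. The
  correction \<open>y\<close> arises next to the factor for j and is then carried over to the factor
  for i.\<close>

lemma cj_koszul_disjoint:
  assumes d: "distinct [p, q, i, j]" "{p, q, i, j} \<subseteq> {1..n}" and u: "vec u"
    and c: "c \<in> carrier R" "a \<in> carrier R"
  shows "cj (x i j a) (koszul i p q u c) = koszul i p q (shear i j a u) c"
proof -
  define y where "y = x i p (a \<cdot> (u j \<cdot> (c \<cdot> u q))) \<otimes> x i q (\<ominus>\<^sub>R (a \<cdot> (u j \<cdot> (c \<cdot> u p))))"
  have y [simp]: "y \<in> carrier G" by (simp add: y_def)
  have yc: "y \<otimes> outer p q u c h = outer p q u c h \<otimes> y" for h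
    unfolding y_def using d by (intro outer_commute) auto
  have uc: "u p \<in> carrier R" "u q \<in> carrier R" "u i \<in> carrier R" "u j \<in> carrier R"
    using u d by (auto simp: vecD)
  have "cj (x i j a) (outer p q u c h) = outer p q u c h \<otimes> (if h = j then y else \<one>)"
    if "h \<in> set idx" for h
  proof -
    consider "h = p \<or> h = q" | "h = j" | "h \<noteq> p" "h \<noteq> q" "h \<noteq> j" by blast
    then show ?thesis
    proof cases
      case 1
      then show ?thesis using d by (auto simp: outer_def)
    next
      case 2
      have "cj (x i j a) (outer p q u c j) = y \<otimes> outer p q u c j"
        using d c uc unfolding y_def
        by (simp add: outer_def cj_mult cj_x_left R.r_minus m_assoc x_left_commute[of i p q j])
      then show ?thesis using 2 by (simp add: yc)
    next
      case 3
      then show ?thesis using d by (auto simp: outer_def cj_mult cj_x_commute)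
    qed
  qed
  then have "cj (x i j a) (lprod (outer p q u c) idx)
      = lprod (\<lambda>h. outer p q u c h \<otimes> (if h = j then y else \<one>)) idx"
    unfolding cj_lprod[OF x_closed outer_closed] by (rule lprod_cong)
  also have "\<dots> = lprod (outer p q u c) idx \<otimes> y"
    using d by (intro lprod_times_single) (auto simp: yc)
  also have "\<dots> = lprod (\<lambda>h. outer p q u c h \<otimes> (if h = i then y else \<one>)) idx"
    using d by (intro lprod_times_single[symmetric]) (auto simp: yc)
  also have "\<dots> = lprod (outer p q (shear i j a u) c) idx"
  proof (rule lprod_cong)
    fix h assume "h \<in> set idx"
    show "outer p q u c h \<otimes> (if h = i then y else \<one>) = outer p q (shear i j a u) c h"
      using d c uc
      by (auto simp: outer_def y_def x_add R.l_distr R.minus_add R.m_assoc m_assoc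
          x_left_commute[of i q p i])
  qed
  finally have "cj (x i j a) (lprod (outer p q u c) idx) = lprod (outer p q (shear i j a u) c) idx" .
  moreover have "cj (x i j a) (block i p q (u p) (u q) c) = block i p q (u p) (u q) c"
    using d c uc by (intro block_commute_col) auto
  ultimately show ?thesis
    using d by (auto simp: koszul_def cj_mult)
qed

lemma cj_koszul_inner:
  assumes d: "distinct [p, q, k]" "{p, q, k} \<subseteq> {1..n}" and u: "vec u"
    and c: "c \<in> carrier R" "a \<in> carrier R"
  shows "cj (x p q a) (koszul k p q u c) = koszul k p q (shear p q a u) c"
proof -
  have uc: "u p \<in> carrier R" "u q \<in> carrier R"
    using u d by (auto simp: vecD)
  have "cj (x p q a) (outer p q u c h) = outer p q (shear p q a u) c h" if "h \<in> set idx" for h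
  proof -
    have "h \<in> {1..n}" using that by auto
    moreover from this have "u h \<in> carrier R" using u by (rule vecD[rotated])
    moreover have "u h \<cdot> (c \<cdot> u q) \<cdot> a = u h \<cdot> (c \<cdot> (a \<cdot> u q))"
      using c uc \<open>u h \<in> carrier R\<close> by (simp add: R.m_ac)
    ultimately show ?thesis
      using d c uc
      by (auto simp: outer_def cj_mult cj_x_right cj_x_commute R.r_distr R.minus_add x_add
          m_assoc x_commute[of h p q h] x_left_commute[of h p q h]
          x_left_commute[of h q q h])
  qed
  then have "cj (x p q a) (lprod (outer p q u c) idx) = lprod (outer p q (shear p q a u) c) idx"
    unfolding cj_lprod[OF x_closed outer_closed] by (rule lprod_cong)
  moreover have "cj (x p q a) (block k p q (u p) (u q) c) = block k p q (u p \<boxplus> a \<cdot> u q) (u q) c"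
    using d c uc by (intro cj_block_inner) auto
  ultimately show ?thesis
    using d by (auto simp: koszul_def cj_mult)
qed

text \<open>Row i must gain a times row p of u v^t, and this is the term created by
  \<open>cj_block_outer\<close>; the outer rows themselves are fixed.\<close>

lemma cj_koszul_enter:
  assumes d: "distinct [p, q, k, i]" "{p, q, k, i} \<subseteq> {1..n}" and u: "vec u"
    and c: "c \<in> carrier R" "a \<in> carrier R"
  shows "cj (x i p a) (koszul k p q u c) = koszul k p q (shear i p a u) c"
proof -
  have uc: "u p \<in> carrier R" "u q \<in> carrier R" "u i \<in> carrier R"
    using u d by (auto simp: vecD)
  define y where "y = x i p (a \<cdot> u p \<cdot> (c \<cdot> u q)) \<otimes> x i q (\<ominus>\<^sub>R (a \<cdot> u p \<cdot> (c \<cdot> u p)))"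
  have y [simp]: "y \<in> carrier G" by (simp add: y_def)
  have yc: "y \<otimes> outer p q u c h = outer p q u c h \<otimes> y" for h
    unfolding y_def using d by (intro outer_commute) auto
  have "cj (x i p a) (outer p q u c h) = outer p q u c h" for h
    using d by (auto simp: outer_def cj_mult cj_x_commute)
  then have "cj (x i p a) (lprod (outer p q u c) idx) = lprod (outer p q u c) idx"
    by (simp add: cj_lprod)
  moreover have "cj (x i p a) (block k p q (u p) (u q) c) = block k p q (u p) (u q) c \<otimes> y"
    unfolding y_def using d c uc by (intro cj_block_outer) auto
  ultimately have "cj (x i p a) (koszul k p q u c)
      = block k p q (u p) (u q) c \<otimes> (y \<otimes> lprod (outer p q u c) idx)"
    by (simp add: koszul_def cj_mult m_assoc)
  also have "y \<otimes> lprod (outer p q u c) idx = lprod (outer p q u c) idx \<otimes> y"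
    by (intro commute_lprod) (auto simp: yc)
  also have "\<dots> = lprod (\<lambda>h. outer p q u c h \<otimes> (if h = i then y else \<one>)) idx"
    using d by (intro lprod_times_single[symmetric]) (auto simp: yc)
  also have "\<dots> = lprod (outer p q (shear i p a u) c) idx"
  proof (rule lprod_cong)
    fix h assume "h \<in> set idx"
    show "outer p q u c h \<otimes> (if h = i then y else \<one>) = outer p q (shear i p a u) c h"
      using d c uc
      by (auto simp: outer_def y_def x_add R.l_distr R.minus_add m_assoc
          x_left_commute[of i q p i])
  qed
  finally show ?thesis
    using d by (auto simp: koszul_def)
qed


lemma colall_split:
  assumes d: "distinct [p, q, l]" "{p, q, l} \<subseteq> {1..n}"
  shows "colall l u = lprod (\<lambda>i. if i = p \<or> i = q then \<one> else x i l (u i)) idx \<otimes> colpart l p q (u p) (u q)"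
proof -
  let ?f = "\<lambda>i. if i = p \<or> i = q then \<one> else x i l (u i)"
  have c: "x i l r \<otimes> x j l s = x j l s \<otimes> x i l r" for i j r s
    using x_commute[of j l l i] by (cases "i = l \<or> j = l") auto
  have "colall l u = lprod (\<lambda>i. (?f i \<otimes> (if i = p then x p l (u p) else \<one>)) \<otimes> (if i = q then x q l (u q) else \<one>)) idx"
    unfolding colall_def using d by (intro lprod_cong) auto
  also have "\<dots> = lprod (\<lambda>i. ?f i \<otimes> (if i = p then x p l (u p) else \<one>)) idx \<otimes> x q l (u q)"
    using d by (intro lprod_times_single) (auto simp: c)
  also have "lprod (\<lambda>i. ?f i \<otimes> (if i = p then x p l (u p) else \<one>)) idx = lprod ?f idx \<otimes> x p l (u p)"
    using d by (intro lprod_times_single) (auto simp: c)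
  finally show ?thesis
    by (simp add: colpart_def m_assoc)
qed

text \<open>The whole element, not just its block, comes from a commutator of the column u with the
  row v^t placed in row l. The column factor has no l-th entry, hence the separate row factor with
  coefficient \<open>u l \<cdot> c\<close>. In this form a sum of two row vectors can be split, as
  \<open>cj_koszul_leave\<close> requires.\<close>

lemma koszul_eq_cmt:
  assumes d: "distinct [p, q, l]" "{p, q, l} \<subseteq> {1..n}" and u: "vec u" and c: "c \<in> carrier R"
  shows "koszul l p q u c = cmt (colall l u) (rowpart l p q (u p) (u q) c) \<otimes> rowpart l p q (u p) (u q) (u l \<cdot> c)"
proof -
  have uc: "u p \<in> carrier R" "u q \<in> carrier R" "u l \<in> carrier R"
    using u d by (auto simp: vecD)
  let ?f = "\<lambda>i. if i = p \<or> i = q then \<one> else x i l (u i)"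
  let ?g = "\<lambda>i. if i = l then \<one> else outer p q u c i"
  let ?B = "rowpart l p q (u p) (u q) c"
  let ?A = "colpart l p q (u p) (u q)"
  have "cj (lprod ?f idx) ?B = lprod ?g idx \<otimes> ?B"
  proof (rule cj_lprod_left)
    fix i assume "i \<in> set idx"
    then have i: "i \<in> {1..n}" by auto
    then have "u i \<in> carrier R" using u by (simp add: vecD)
    then show "cj (?f i) ?B = ?g i \<otimes> ?B"
      using d c uc i
      by (auto simp: rowpart_def outer_def cj_mult cj_x_left R.r_minus m_assoc x_left_commute[of i p q l])
  next
    fix i j
    have "x i l r \<otimes> outer p q u c j = outer p q u c j \<otimes> x i l r" if "i \<noteq> p" "i \<noteq> q" "j \<noteq> l" for r
      unfolding outer_def using that x_commute[of j l p i] x_commute[of j l q i]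
      by (auto intro!: commute_mult)
    then show "?f i \<otimes> ?g j = ?g j \<otimes> ?f i" by auto
    show "?g i \<otimes> ?g j = ?g j \<otimes> ?g i"
      using outer_commute[of i p q _ _ u c j] by (auto simp: outer_def[of p q u c i])
  qed auto
  then have 1: "cmt (lprod ?f idx) ?B = lprod ?g idx"
    by (simp add: cmt_eq_cj m_assoc)
  have "cj (x i l a) (block l p q (u p) (u q) c) = block l p q (u p) (u q) c"
    if "i \<in> {1..n}" "i \<noteq> p" "i \<noteq> q" "a \<in> carrier R" for i a
    using that d c uc by (cases "i = l") (auto intro!: block_commute_row)
  then have "?f i \<otimes> block l p q (u p) (u q) c = block l p q (u p) (u q) c \<otimes> ?f i"
    if "i \<in> set idx" for i
    using that u by (auto simp: vecD cj_triv_iff)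
  then have "block l p q (u p) (u q) c \<otimes> lprod ?f idx = lprod ?f idx \<otimes> block l p q (u p) (u q) c"
    by (intro commute_lprod) auto
  then have "cj (lprod ?f idx) (block l p q (u p) (u q) c) = block l p q (u p) (u q) c"
    by (simp add: cj_triv_iff)
  then have "cmt (colall l u) ?B = block l p q (u p) (u q) c \<otimes> lprod ?g idx"
    using colall_split[OF d] 1 by (simp add: cmt_mult_left block_def)
  moreover have "lprod (outer p q u c) idx = lprod ?g idx \<otimes> rowpart l p q (u p) (u q) (u l \<cdot> c)"
  proof -
    have e: "outer p q u c l = rowpart l p q (u p) (u q) (u l \<cdot> c)"
      using d c uc by (simp add: outer_def rowpart_def R.m_assoc)
    have "lprod (outer p q u c) idx = lprod (\<lambda>i. ?g i \<otimes> (if i = l then outer p q u c l else \<one>)) idx"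
      by (intro lprod_cong) auto
    also have "\<dots> = lprod ?g idx \<otimes> outer p q u c l"
      using d outer_commute[of l p q _ _ u c] outer_def[of p q u c l]
      by (intro lprod_times_single) auto
    finally show ?thesis by (simp add: e)
  qed
  ultimately show ?thesis
    by (simp add: koszul_def m_assoc)
qed

lemma cj_colall:
  assumes d: "distinct [p, j, l]" "{p, j, l} \<subseteq> {1..n}" and u: "vec u" and a: "a \<in> carrier R"
  shows "cj (x p j a) (colall l u) = colall l (shear p j a u)"
proof -
  have uc: "u p \<in> carrier R" "u j \<in> carrier R"
    using u d by (auto simp: vecD)
  have c: "x i l r \<otimes> x h l s = x h l s \<otimes> x i l r" for i h r s
    using x_commute[of h l l i] by (cases "i = l \<or> h = l") auto
  have "cj (x p j a) (x h l (u h)) = x h l (u h) \<otimes> (if h = j then x p l (a \<cdot> u j) else \<one>)" for h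
    using d a uc by (auto simp: cj_x_left cj_x_commute c)
  then have "cj (x p j a) (colall l u)
      = lprod (\<lambda>h. x h l (u h) \<otimes> (if h = j then x p l (a \<cdot> u j) else \<one>)) idx"
    by (simp add: colall_def cj_lprod)
  also have "\<dots> = lprod (\<lambda>h. x h l (u h)) idx \<otimes> x p l (a \<cdot> u j)"
    using d by (intro lprod_times_single) (auto simp: c)
  also have "\<dots> = lprod (\<lambda>h. x h l (u h) \<otimes> (if h = p then x p l (a \<cdot> u j) else \<one>)) idx"
    using d by (intro lprod_times_single[symmetric]) (auto simp: c)
  also have "\<dots> = colall l (shear p j a u)"
    unfolding colall_def using a uc by (intro lprod_cong) (auto simp: x_add)
  finally show ?thesis .
qed

text \<open>The two shears of \<open>u\<^sub>l\<close> caused by the factors of the row part cancel.\<close>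

lemma rowpart_commute:
  assumes d: "distinct [p, q, j, l]" "{p, q, j, l} \<subseteq> {1..n}" and u: "vec u"
    and c: "c \<in> carrier R" "c' \<in> carrier R"
  shows "cj (rowpart l p q (u p) (u q) c) (koszul l q j u c') = koszul l q j u c'"
proof -
  have uc: "u p \<in> carrier R" "u q \<in> carrier R" "u l \<in> carrier R"
    using u d by (auto simp: vecD)
  define u' where "u' = shear l q (\<ominus>\<^sub>R (c \<cdot> u p)) u"
  have u': "vec u'" unfolding u'_def using u d c uc by (intro vec_shear) auto
  have "koszul l q j u c' = koszul p q j u c'"
    using d c u by (intro koszul_index_eq) auto
  then have 1: "cj (x l q (\<ominus>\<^sub>R (c \<cdot> u p))) (koszul l q j u c') = koszul p q j u' c'"
    unfolding u'_def using d c uc u by (simp add: cj_koszul_enter)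
  have "koszul p q j u' c' = koszul l q j u' c'"
    using d c u' by (intro koszul_index_eq) auto
  then have "cj (x l p (c \<cdot> u q)) (koszul p q j u' c') = koszul l q j (shear l p (c \<cdot> u q) u') c'"
    using d c uc u' by (simp add: cj_koszul_disjoint)
  also have "shear l p (c \<cdot> u q) u' = u"
  proof -
    have "u l \<boxplus> \<ominus>\<^sub>R (c \<cdot> u p) \<cdot> u q \<boxplus> c \<cdot> u q \<cdot> u p = u l"
    proof -
      have "\<ominus>\<^sub>R (c \<cdot> u p) \<cdot> u q \<boxplus> c \<cdot> u q \<cdot> u p = \<zero>\<^bsub>R\<^esub>"
        using c uc by (simp add: R.l_minus R.r_minus R.m_ac R.l_neg)
      then show ?thesis using c uc by (simp add: R.a_assoc)
    qed
    then show ?thesis using d by (auto simp: u'_def)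
  qed
  finally show ?thesis
    using 1 by (simp add: rowpart_def flip: cj_cj)
qed

text \<open>Behind this is the identity c(u_q e_p - u_p e_q) - c a u_q e_j = c(u_q e_p - u'_p e_q) +
  c a (u_j e_q - u_q e_j), where u'_p = u_p + a u_j: one Koszul vector becomes two. The row part
  splits accordingly, and the commutator follows because the first row part commutes with the second
  commutator.\<close>

lemma cj_koszul_leave:
  assumes d: "distinct [p, q, j, l]" "{p, q, j, l} \<subseteq> {1..n}" and u: "vec u"
    and c: "c \<in> carrier R" "a \<in> carrier R"
  defines "u' \<equiv> shear p j a u"
  shows "cj (x p j a) (koszul l p q u c) = koszul l p q u' c \<otimes> koszul l q j u' (c \<cdot> a)"
proof -
  have uc: "u p \<in> carrier R" "u q \<in> carrier R" "u l \<in> carrier R" "u j \<in> carrier R"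
    using u d by (auto simp: vecD)
  have u': "vec u'" unfolding u'_def using u d c by (intro vec_shear) auto
  have e: "u' q = u q" "u' j = u j" "u' l = u l" "u' p = u p \<boxplus> a \<cdot> u j"
    using d by (auto simp: u'_def)
  have row: "cj (x p j a) (rowpart l p q (u p) (u q) b)
      = rowpart l p q (u' p) (u' q) b \<otimes> rowpart l q j (u' q) (u' j) (b \<cdot> a)"
    if b: "b \<in> carrier R" for b
  proof -
    have "b \<cdot> a \<cdot> u j = b \<cdot> (a \<cdot> u j)" "b \<cdot> u q \<cdot> a = b \<cdot> a \<cdot> u q"
      using b c uc by (simp_all add: R.m_ac)
    then show ?thesis
      using d c uc b
      by (simp add: rowpart_def e cj_mult cj_x_right cj_x_commute R.r_distr R.minus_add x_add
          m_assoc x_commute[of l p j l] x_commute[of l q j l]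
          x_left_commute[of l p j l] x_left_commute[of l q j l])
  qed
  let ?C = "colall l u'"
  let ?B1 = "\<lambda>b. rowpart l p q (u' p) (u' q) b" and ?B2 = "\<lambda>b. rowpart l q j (u' q) (u' j) (b \<cdot> a)"
  have k2: "koszul l q j u' (c \<cdot> a) = cmt ?C (?B2 c) \<otimes> ?B2 (u l \<cdot> c)"
    using d c u' uc by (simp add: koszul_eq_cmt e R.m_assoc)
  \<comment> \<open>By \<open>rowpart_commute\<close> the entire Koszul element is fixed; its
    trailing row factor commutes with \<open>?B1 b\<close> anyway and is cancelled, which leaves the
    commutator.\<close>
  have c2: "?B1 b \<otimes> cmt ?C (?B2 c) = cmt ?C (?B2 c) \<otimes> ?B1 b" if b: "b \<in> carrier R" for b
  proof -
    have "?B1 b \<otimes> ?B2 b' = ?B2 b' \<otimes> ?B1 b" for b'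
    proof -
      have "x l i r \<otimes> x l k s = x l k s \<otimes> x l i r" for i k r s
        using x_commute[of l i k l] by (cases "i = l \<or> k = l") auto
      then show ?thesis
        unfolding rowpart_def by (metis commute_mult m_closed x_closed)
    qed
    then have "cj (?B1 b) (?B2 (u l \<cdot> c)) = ?B2 (u l \<cdot> c)"
      by (simp add: cj_triv_iff)
    moreover have "cj (?B1 b) (koszul l q j u' (c \<cdot> a)) = koszul l q j u' (c \<cdot> a)"
      using d c b u' by (intro rowpart_commute) auto
    ultimately have "cj (?B1 b) (cmt ?C (?B2 c)) \<otimes> ?B2 (u l \<cdot> c) = cmt ?C (?B2 c) \<otimes> ?B2 (u l \<cdot> c)"
      by (simp add: k2 cj_mult)
    then show ?thesis by (simp add: cj_triv_iff)
  qed
  have "cj (x p j a) (koszul l p q u c)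
      = cmt ?C (?B1 c \<otimes> ?B2 c) \<otimes> (?B1 (u l \<cdot> c) \<otimes> ?B2 (u l \<cdot> c))"
    using d c uc u by (simp add: koszul_eq_cmt cj_mult cj_cmt row cj_colall flip: u'_def)
  also have "cmt ?C (?B1 c \<otimes> ?B2 c) = cmt ?C (?B1 c) \<otimes> cmt ?C (?B2 c)"
    using c2[OF c(1)] by (simp add: cmt_mult_right cj_triv_iff[THEN iffD2])
  finally have "cj (x p j a) (koszul l p q u c)
      = (cmt ?C (?B1 c) \<otimes> ?B1 (u l \<cdot> c)) \<otimes> (cmt ?C (?B2 c) \<otimes> ?B2 (u l \<cdot> c))"
    using c uc c2[of "u l \<cdot> c"] by (simp add: m_assoc mult_left_commute)
  then show ?thesis
    using d c u' by (simp add: k2 koszul_eq_cmt e)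
qed

end

section \<open>Transport of the subgroups generated by Koszul elements\<close>

context group begin

lemma cj_generate:
  assumes g: "g \<in> carrier G" and A: "A \<subseteq> carrier G" and B: "B \<subseteq> carrier G"
    and h: "\<And>y. y \<in> A \<Longrightarrow> cj g y \<in> generate G B" and y: "y \<in> generate G A"
  shows "cj g y \<in> generate G B"
  using y
proof (induction rule: generate.induct)
  case one
  then show ?case by (simp add: g generate.one)
next
  case (incl y)
  then show ?case by (rule h)
next
  case (inv y)
  then show ?case
    using A g generate_m_inv_closed[OF B h] by (auto simp: cj_inv)
next
  case (eng y z)
  then show ?case
    using g generate_in_carrier[OF A] by (simp add: cj_mult generate.eng)
qed

end

context steinberg_system begin

definition koszul_set :: "(nat \<Rightarrow> 'c) \<Rightarrow> 'a set" where
  "koszul_set u = {koszul k p q u c | k p q c.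
     distinct [p, q, k] \<and> {p, q, k} \<subseteq> {1..n} \<and> c \<in> carrier R}"

definition stab :: "(nat \<Rightarrow> 'c) \<Rightarrow> 'a set" where
  "stab u = generate G (koszul_set u)"

lemma koszul_set_closed: "koszul_set u \<subseteq> carrier G"
  by (auto simp: koszul_set_def)

lemma subgroup_stab: "subgroup (stab u) G"
  unfolding stab_def by (rule generate_is_subgroup[OF koszul_set_closed])

lemma koszul_in_stab:
  "distinct [p, q, k] \<Longrightarrow> {p, q, k} \<subseteq> {1..n} \<Longrightarrow> c \<in> carrier R \<Longrightarrow> koszul k p q u c \<in> stab u"
  unfolding stab_def koszul_set_def by (rule generate.incl) blast

lemma cj_koszul_left_in_stab:
  assumes d: "distinct [p, q, k]" "{p, q, k} \<subseteq> {1..n}" and u: "vec u"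
    and c: "c \<in> carrier R" "a \<in> carrier R" and j: "j \<in> {1..n}" "p \<noteq> j"
  shows "cj (x p j a) (koszul k p q u c) \<in> stab (shear p j a u)"
proof (cases "j = q")
  case True
  then show ?thesis
    using assms by (simp add: cj_koszul_inner koszul_in_stab)
next
  case False
  obtain l where l: "l \<in> {1..n}" "l \<noteq> p" "l \<noteq> q" "l \<noteq> j" by (rule fresh_index)
  have "koszul k p q u c = koszul l p q u c"
    using assms l by (intro koszul_index_eq) auto
  then have "cj (x p j a) (koszul k p q u c)
      = koszul l p q (shear p j a u) c \<otimes> koszul l q j (shear p j a u) (c \<cdot> a)"
    using assms l False by (simp add: cj_koszul_leave)
  then show ?thesis
    using assms l False
    by (auto intro!: subgroup.m_closed[OF subgroup_stab] koszul_in_stab)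
qed

lemma cj_koszul_right_in_stab:
  assumes d: "distinct [p, q, k]" "{p, q, k} \<subseteq> {1..n}" and u: "vec u"
    and c: "c \<in> carrier R" "a \<in> carrier R" and i: "i \<in> {1..n}" "i \<noteq> p" "i \<noteq> q"
  shows "cj (x i p a) (koszul k p q u c) \<in> stab (shear i p a u)"
proof -
  obtain l where l: "l \<in> {1..n}" "l \<noteq> p" "l \<noteq> q" "l \<noteq> i" by (rule fresh_index)
  have "koszul k p q u c = koszul l p q u c"
    using assms l by (intro koszul_index_eq) auto
  then show ?thesis
    using assms l by (simp add: cj_koszul_enter koszul_in_stab)
qed

text \<open>Up to the symmetry \<open>koszul_swap\<close> there are three situations: i is p, or j
  is p with i outside, or both i and j lie outside p and q. In the last one the auxiliary index is
  changed to i.\<close>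

lemma cj_koszul_in_stab:
  assumes d: "distinct [p, q, k]" "{p, q, k} \<subseteq> {1..n}" and u: "vec u"
    and c: "c \<in> carrier R" "a \<in> carrier R" and ij: "i \<in> {1..n}" "j \<in> {1..n}" "i \<noteq> j"
  shows "cj (x i j a) (koszul k p q u c) \<in> stab (shear i j a u)"
proof -
  have swap: "koszul k p q u c = koszul k q p u (\<ominus>\<^sub>R c)"
    using assms koszul_swap[of p q k u c] by simp
  consider "i = p" | "i = q" | "i \<noteq> p" "i \<noteq> q" "j = p" | "i \<noteq> p" "i \<noteq> q" "j = q"
    | "i \<noteq> p" "i \<noteq> q" "j \<noteq> p" "j \<noteq> q" by blast
  then show ?thesis
  proof cases
    case 1
    then show ?thesis using assms by (simp add: cj_koszul_left_in_stab)
  next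
    case 2
    then show ?thesis using assms by (simp add: swap cj_koszul_left_in_stab)
  next
    case 3
    then show ?thesis using assms by (simp add: cj_koszul_right_in_stab)
  next
    case 4
    then show ?thesis using assms by (simp add: swap cj_koszul_right_in_stab)
  next
    case 5
    have "koszul k p q u c = koszul i p q u c"
      using assms 5 by (intro koszul_index_eq) auto
    then show ?thesis
      using assms 5 by (simp add: cj_koszul_disjoint koszul_in_stab)
  qed
qed

theorem cj_stab:
  assumes u: "vec u" and a: "a \<in> carrier R" and ij: "i \<in> {1..n}" "j \<in> {1..n}" "i \<noteq> j"
    and y: "y \<in> stab u"
  shows "cj (x i j a) y \<in> stab (shear i j a u)"
  unfolding stab_def
proof (rule cj_generate[OF x_closed koszul_set_closed koszul_set_closed _ y[unfolded stab_def]])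
  fix z assume "z \<in> koszul_set u"
  then show "cj (x i j a) z \<in> generate G (koszul_set (shear i j a u))"
    using cj_koszul_in_stab[OF _ _ u _ a ij] by (auto simp: koszul_set_def stab_def)
qed

section \<open>Row elements and the stabiliser of the first unit column\<close>

definition rowg :: "(nat \<Rightarrow> 'c) \<Rightarrow> 'a" where
  "rowg b = lprod (\<lambda>j. x 1 j (b j)) idx"

lemma rowg_closed [simp]: "rowg b \<in> carrier G"
  by (simp add: rowg_def)

lemma x_row_commute: "x i j r \<otimes> x i k s = x i k s \<otimes> x i j r"
  using x_commute[of i j k i] by (cases "i = j \<or> i = k") auto

lemma rowg_cong: "(\<And>i. i \<in> {1..n} \<Longrightarrow> b i = b' i) \<Longrightarrow> rowg b = rowg b'"
  unfolding rowg_def by (rule lprod_cong) auto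

lemma rowg_add:
  assumes "vec b" "vec b'"
  shows "rowg (\<lambda>j. b j \<boxplus> b' j) = rowg b \<otimes> rowg b'"
proof -
  have "rowg (\<lambda>j. b j \<boxplus> b' j) = lprod (\<lambda>j. x 1 j (b j) \<otimes> x 1 j (b' j)) idx"
    unfolding rowg_def using assms by (intro lprod_cong) (auto simp: x_add vecD)
  also have "\<dots> = rowg b \<otimes> rowg b'"
    unfolding rowg_def by (rule lprod_mult) (simp_all add: x_row_commute)
  finally show ?thesis .
qed

lemma rowg_zero: "(\<And>i. i \<in> {1..n} \<Longrightarrow> b i = \<zero>\<^bsub>R\<^esub>) \<Longrightarrow> rowg b = \<one>"
  unfolding rowg_def by (rule lprod_one) auto

lemma rowg_single:
  assumes "q \<in> {1..n}"
  shows "rowg (\<lambda>j. if j = q then r else \<zero>\<^bsub>R\<^esub>) = x 1 q r"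
  unfolding rowg_def using assms lprod_single[of idx q "\<lambda>j. x 1 j (if j = q then r else \<zero>\<^bsub>R\<^esub>)"] by auto

lemma subgroup_rowg: "subgroup {rowg b | b. vec b} G"
proof (rule subgroupI)
  show "{rowg b | b. vec b} \<subseteq> carrier G" by auto
  have "vec (\<lambda>_. \<zero>\<^bsub>R\<^esub>)" by (simp add: vec_def)
  then show "{rowg b | b. vec b} \<noteq> {}" by blast
next
  fix y assume "y \<in> {rowg b | b. vec b}"
  then obtain b where b: "vec b" "y = rowg b" by blast
  have v: "vec (\<lambda>j. \<ominus>\<^sub>R b j)" using b by (simp add: vec_def)
  have "rowg (\<lambda>j. \<ominus>\<^sub>R b j) \<otimes> y = \<one>"
    unfolding b using b v by (subst rowg_add[symmetric]) (auto intro!: rowg_zero simp: vecD R.l_neg)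
  then have "inv y = rowg (\<lambda>j. \<ominus>\<^sub>R b j)" using b by (simp add: inv_equality)
  then show "inv y \<in> {rowg b | b. vec b}" using v by blast
next
  fix y z assume "y \<in> {rowg b | b. vec b}" "z \<in> {rowg b | b. vec b}"
  then obtain b c where b: "vec b" "y = rowg b" "vec c" "z = rowg c" by blast
  then have "y \<otimes> z = rowg (\<lambda>j. b j \<boxplus> c j)" by (simp add: rowg_add)
  moreover have "vec (\<lambda>j. b j \<boxplus> c j)" using b by (simp add: vec_def)
  ultimately show "y \<otimes> z \<in> {rowg b | b. vec b}" by blast
qed

text \<open>For u = e_1 the Koszul vector is -c e_q. All outer rows vanish and the block collapses
  to the commutator of \<open>x_1k(1)\<close> and \<open>x_kq(-c)\<close>.\<close>

lemma koszul_unit_first: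
  assumes d: "distinct [1, q, k]" "{q, k} \<subseteq> {1..n}" and c: "c \<in> carrier R"
    and u: "u 1 = \<one>\<^bsub>R\<^esub>" "\<And>i. i \<in> {1..n} \<Longrightarrow> i \<noteq> 1 \<Longrightarrow> u i = \<zero>\<^bsub>R\<^esub>"
  shows "koszul k 1 q u c = x 1 q (\<ominus>\<^sub>R c)"
proof -
  have uq: "u q = \<zero>\<^bsub>R\<^esub>" using u d by auto
  have "lprod (outer 1 q u c) idx = \<one>"
  proof (rule lprod_one)
    fix i assume "i \<in> set idx"
    then have "i \<in> {1..n}" by auto
    then show "outer 1 q u c i = \<one>"
      using u c by (cases "i = 1") (auto simp: outer_def uq)
  qed
  moreover have "block k 1 q (u 1) (u q) c = cmt (x 1 k \<one>\<^bsub>R\<^esub>) (x k q (\<ominus>\<^sub>R c))"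
    using c by (simp add: block_def colpart_def rowpart_def u(1)[unfolded One_nat_def] uq)
  moreover have "cmt (x 1 k \<one>\<^bsub>R\<^esub>) (x k q (\<ominus>\<^sub>R c)) = x 1 q (\<ominus>\<^sub>R c)"
    using d c n by (simp add: cmt_eq_cj cj_x_left m_assoc)
  ultimately show ?thesis by (simp add: koszul_def)
qed

text \<open>Koszul vectors of e_1 are multiples of some e_q with q \<noteq> 1, and zero when neither
  p nor q is 1; conversely the coefficient -r yields \<open>x_1q(r)\<close>.\<close>

lemma stab_unit:
  assumes u: "u 1 = \<one>\<^bsub>R\<^esub>" "\<And>i. i \<in> {1..n} \<Longrightarrow> i \<noteq> 1 \<Longrightarrow> u i = \<zero>\<^bsub>R\<^esub>"
  shows "stab u = {rowg b | b. vec b}"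
proof
  have vu: "vec u" using u by (metis vec_def R.one_closed R.zero_closed)
  have row: "x 1 q r \<in> {rowg b | b. vec b}" if "r \<in> carrier R" "q \<in> {1..n}" for q r
    using that rowg_single[of q r]
    by (auto intro!: exI[of _ "\<lambda>j. if j = q then r else \<zero>\<^bsub>R\<^esub>"] simp: vec_def)
  have "koszul k p q u c \<in> {rowg b | b. vec b}"
    if d: "distinct [p, q, k]" "{p, q, k} \<subseteq> {1..n}" and c: "c \<in> carrier R" for k p q c
  proof -
    obtain l where l: "l \<in> {1..n}" "l \<noteq> p" "l \<noteq> q" "l \<noteq> 1" by (rule fresh_index)
    have e: "koszul k p q u c = koszul l p q u c"
      using d l c vu by (intro koszul_index_eq) auto
    consider "p = 1" | "q = 1" | "p \<noteq> 1" "q \<noteq> 1" by blast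
    then show ?thesis
    proof cases
      case 1
      then have "koszul k p q u c = x 1 q (\<ominus>\<^sub>R c)"
        using d c koszul_unit_first[of q k c u, OF _ _ _ u] by auto
      then show ?thesis using row[of "\<ominus>\<^sub>R c" q] d c by simp
    next
      case 2
      then have "koszul k p q u c = koszul l 1 p u (\<ominus>\<^sub>R c)"
        using koszul_swap[of p q l u c] d l c vu e by auto
      then have "koszul k p q u c = x 1 p c"
        using 2 d c l koszul_unit_first[of p l "\<ominus>\<^sub>R c" u, OF _ _ _ u] by auto
      then show ?thesis using row[of c p] d c by simp
    next
      case 3
      then have pq: "u p = \<zero>\<^bsub>R\<^esub>" "u q = \<zero>\<^bsub>R\<^esub>" using u d by auto
      have "outer p q u c i = \<one>" if "i \<in> set idx" for i
      proof -
        have "i \<in> {1..n}" using that by auto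
        then have "u i \<in> carrier R" using vu by (rule vecD[rotated])
        then show ?thesis using c by (auto simp: outer_def pq)
      qed
      then have "lprod (outer p q u c) idx = \<one>" by (rule lprod_one)
      then have "koszul k p q u c = \<one>"
        using c by (simp add: koszul_def block_def colpart_def rowpart_def cmt_def pq)
      then show ?thesis using subgroup.one_closed[OF subgroup_rowg] by simp
    qed
  qed
  then show "stab u \<subseteq> {rowg b | b. vec b}"
    unfolding stab_def by (intro generate_subgroup_incl subgroup_rowg) (auto simp: koszul_set_def)
  have "x 1 q r \<in> stab u" if r: "r \<in> carrier R" and q: "q \<in> {1..n}" for q r
  proof (cases "q = 1")
    case True
    then show ?thesis using subgroup.one_closed[OF subgroup_stab] by simp
  next
    case False
    obtain l where l: "l \<in> {1..n}" "l \<noteq> 1" "l \<noteq> q" "l \<noteq> 1" by (rule fresh_index)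
    then have "koszul l 1 q u (\<ominus>\<^sub>R r) = x 1 q r"
      using False r q koszul_unit_first[of q l "\<ominus>\<^sub>R r" u, OF _ _ _ u] by auto
    moreover have "koszul l 1 q u (\<ominus>\<^sub>R r) \<in> stab u"
      using False l r q n by (intro koszul_in_stab) auto
    ultimately show ?thesis by simp
  qed
  then show "{rowg b | b. vec b} \<subseteq> stab u"
    by (auto simp: rowg_def vecD intro!: lprod_in_subgroup[OF subgroup_stab])
qed

end

section \<open>Actions of matrices on columns\<close>

locale column_space = cring R for R (structure) + fixes n :: nat
begin

abbreviation cols :: "(nat \<Rightarrow> 'a) set" where "cols \<equiv> columns n (carrier R)"
abbreviation mats :: "(nat \<times> nat \<Rightarrow> 'a) set" where "mats \<equiv> carrier (mat_monoid n R)"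
abbreviation dot :: "(nat \<Rightarrow> 'a) \<Rightarrow> (nat \<Rightarrow> 'a) \<Rightarrow> 'a" where "dot \<equiv> col_dot n R"
abbreviation act :: "(nat \<times> nat \<Rightarrow> 'a) \<Rightarrow> (nat \<Rightarrow> 'a) \<Rightarrow> nat \<Rightarrow> 'a" where "act \<equiv> mat_col n R"
abbreviation ucol :: "nat \<Rightarrow> nat \<Rightarrow> 'a" where "ucol \<equiv> unit_col n R"
abbreviation cadd (infixl "\<^bold>+" 65) where "u \<^bold>+ v \<equiv> col_add n R u v"
abbreviation cscale (infixl "\<^bold>*" 70) where "u \<^bold>* a \<equiv> col_scale n R u a"
abbreviation GLn where "GLn \<equiv> GL n R"

text \<open>The contragredient action v^t |-> v^t M^-1, written on columns; it is the companion of
  \<open>act\<close> that leaves \<open>dot\<close> invariant.\<close>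

definition coact :: "(nat \<times> nat \<Rightarrow> 'a) \<Rightarrow> (nat \<Rightarrow> 'a) \<Rightarrow> nat \<Rightarrow> 'a" where
  "coact M v = row_mat n R v (inv\<^bsub>GLn\<^esub> M)"

lemma colsD: "u \<in> columns n A \<Longrightarrow> i \<in> {1..n} \<Longrightarrow> u i \<in> A"
  by (auto simp: columns_def)

lemma restrict_cols_iff: "restrict f {1..n} \<in> columns n A \<longleftrightarrow> (\<forall>i\<in>{1..n}. f i \<in> A)"
  unfolding columns_def by (rule restrict_PiE_iff)

lemma cols_eqI:
  "u \<in> columns n A \<Longrightarrow> v \<in> columns n B \<Longrightarrow> (\<And>i. i \<in> {1..n} \<Longrightarrow> u i = v i) \<Longrightarrow> u = v"
  unfolding columns_def PiE_def by (rule extensionalityI[of u "{1..n}"]) simp_all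

lemma matsD: "M \<in> mats \<Longrightarrow> i \<in> {1..n} \<Longrightarrow> j \<in> {1..n} \<Longrightarrow> M (i, j) \<in> carrier R"
  by (rule PiE_mem[of M "{1..n} \<times> {1..n}" "\<lambda>_. carrier R"]) (simp_all add: mat_monoid_def)

lemma columns_mono: "A \<subseteq> B \<Longrightarrow> columns n A \<subseteq> columns n B"
  unfolding columns_def by (rule PiE_mono)

lemma ideal_sub: "ideal J R \<Longrightarrow> J \<subseteq> carrier R"
  by (rule subsetI) (rule ideal.Icarr)

lemma ideal_cols: "ideal J R \<Longrightarrow> u \<in> columns n J \<Longrightarrow> u \<in> cols"
  by (rule subsetD[OF columns_mono[OF ideal_sub]])

lemma ideal_finsum:
  assumes J: "ideal J R" and f: "\<And>i. i \<in> A \<Longrightarrow> f i \<in> J" and A: "finite A"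
  shows "finsum R f A \<in> J"
  using A f
proof (induction A rule: finite_induct)
  case empty
  then show ?case using additive_subgroup.zero_closed[OF ideal.axioms(1)[OF J]] by simp
next
  case (insert a A)
  then have "finsum R f (insert a A) = f a \<oplus> finsum R f A"
    using ideal_sub[OF J] by (intro finsum_insert) auto
  then show ?case
    using insert additive_subgroup.a_closed[OF ideal.axioms(1)[OF J]] by auto
qed

section \<open>Columns, their pairing and the multiplication by matrices\<close>

lemma add_cols: "ideal J R \<Longrightarrow> u \<in> columns n J \<Longrightarrow> v \<in> columns n J \<Longrightarrow> u \<^bold>+ v \<in> columns n J"
  unfolding col_add_def restrict_cols_iff
  by (simp add: colsD additive_subgroup.a_closed[OF ideal.axioms(1)])

lemma scale_cols: "ideal J R \<Longrightarrow> u \<in> columns n J \<Longrightarrow> a \<in> carrier R \<Longrightarrow> u \<^bold>* a \<in> columns n J"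
  unfolding col_scale_def restrict_cols_iff by (simp add: colsD ideal.I_r_closed)

lemma scale_cols': "ideal J R \<Longrightarrow> u \<in> cols \<Longrightarrow> a \<in> J \<Longrightarrow> u \<^bold>* a \<in> columns n J"
  unfolding col_scale_def restrict_cols_iff by (simp add: colsD ideal.I_l_closed)

lemma act_cols:
  assumes J: "ideal J R" and M: "M \<in> mats" and u: "u \<in> columns n J"
  shows "act M u \<in> columns n J"
  unfolding mat_col_def restrict_cols_iff
  using ideal.I_l_closed[OF J] matsD[OF M] colsD[OF u]
  by (intro ballI ideal_finsum[OF J]) simp_all

lemma row_mat_cols:
  assumes J: "ideal J R" and M: "M \<in> mats" and u: "u \<in> columns n J"
  shows "row_mat n R u M \<in> columns n J"
  unfolding row_mat_def restrict_cols_iff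
  using ideal.I_r_closed[OF J] matsD[OF M] colsD[OF u]
  by (intro ballI ideal_finsum[OF J]) simp_all

lemmas [simp] = add_cols[OF oneideal] scale_cols[OF oneideal] act_cols[OF oneideal]
  row_mat_cols[OF oneideal]

lemma unit_cols [simp]: "ucol i \<in> cols"
  unfolding unit_col_def restrict_cols_iff by simp

lemma column_at:
  "i \<in> {1..n} \<Longrightarrow> (u \<^bold>+ v) i = u i \<oplus> v i"
  "i \<in> {1..n} \<Longrightarrow> (u \<^bold>* a) i = u i \<otimes> a"
  "i \<in> {1..n} \<Longrightarrow> ucol k i = (if i = k then \<one> else \<zero>)"
  "i \<in> {1..n} \<Longrightarrow> act M u i = (\<Oplus>j\<in>{1..n}. M (i, j) \<otimes> u j)"
  "i \<in> {1..n} \<Longrightarrow> row_mat n R u M i = (\<Oplus>j\<in>{1..n}. u j \<otimes> M (j, i))"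
  by (simp_all add: col_add_def col_scale_def unit_col_def mat_col_def row_mat_def)

lemma matrix_at:
  "i \<in> {1..n} \<Longrightarrow> j \<in> {1..n} \<Longrightarrow> transv n R u v (i, j) = (if i = j then \<one> else \<zero>) \<oplus> u i \<otimes> v j"
  "i \<in> {1..n} \<Longrightarrow> j \<in> {1..n} \<Longrightarrow> \<one>\<^bsub>mat_monoid n R\<^esub> (i, j) = (if i = j then \<one> else \<zero>)"
  "i \<in> {1..n} \<Longrightarrow> k \<in> {1..n} \<Longrightarrow>
    (M \<otimes>\<^bsub>mat_monoid n R\<^esub> N) (i, k) = (\<Oplus>j\<in>{1..n}. M (i, j) \<otimes> N (j, k))"
  by (simp_all add: transv_def mat_monoid_def)

lemma dot_closed [simp]: "u \<in> cols \<Longrightarrow> v \<in> cols \<Longrightarrow> dot u v \<in> carrier R"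
  unfolding col_dot_def by (rule finsum_closed) (auto simp: colsD)

lemma dot_commute: "u \<in> cols \<Longrightarrow> v \<in> cols \<Longrightarrow> dot u v = dot v u"
  unfolding col_dot_def by (rule finsum_cong') (auto simp: colsD m_comm)

lemma dot_unit:
  assumes "u \<in> cols" "i \<in> {1..n}"
  shows "dot u (ucol i) = u i"
proof -
  have "dot u (ucol i) = (\<Oplus>j\<in>{1..n}. if i = j then u j else \<zero>)"
    unfolding col_dot_def using assms by (intro finsum_cong') (auto simp: colsD unit_col_def)
  also have "\<dots> = u i"
    using assms by (intro finsum_singleton) (auto simp: colsD)
  finally show ?thesis .
qed

lemma dot_add: 
  assumes "u \<in> cols" "v \<in> cols" "w \<in> cols"
  shows "dot u (v \<^bold>+ w) = dot u v \<oplus> dot u w"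
proof -
  have "dot u (v \<^bold>+ w) = (\<Oplus>i\<in>{1..n}. u i \<otimes> v i \<oplus> u i \<otimes> w i)"
    unfolding col_dot_def using assms
    by (intro finsum_cong') (auto simp: colsD col_add_def r_distr)
  then show ?thesis
    using assms by (simp add: col_dot_def, intro finsum_addf) (auto simp: colsD)
qed

lemma dot_scale:
  assumes "u \<in> cols" "v \<in> cols" "a \<in> carrier R"
  shows "dot u (v \<^bold>* a) = dot u v \<otimes> a"
proof -
  have "dot u (v \<^bold>* a) = (\<Oplus>i\<in>{1..n}. u i \<otimes> v i \<otimes> a)"
    unfolding col_dot_def using assms
    by (intro finsum_cong') (auto simp: colsD col_scale_def m_assoc)
  also have "\<dots> = dot u v \<otimes> a"
    unfolding col_dot_def using assms by (intro finsum_ldistr[symmetric]) (auto simp: colsD)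
  finally show ?thesis .
qed

lemma dot_add_left:
  "u \<in> cols \<Longrightarrow> v \<in> cols \<Longrightarrow> w \<in> cols \<Longrightarrow> dot (v \<^bold>+ w) u = dot v u \<oplus> dot w u"
  using dot_add[of u v w] by (simp add: dot_commute)

lemma dot_scale_left:
  "u \<in> cols \<Longrightarrow> v \<in> cols \<Longrightarrow> a \<in> carrier R \<Longrightarrow> dot (v \<^bold>* a) u = dot v u \<otimes> a"
  using dot_scale[of u v a] by (simp add: dot_commute)

lemmas dot_simps = dot_add dot_scale dot_add_left dot_scale_left

text \<open>The pairing is nondegenerate, as testing on unit columns shows. Many later identities
  between columns are reduced in this way to identities in R.\<close>

lemma dot_eqI:
  assumes "u \<in> cols" "v \<in> cols" "\<And>w. w \<in> cols \<Longrightarrow> dot u w = dot v w"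
  shows "u = v"
  using assms(1,2) by (rule cols_eqI) (metis assms dot_unit unit_cols)

lemma dot_row_mat:
  assumes M: "M \<in> mats" and u: "u \<in> cols" and v: "v \<in> cols"
  shows "dot (row_mat n R v M) u = dot v (act M u)"
proof -
  note c = matsD[OF M] colsD[OF u] colsD[OF v]
  have "dot (row_mat n R v M) u = (\<Oplus>j\<in>{1..n}. \<Oplus>i\<in>{1..n}. v i \<otimes> M (i, j) \<otimes> u j)"
    unfolding col_dot_def using c
    by (intro finsum_cong') (auto simp: row_mat_def finsum_ldistr intro!: finsum_closed)
  also have "\<dots> = (\<Oplus>i\<in>{1..n}. \<Oplus>j\<in>{1..n}. v i \<otimes> M (i, j) \<otimes> u j)"
    using c by (intro finsum_swap) auto
  also have "\<dots> = dot v (act M u)"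
    unfolding col_dot_def using c
    by (intro finsum_cong')
      (auto simp: mat_col_def finsum_rdistr m_assoc intro!: finsum_closed finsum_cong')
  finally show ?thesis .
qed

lemma mats_mult [simp]: "M \<in> mats \<Longrightarrow> N \<in> mats \<Longrightarrow> M \<otimes>\<^bsub>mat_monoid n R\<^esub> N \<in> mats"
  using monoid_mat_monoid by (rule Group.monoid.m_closed)

lemma mats_one [simp]: "\<one>\<^bsub>mat_monoid n R\<^esub> \<in> mats"
  using monoid_mat_monoid by (rule Group.monoid.one_closed)

lemma act_mult:
  assumes M: "M \<in> mats" and N: "N \<in> mats" and u: "u \<in> cols"
  shows "act (M \<otimes>\<^bsub>mat_monoid n R\<^esub> N) u = act M (act N u)"
proof (rule cols_eqI[where A = "carrier R" and B = "carrier R"])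
  fix i assume i: "i \<in> {1..n}"
  define r where "r = (\<lambda>j\<in>{1..n}. M (i, j))"
  have r: "r \<in> cols" using M i unfolding r_def restrict_cols_iff by (simp add: matsD)
  have "act (M \<otimes>\<^bsub>mat_monoid n R\<^esub> N) u i = dot (row_mat n R r N) u"
    using i matsD[OF mats_mult[OF M N]] colsD[OF u] matsD[OF M] matsD[OF N]
    by (auto simp: mat_col_def col_dot_def row_mat_def r_def mat_monoid_def
        intro!: finsum_cong' finsum_closed arg_cong2[where f = "(\<otimes>)"])
  also have "\<dots> = dot r (act N u)" using N r u by (simp add: dot_row_mat)
  also have "\<dots> = act M (act N u) i"
    using i matsD[OF M] colsD[OF act_cols[OF oneideal N u]]
    by (auto simp: mat_col_def[of n R M] col_dot_def r_def intro!: finsum_cong')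
  finally show "act (M \<otimes>\<^bsub>mat_monoid n R\<^esub> N) u i = act M (act N u) i" .
qed (use assms in auto)

lemma act_unit:
  assumes M: "M \<in> mats" and i: "i \<in> {1..n}" and j: "j \<in> {1..n}"
  shows "act M (ucol j) i = M (i, j)"
proof -
  have "act M (ucol j) i = (\<Oplus>k\<in>{1..n}. if j = k then M (i, k) else \<zero>)"
    using assms by (auto simp: mat_col_def unit_col_def intro!: finsum_cong' simp: matsD)
  also have "\<dots> = M (i, j)"
    using assms by (intro finsum_singleton) (auto simp: matsD)
  finally show ?thesis .
qed

lemma mats_eqI:
  assumes M: "M \<in> mats" and N: "N \<in> mats" and e: "\<And>u. u \<in> cols \<Longrightarrow> act M u = act N u"
  shows "M = N"
proof -
  have "M p = N p" if "p \<in> {1..n} \<times> {1..n}" for p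
    using that act_unit[OF M] act_unit[OF N] e[OF unit_cols] by (metis SigmaE)
  moreover have "M \<in> {1..n} \<times> {1..n} \<rightarrow>\<^sub>E carrier R" "N \<in> {1..n} \<times> {1..n} \<rightarrow>\<^sub>E carrier R"
    using M N by (simp_all add: mat_monoid_def)
  ultimately show ?thesis by (metis PiE_ext)
qed

lemma act_one [simp]:
  assumes "u \<in> cols"
  shows "act \<one>\<^bsub>mat_monoid n R\<^esub> u = u"
proof (rule cols_eqI[where A = "carrier R" and B = "carrier R"])
  fix i assume i: "i \<in> {1..n}"
  have "act \<one>\<^bsub>mat_monoid n R\<^esub> u i = (\<Oplus>j\<in>{1..n}. if i = j then u j else \<zero>)"
    using assms i by (auto simp: mat_col_def mat_monoid_def intro!: finsum_cong' simp: colsD)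
  also have "\<dots> = u i" using assms i by (intro finsum_singleton) (auto simp: colsD)
  finally show "act \<one>\<^bsub>mat_monoid n R\<^esub> u i = u i" .
qed (use assms in auto)

lemma act_add:
  assumes "M \<in> mats" "u \<in> cols" "v \<in> cols"
  shows "act M (u \<^bold>+ v) = act M u \<^bold>+ act M v"
proof (rule dot_eqI)
  fix w assume "w \<in> cols"
  then have "dot w (act M (u \<^bold>+ v)) = dot w (act M u \<^bold>+ act M v)"
    using assms by (simp add: dot_add flip: dot_row_mat)
  then show "dot (act M (u \<^bold>+ v)) w = dot (act M u \<^bold>+ act M v) w"
    using assms \<open>w \<in> cols\<close> by (simp add: dot_commute)
qed (use assms in auto)

lemma act_scale:
  assumes "M \<in> mats" "u \<in> cols" "a \<in> carrier R"
  shows "act M (u \<^bold>* a) = act M u \<^bold>* a"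
proof (rule dot_eqI)
  fix w assume "w \<in> cols"
  then have "dot w (act M (u \<^bold>* a)) = dot w (act M u \<^bold>* a)"
    using assms by (simp add: dot_scale flip: dot_row_mat)
  then show "dot (act M (u \<^bold>* a)) w = dot (act M u \<^bold>* a) w"
    using assms \<open>w \<in> cols\<close> by (simp add: dot_commute)
qed (use assms in auto)

lemma row_mat_add:
  "M \<in> mats \<Longrightarrow> u \<in> cols \<Longrightarrow> v \<in> cols \<Longrightarrow>
    row_mat n R (u \<^bold>+ v) M = row_mat n R u M \<^bold>+ row_mat n R v M"
  by (rule dot_eqI) (simp_all add: dot_row_mat dot_add_left)

lemma row_mat_scale:
  "M \<in> mats \<Longrightarrow> u \<in> cols \<Longrightarrow> a \<in> carrier R \<Longrightarrow>
    row_mat n R (u \<^bold>* a) M = row_mat n R u M \<^bold>* a"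
  by (rule dot_eqI) (simp_all add: dot_row_mat dot_scale_left)

lemma row_mat_mult:
  "M \<in> mats \<Longrightarrow> N \<in> mats \<Longrightarrow> u \<in> cols \<Longrightarrow>
    row_mat n R u (M \<otimes>\<^bsub>mat_monoid n R\<^esub> N) = row_mat n R (row_mat n R u M) N"
  by (rule dot_eqI) (simp_all add: dot_row_mat act_mult)

lemma row_mat_one [simp]: "u \<in> cols \<Longrightarrow> row_mat n R u \<one>\<^bsub>mat_monoid n R\<^esub> = u"
  by (rule dot_eqI) (simp_all add: dot_row_mat)

section \<open>Invertible matrices and the contragredient action\<close>

sublocale GL: group GLn by (rule group_GL)

lemma GL_simps [simp]:
  "(\<otimes>\<^bsub>GLn\<^esub>) = (\<otimes>\<^bsub>mat_monoid n R\<^esub>)" "\<one>\<^bsub>GLn\<^esub> = \<one>\<^bsub>mat_monoid n R\<^esub>"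
  by (simp_all add: GL_def units_of_def)

lemma GL_mats [simp]: "M \<in> carrier GLn \<Longrightarrow> M \<in> mats"
  by (simp add: GL_def units_of_def Units_def)

lemma GL_inv_mult:
  "M \<in> carrier GLn \<Longrightarrow> inv\<^bsub>GLn\<^esub> M \<otimes>\<^bsub>mat_monoid n R\<^esub> M = \<one>\<^bsub>mat_monoid n R\<^esub>"
  "M \<in> carrier GLn \<Longrightarrow> M \<otimes>\<^bsub>mat_monoid n R\<^esub> inv\<^bsub>GLn\<^esub> M = \<one>\<^bsub>mat_monoid n R\<^esub>"
  using GL.l_inv GL.r_inv by auto

lemma GL_I:
  assumes "M \<in> mats" "N \<in> mats" "M \<otimes>\<^bsub>mat_monoid n R\<^esub> N = \<one>\<^bsub>mat_monoid n R\<^esub>"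
    "N \<otimes>\<^bsub>mat_monoid n R\<^esub> M = \<one>\<^bsub>mat_monoid n R\<^esub>"
  shows "M \<in> carrier GLn" "inv\<^bsub>GLn\<^esub> M = N"
proof -
  have "M \<in> Units (mat_monoid n R)" "N \<in> Units (mat_monoid n R)"
    unfolding Units_def using assms by blast+
  then have c: "M \<in> carrier GLn" "N \<in> carrier GLn"
    by (simp_all only: GL_def units_of_carrier)
  then show "M \<in> carrier GLn" by simp
  show "inv\<^bsub>GLn\<^esub> M = N" using GL.inv_equality[of N M] c assms by simp
qed

lemma act_inv [simp]:
  "M \<in> carrier GLn \<Longrightarrow> u \<in> cols \<Longrightarrow> act M (act (inv\<^bsub>GLn\<^esub> M) u) = u"
  "M \<in> carrier GLn \<Longrightarrow> u \<in> cols \<Longrightarrow> act (inv\<^bsub>GLn\<^esub> M) (act M u) = u"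
  by (simp_all add: GL_inv_mult flip: act_mult)

lemma coact_cols: "ideal J R \<Longrightarrow> M \<in> carrier GLn \<Longrightarrow> v \<in> columns n J \<Longrightarrow> coact M v \<in> columns n J"
  unfolding coact_def by (simp add: row_mat_cols)

lemma coact_closed [simp]: "M \<in> carrier GLn \<Longrightarrow> v \<in> cols \<Longrightarrow> coact M v \<in> cols"
  by (rule coact_cols[OF oneideal])

lemma dot_coact:
  "M \<in> carrier GLn \<Longrightarrow> u \<in> cols \<Longrightarrow> v \<in> cols \<Longrightarrow> dot (coact M v) u = dot v (act (inv\<^bsub>GLn\<^esub> M) u)"
  by (simp add: coact_def dot_row_mat)

lemma dot_coact_act [simp]:
  "M \<in> carrier GLn \<Longrightarrow> u \<in> cols \<Longrightarrow> v \<in> cols \<Longrightarrow> dot (coact M v) (act M u) = dot v u"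
  "M \<in> carrier GLn \<Longrightarrow> u \<in> cols \<Longrightarrow> v \<in> cols \<Longrightarrow> dot (act M u) (coact M v) = dot u v"
  by (simp_all add: dot_coact dot_commute[of "act M u"] dot_commute[of u])

lemma coact_add:
  "M \<in> carrier GLn \<Longrightarrow> u \<in> cols \<Longrightarrow> v \<in> cols \<Longrightarrow> coact M (u \<^bold>+ v) = coact M u \<^bold>+ coact M v"
  by (simp add: coact_def row_mat_add)

lemma coact_scale:
  "M \<in> carrier GLn \<Longrightarrow> u \<in> cols \<Longrightarrow> a \<in> carrier R \<Longrightarrow> coact M (u \<^bold>* a) = coact M u \<^bold>* a"
  by (simp add: coact_def row_mat_scale)

lemma coact_mult:
  assumes "M \<in> carrier GLn" "N \<in> carrier GLn" "u \<in> cols"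
  shows "coact (M \<otimes>\<^bsub>mat_monoid n R\<^esub> N) u = coact M (coact N u)"
  using GL.inv_mult_group[of M N] assms by (simp add: coact_def row_mat_mult)

lemma coact_one [simp]: "u \<in> cols \<Longrightarrow> coact \<one>\<^bsub>mat_monoid n R\<^esub> u = u"
  using GL.inv_one by (simp add: coact_def)

lemma coact_inv [simp]:
  "M \<in> carrier GLn \<Longrightarrow> u \<in> cols \<Longrightarrow> coact M (coact (inv\<^bsub>GLn\<^esub> M) u) = u"
  "M \<in> carrier GLn \<Longrightarrow> u \<in> cols \<Longrightarrow> coact (inv\<^bsub>GLn\<^esub> M) (coact M u) = u"
  by (simp_all add: GL_inv_mult flip: coact_mult)

section \<open>Transvection matrices\<close>

lemma transv_mats [simp]: "u \<in> cols \<Longrightarrow> v \<in> cols \<Longrightarrow> transv n R u v \<in> mats"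
  by (auto simp: transv_def mat_monoid_def simp: colsD)

lemma act_transv:
  assumes u: "u \<in> cols" and v: "v \<in> cols" and w: "w \<in> cols"
  shows "act (transv n R u v) w = w \<^bold>+ u \<^bold>* dot v w"
proof (rule cols_eqI[where A = "carrier R" and B = "carrier R"])
  fix i assume i: "i \<in> {1..n}"
  note c = colsD[OF u] colsD[OF v] colsD[OF w]
  have "act (transv n R u v) w i = (\<Oplus>j\<in>{1..n}. (if i = j then w j else \<zero>) \<oplus> u i \<otimes> (v j \<otimes> w j))"
    unfolding column_at(4)[OF i] using i c
    by (intro finsum_cong') (auto simp: matrix_at l_distr m_assoc)
  also have "\<dots> = (\<Oplus>j\<in>{1..n}. if i = j then w j else \<zero>) \<oplus> (\<Oplus>j\<in>{1..n}. u i \<otimes> (v j \<otimes> w j))"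
    using i c by (intro finsum_addf) auto
  also have "(\<Oplus>j\<in>{1..n}. if i = j then w j else \<zero>) = w i"
    using i c by (intro finsum_singleton) auto
  also have "(\<Oplus>j\<in>{1..n}. u i \<otimes> (v j \<otimes> w j)) = u i \<otimes> dot v w"
    unfolding col_dot_def using i c by (intro finsum_rdistr[symmetric]) auto
  finally show "act (transv n R u v) w i = (w \<^bold>+ u \<^bold>* dot v w) i"
    using i by (simp add: column_at)
qed (use assms in auto)

lemma scale_add: "u \<in> cols \<Longrightarrow> a \<in> carrier R \<Longrightarrow> b \<in> carrier R \<Longrightarrow> u \<^bold>* (a \<oplus> b) = u \<^bold>* a \<^bold>+ u \<^bold>* b"
  by (rule dot_eqI) (simp_all add: dot_simps r_distr)

text \<open>Since v^t u = 0, the mixed term u v^t u v^t vanishes and the scalars simply add up.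
  Opposite scalars then exhibit the inverse of a transvection.\<close>

lemma transv_mult_neg:
  assumes "u \<in> cols" "v \<in> cols" "dot v u = \<zero>" "a \<in> carrier R" "b \<in> carrier R" "a \<oplus> b = \<zero>"
  shows "transv n R u (v \<^bold>* a) \<otimes>\<^bsub>mat_monoid n R\<^esub> transv n R u (v \<^bold>* b) = \<one>\<^bsub>mat_monoid n R\<^esub>"
proof (rule mats_eqI)
  fix w assume w: "w \<in> cols"
  have "act (transv n R u (v \<^bold>* a)) (act (transv n R u (v \<^bold>* b)) w)
      = w \<^bold>+ u \<^bold>* (dot v w \<otimes> b) \<^bold>+ u \<^bold>* (dot v w \<otimes> a)"
    using assms w by (simp add: act_transv dot_simps)
  also have "\<dots> = w"
  proof (rule dot_eqI)
    fix z assume z: "z \<in> cols"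
    have "dot u z \<otimes> (dot v w \<otimes> b) \<oplus> dot u z \<otimes> (dot v w \<otimes> a) = dot u z \<otimes> (dot v w \<otimes> (a \<oplus> b))"
      using assms(1,2,4,5) w z by (simp add: r_distr a_comm)
    also have "\<dots> = \<zero>" using assms w z by simp
    finally show "dot (w \<^bold>+ u \<^bold>* (dot v w \<otimes> b) \<^bold>+ u \<^bold>* (dot v w \<otimes> a)) z = dot w z"
      using assms(1,2,4,5) w z by (simp add: dot_simps a_assoc)
  qed (use assms w in auto)
  finally show "act (transv n R u (v \<^bold>* a) \<otimes>\<^bsub>mat_monoid n R\<^esub> transv n R u (v \<^bold>* b)) w
      = act \<one>\<^bsub>mat_monoid n R\<^esub> w"
    using assms w by (simp add: act_mult)
qed (use assms in auto)

lemma scale_one [simp]: "u \<in> cols \<Longrightarrow> u \<^bold>* \<one> = u"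
  by (rule dot_eqI) (simp_all add: dot_simps)

lemma
  assumes "u \<in> cols" "v \<in> cols" "dot v u = \<zero>"
  shows transv_GL [simp]: "transv n R u v \<in> carrier GLn"
    and inv_transv: "inv\<^bsub>GLn\<^esub> (transv n R u v) = transv n R u (v \<^bold>* \<ominus> \<one>)"
  using transv_mult_neg[of u v \<one> "\<ominus> \<one>"] transv_mult_neg[of u v "\<ominus> \<one>" \<one>] assms
    GL_I[of "transv n R u v" "transv n R u (v \<^bold>* \<ominus> \<one>)"]
  by (simp_all add: l_neg r_neg)

lemma coact_transv:
  assumes "u \<in> cols" "v \<in> cols" "dot v u = \<zero>" "w \<in> cols"
  shows "coact (transv n R u v) w = w \<^bold>+ v \<^bold>* \<ominus> (dot u w)"
proof (rule dot_eqI)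
  fix z assume z: "z \<in> cols"
  then show "dot (coact (transv n R u v) w) z = dot (w \<^bold>+ v \<^bold>* \<ominus> dot u w) z"
    using assms
    by (simp add: dot_coact inv_transv act_transv dot_simps dot_commute[of w u] l_minus r_minus m_ac)
qed (use assms in auto)

text \<open>The right-hand side is that of \<open>coact_transv\<close>: t(v,u) is the transpose of
  t(u,v), so the matrix t(v,u)^-1 of relation (R3) acts as the coaction of t(u,v).\<close>

lemma act_inv_transv:
  assumes "u \<in> cols" "v \<in> cols" "dot v u = \<zero>" "w \<in> cols"
  shows "act (inv\<^bsub>GLn\<^esub> (transv n R v u)) w = w \<^bold>+ v \<^bold>* \<ominus> (dot u w)"
proof -
  have "dot u v = \<zero>" using assms by (simp add: dot_commute)
  then show ?thesis
    using assms by (simp add: inv_transv act_transv dot_simps l_minus r_minus)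
qed

lemma elem_transv_eq:
  assumes "i \<in> {1..n}" "j \<in> {1..n}" "r \<in> carrier R"
  shows "elem_transv n R i j r = transv n R (ucol i) (ucol j \<^bold>* r)"
  unfolding elem_transv_def transv_def using assms
  by (intro restrict_ext) (auto simp: unit_col_def col_scale_def)

lemma dot_unit_unit: "i \<in> {1..n} \<Longrightarrow> j \<in> {1..n} \<Longrightarrow> i \<noteq> j \<Longrightarrow> dot (ucol j) (ucol i) = \<zero>"
  by (simp add: dot_unit column_at)

lemma elem_transv_GL [simp]:
  assumes "i \<in> {1..n}" "j \<in> {1..n}" "i \<noteq> j" "r \<in> carrier R"
  shows "elem_transv n R i j r \<in> carrier GLn"
  using assms by (simp only: elem_transv_eq) (rule transv_GL; simp add: dot_simps dot_unit_unit)

lemma act_elem_transv: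
  assumes "i \<in> {1..n}" "j \<in> {1..n}" "r \<in> carrier R" "u \<in> cols"
  shows "act (elem_transv n R i j r) u = u(i := u i \<oplus> r \<otimes> u j)"
proof (rule cols_eqI[where A = "carrier R" and B = "carrier R"])
  fix k assume k: "k \<in> {1..n}"
  have "dot (ucol j \<^bold>* r) u = r \<otimes> u j"
    using assms by (simp add: dot_simps dot_commute[of "ucol j"] dot_unit m_comm colsD)
  then show "act (elem_transv n R i j r) u k = (u(i := u i \<oplus> r \<otimes> u j)) k"
    using assms k by (auto simp: elem_transv_eq act_transv column_at colsD)
next
  show "u(i := u i \<oplus> r \<otimes> u j) \<in> cols"
    using assms by (auto simp: columns_def PiE_iff extensional_def)
  show "act (elem_transv n R i j r) u \<in> cols"
    using assms by (simp add: elem_transv_eq)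
qed

lemma coact_elem_transv:
  assumes "i \<in> {1..n}" "j \<in> {1..n}" "i \<noteq> j" "r \<in> carrier R" "u \<in> cols"
  shows "coact (elem_transv n R i j r) u = u(j := u j \<oplus> \<ominus> r \<otimes> u i)"
proof (rule cols_eqI[where A = "carrier R" and B = "carrier R"])
  fix k assume k: "k \<in> {1..n}"
  have "dot (ucol i) u = u i"
    using assms by (simp add: dot_commute[of "ucol i"] dot_unit)
  moreover have "dot (ucol j \<^bold>* r) (ucol i) = \<zero>"
    using assms by (simp add: dot_simps dot_unit_unit)
  ultimately show "coact (elem_transv n R i j r) u k = (u(j := u j \<oplus> \<ominus> r \<otimes> u i)) k"
    using assms k
    by (auto simp: elem_transv_eq coact_transv column_at colsD l_minus r_minus)
next
  show "u(j := u j \<oplus> \<ominus> r \<otimes> u i) \<in> cols"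
    using assms by (auto simp: columns_def PiE_iff extensional_def)
  show "coact (elem_transv n R i j r) u \<in> cols"
    using assms by simp
qed

end

section \<open>Transvections in a group with Steinberg relations\<close>

text \<open>Matrices are replaced by a pair of contragredient actions \<open>A\<close> and
  \<open>B\<close>, so that exchanging the two gives the dual system. Only the action
  \<open>A\<close> of root elements is prescribed; \<open>generation\<close> carries statements over
  to all of the group.\<close>

locale steinberg_rep = steinberg_system G R n x + column_space R n
  for G (structure) and R (structure) and n x +
  fixes A B :: "'a \<Rightarrow> (nat \<Rightarrow> 'c) \<Rightarrow> nat \<Rightarrow> 'c"
  assumes A_closed [simp]: "g \<in> carrier G \<Longrightarrow> u \<in> cols \<Longrightarrow> A g u \<in> cols"
    and B_closed [simp]: "g \<in> carrier G \<Longrightarrow> u \<in> cols \<Longrightarrow> B g u \<in> cols"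
    and A_mult: "g \<in> carrier G \<Longrightarrow> h \<in> carrier G \<Longrightarrow> u \<in> cols \<Longrightarrow> A (g \<otimes> h) u = A g (A h u)"
    and B_mult: "g \<in> carrier G \<Longrightarrow> h \<in> carrier G \<Longrightarrow> u \<in> cols \<Longrightarrow> B (g \<otimes> h) u = B g (B h u)"
    and A_one [simp]: "u \<in> cols \<Longrightarrow> A \<one> u = u"
    and B_one [simp]: "u \<in> cols \<Longrightarrow> B \<one> u = u"
    and A_linear: "g \<in> carrier G \<Longrightarrow> u \<in> cols \<Longrightarrow> v \<in> cols \<Longrightarrow> a \<in> carrier R \<Longrightarrow>
      A g (u \<^bold>+ v \<^bold>* a) = A g u \<^bold>+ A g v \<^bold>* a"
    and B_add: "g \<in> carrier G \<Longrightarrow> u \<in> cols \<Longrightarrow> v \<in> cols \<Longrightarrow> B g (u \<^bold>+ v) = B g u \<^bold>+ B g v"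
    and dot_BA [simp]: "g \<in> carrier G \<Longrightarrow> u \<in> cols \<Longrightarrow> v \<in> cols \<Longrightarrow> dot (B g v) (A g u) = dot v u"
    and A_x: "i \<in> {1..n} \<Longrightarrow> j \<in> {1..n} \<Longrightarrow> i \<noteq> j \<Longrightarrow> r \<in> carrier R \<Longrightarrow> u \<in> cols \<Longrightarrow>
      A (x i j r) u = shear i j r u"
    and generation: "carrier G \<subseteq> generate G {x i j r | i j r.
      i \<in> {1..n} \<and> j \<in> {1..n} \<and> i \<noteq> j \<and> r \<in> carrier R}"
begin

abbreviation e1 :: "nat \<Rightarrow> 'c" where "e1 \<equiv> ucol 1"

lemma one_index [simp]: "1 \<in> {1..n}" "Suc 0 \<le> n"
  using n by auto

lemma A_inv [simp]:
  "g \<in> carrier G \<Longrightarrow> u \<in> cols \<Longrightarrow> A (inv g) (A g u) = u"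
  "g \<in> carrier G \<Longrightarrow> u \<in> cols \<Longrightarrow> A g (A (inv g) u) = u"
  by (simp_all flip: A_mult)

lemma B_inv [simp]:
  "g \<in> carrier G \<Longrightarrow> u \<in> cols \<Longrightarrow> B (inv g) (B g u) = u"
  "g \<in> carrier G \<Longrightarrow> u \<in> cols \<Longrightarrow> B g (B (inv g) u) = u"
  by (simp_all flip: B_mult)

lemma cols_vec: "u \<in> cols \<Longrightarrow> vec u"
  by (simp add: vec_def colsD)

lemma cj_stab_A:
  assumes g: "g \<in> carrier G"
  shows "u \<in> cols \<Longrightarrow> y \<in> stab u \<Longrightarrow> cj g y \<in> stab (A g u)"
proof -
  have sub: "{x i j r | i j r. i \<in> {1..n} \<and> j \<in> {1..n} \<and> i \<noteq> j \<and> r \<in> carrier R} \<subseteq> carrier G"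
    by auto
  note stab_closed = subgroup.mem_carrier[OF subgroup_stab]
  have "g \<in> generate G {x i j r | i j r. i \<in> {1..n} \<and> j \<in> {1..n} \<and> i \<noteq> j \<and> r \<in> carrier R}"
    using g generation by blast
  then show "u \<in> cols \<Longrightarrow> y \<in> stab u \<Longrightarrow> cj g y \<in> stab (A g u)"
  proof (induction arbitrary: u y rule: generate.induct)
    case one
    then show ?case by (simp add: stab_closed)
  next
    case (incl h)
    then obtain i j r where h: "h = x i j r" "i \<in> {1..n}" "j \<in> {1..n}" "i \<noteq> j" "r \<in> carrier R"
      by blast
    then show ?case
      using incl cj_stab[of u r i j y] by (simp only: h A_x cols_vec)
  next
    case (inv h)
    then obtain i j r where h: "h = x i j r" "i \<in> {1..n}" "j \<in> {1..n}" "i \<noteq> j" "r \<in> carrier R"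
      by blast
    then have "inv h = x i j (\<ominus>\<^sub>R r)" by (simp add: x_inv)
    moreover have "A (x i j (\<ominus>\<^sub>R r)) u = shear i j (\<ominus>\<^sub>R r) u"
      using h inv.prems by (intro A_x) auto
    moreover have "cj (x i j (\<ominus>\<^sub>R r)) y \<in> stab (shear i j (\<ominus>\<^sub>R r) u)"
      using h inv.prems by (intro cj_stab cols_vec) auto
    ultimately show ?case by (simp only:)
  next
    case (eng g h)
    have c: "g \<in> carrier G" "h \<in> carrier G"
      using eng.hyps generate_in_carrier[OF sub] by auto
    have "cj g (cj h y) \<in> stab (A g (A h u))"
      using eng c by simp
    then show ?case
      using c eng.prems stab_closed by (simp add: cj_cj A_mult)
  qed
qed

text \<open>The condition on \<open>b 1\<close> makes the formula right: \<open>x 1 1\<close> is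
  trivial, so \<open>rowg\<close> does not see \<open>b 1\<close>, whereas the pairing does.\<close>

lemma A_rowg:
  assumes b: "b \<in> cols" "b 1 = \<zero>\<^bsub>R\<^esub>" and w: "w \<in> cols"
  shows "A (rowg b) w = w \<^bold>+ e1 \<^bold>* dot b w"
proof -
  have "A (lprod (\<lambda>j. x 1 j (b j)) L) w = w(1 := w 1 \<boxplus> (\<Oplus>\<^bsub>R\<^esub>j\<in>set L. b j \<cdot> w j))"
    if "distinct L" "set L \<subseteq> {1..n}" for L
    using that
  proof (induction L)
    case Nil
    then show ?case using w colsD[OF w, of 1] by simp
  next
    case (Cons a L)
    let ?s = "\<Oplus>\<^bsub>R\<^esub>j\<in>set L. b j \<cdot> w j"
    have c: "b j \<in> carrier R" "w j \<in> carrier R" if "j \<in> {1..n}" for j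
      using that b w by (simp_all add: colsD)
    have s: "?s \<in> carrier R"
      using Cons.prems c by (intro R.finsum_closed) auto
    have sum: "(\<Oplus>\<^bsub>R\<^esub>j\<in>set (a # L). b j \<cdot> w j) = b a \<cdot> w a \<boxplus> ?s"
      using Cons.prems c by (simp, intro R.finsum_insert) auto
    let ?w = "w(1 := w 1 \<boxplus> ?s)"
    have w': "?w \<in> cols"
      using w s c[of 1] by (auto simp: columns_def PiE_iff extensional_def)
    have IH: "A (lprod (\<lambda>j. x 1 j (b j)) L) w = ?w"
      by (rule Cons.IH) (use Cons.prems in auto)
    show ?case
    proof (cases "a = 1")
      case True
      have e: "A (lprod (\<lambda>j. x 1 j (b j)) (a # L)) w = A (lprod (\<lambda>j. x 1 j (b j)) L) w"
        using True by simp
      have "b a \<cdot> w a \<boxplus> ?s = ?s" using True b c[of 1] s by simp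
      then show ?thesis by (simp only: sum e IH)
    next
      case False
      have "A (lprod (\<lambda>j. x 1 j (b j)) (a # L)) w = A (x 1 a (b a)) ?w"
        using w IH by (simp add: A_mult)
      also have "\<dots> = shear 1 a (b a) ?w"
        using False Cons.prems c w' by (intro A_x) auto
      also have "\<dots> = w(1 := w 1 \<boxplus> (b a \<cdot> w a \<boxplus> ?s))"
        using False Cons.prems c[of 1] c[of a] s by (auto simp: R.a_ac)
      finally show ?thesis by (simp only: sum)
    qed
  qed
  from this[of idx] have "A (rowg b) w = w(1 := w 1 \<boxplus> dot b w)"
    by (simp add: rowg_def col_dot_def)
  moreover have "w(1 := w 1 \<boxplus> dot b w) = w \<^bold>+ e1 \<^bold>* dot b w"
  proof (rule cols_eqI[where A = "carrier R" and B = "carrier R"])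
    show "w(1 := w 1 \<boxplus> dot b w) \<in> cols"
      using w b colsD[OF w, of 1] by (auto simp: columns_def PiE_iff extensional_def)
    show "(w(1 := w 1 \<boxplus> dot b w)) i = (w \<^bold>+ e1 \<^bold>* dot b w) i" if "i \<in> {1..n}" for i
      using that w b by (auto simp: column_at colsD)
  qed (use w b in auto)
  ultimately show ?thesis by simp
qed

lemma dot_B:
  assumes "g \<in> carrier G" "w \<in> cols" "b \<in> cols"
  shows "dot b (A (inv g) w) = dot (B g b) w" "dot (B (inv g) b) w = dot b (A g w)"
  using assms dot_BA[of g "A (inv g) w" b] dot_BA[of "inv g" "A g w" b] A_inv inv_closed A_closed
  by metis+

text \<open>Conjugation by \<open>g\<close> carries \<open>stab e1\<close> into itself, so the
  result is again a row element. Its action on columns is known, and the first coordinate of that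
  action recovers the row. When \<open>g\<close> acts as the identity, this says that
  \<open>g\<close> commutes with the row element.\<close>

theorem cj_rowg:
  assumes g: "g \<in> carrier G" and e: "A g e1 = e1" and b: "b \<in> cols" "b 1 = \<zero>\<^bsub>R\<^esub>"
  shows "cj g (rowg b) = rowg (B g b)"
proof -
  have stab: "stab e1 = {rowg b | b. vec b}"
    by (rule stab_unit) (auto simp: unit_col_def)
  have "rowg b \<in> stab e1"
    unfolding stab using b cols_vec by blast
  then have "cj g (rowg b) \<in> stab e1"
    using cj_stab_A[OF g unit_cols, of "rowg b" 1] e by simp
  then obtain b0 where b0: "vec b0" "cj g (rowg b) = rowg b0"
    unfolding stab by blast
  define b' where "b' = (\<lambda>i\<in>{1..n}. if i = 1 then \<zero>\<^bsub>R\<^esub> else b0 i)"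
  have b': "b' \<in> cols"
    unfolding b'_def restrict_cols_iff using b0 by (simp add: vecD)
  have "rowg b0 = rowg b'"
    unfolding rowg_def by (rule lprod_cong) (auto simp: b'_def)
  then have eq: "cj g (rowg b) = rowg b'" using b0 by simp
  have "b' = B g b"
  proof (rule dot_eqI)
    fix w assume w: "w \<in> cols"
    have "A (rowg b') w = A g (A (rowg b) (A (inv g) w))"
      using g b w unfolding eq[symmetric] by (simp add: cj_def A_mult)
    also have "\<dots> = w \<^bold>+ e1 \<^bold>* dot (B g b) w"
      using g b w e by (simp add: A_rowg A_linear dot_B)
    finally have "w \<^bold>+ e1 \<^bold>* dot b' w = w \<^bold>+ e1 \<^bold>* dot (B g b) w"
      using b' w by (simp add: A_rowg b'_def)
    then have "(w \<^bold>+ e1 \<^bold>* dot b' w) 1 = (w \<^bold>+ e1 \<^bold>* dot (B g b) w) 1" by simp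
    then show "dot b' w = dot (B g b) w"
      using w b' b g by (simp add: column_at colsD)
  qed (use b' g b in auto)
  then show ?thesis using eq by simp
qed

section \<open>Transvections as elements of the group\<close>

definition transvection :: "(nat \<Rightarrow> 'c) \<Rightarrow> (nat \<Rightarrow> 'c) \<Rightarrow> 'a" where
  "transvection u v =
     (let g = SOME g. g \<in> carrier G \<and> A g e1 = u in cj g (rowg (B (inv g) v)))"

definition orbit :: "(nat \<Rightarrow> 'c) set" where
  "orbit = {A g e1 | g. g \<in> carrier G}"

lemma orbit_cols: "u \<in> orbit \<Longrightarrow> u \<in> cols"
  by (auto simp: orbit_def)

lemma orbit_A: "g \<in> carrier G \<Longrightarrow> u \<in> orbit \<Longrightarrow> A g u \<in> orbit"
proof -
  assume g: "g \<in> carrier G" and "u \<in> orbit"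
  then obtain h where h: "h \<in> carrier G" "u = A h e1" by (auto simp: orbit_def)
  then have "A g u = A (g \<otimes> h) e1" using g by (simp add: A_mult)
  then show "A g u \<in> orbit" unfolding orbit_def using g h by blast
qed

text \<open>Two choices of the conjugating element differ by some \<open>k\<close> fixing
  \<open>e1\<close>, and \<open>cj_rowg\<close> tells how \<open>k\<close> acts on the row element;
  so the selected element may be replaced by any other.\<close>

lemma transvection_eq:
  assumes g: "g \<in> carrier G" and v: "v \<in> cols" "dot v (A g e1) = \<zero>\<^bsub>R\<^esub>"
  shows "transvection (A g e1) v = cj g (rowg (B (inv g) v))"
proof -
  define h where "h = (SOME h. h \<in> carrier G \<and> A h e1 = A g e1)"
  have "h \<in> carrier G \<and> A h e1 = A g e1"
    unfolding h_def by (rule someI[where P = "\<lambda>h. h \<in> carrier G \<and> A h e1 = A g e1" and x = g])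
      (simp add: g)
  then have h: "h \<in> carrier G" "A h e1 = A g e1" by auto
  define k where "k = inv h \<otimes> g"
  have k: "k \<in> carrier G" "h \<otimes> k = g"
    using g h(1) by (simp_all add: k_def)
  have "A k e1 = A (inv h) (A h e1)"
    unfolding k_def h(2) using g h(1) by (simp only: A_mult inv_closed unit_cols)
  also have "\<dots> = e1" by (rule A_inv(1)[OF h(1) unit_cols])
  finally have ke: "A k e1 = e1" .
  let ?b = "B (inv g) v"
  have "dot ?b e1 = \<zero>\<^bsub>R\<^esub>"
    using g v by (simp add: dot_B)
  then have b: "?b \<in> cols" "?b 1 = \<zero>\<^bsub>R\<^esub>"
    using g v(1) dot_unit[of ?b 1] by simp_all
  have "B k ?b = B (inv h) (B g (B (inv g) v))"
    unfolding k_def using g h(1) v(1) by (simp only: B_mult inv_closed B_closed)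
  also have "\<dots> = B (inv h) v"
    using g v(1) by (simp only: B_inv)
  finally have "cj k (rowg ?b) = rowg (B (inv h) v)"
    using cj_rowg[OF k(1) ke b] by (simp only:)
  then have "cj h (rowg (B (inv h) v)) = cj h (cj k (rowg ?b))"
    by (simp only:)
  also have "\<dots> = cj g (rowg ?b)"
    using h(1) k by (simp add: cj_cj)
  finally show ?thesis
    by (simp only: transvection_def Let_def flip: h_def)
qed

text \<open>Simplification turns the index 1 into \<open>Suc 0\<close>; this is the matching form of
  the equation.\<close>

lemmas transvection_eq' = transvection_eq[unfolded One_nat_def]

lemma transvection_closed [simp]:
  assumes "u \<in> orbit" "v \<in> cols" "dot v u = \<zero>\<^bsub>R\<^esub>"
  shows "transvection u v \<in> carrier G"
  using assms by (auto simp: orbit_def transvection_eq')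

lemma cj_transvection:
  assumes h: "h \<in> carrier G" and u: "u \<in> orbit" and v: "v \<in> cols" "dot v u = \<zero>\<^bsub>R\<^esub>"
  shows "cj h (transvection u v) = transvection (A h u) (B h v)"
proof -
  obtain g where g: "g \<in> carrier G" "u = A g e1" using u by (auto simp: orbit_def)
  have "cj h (transvection u v) = cj (h \<otimes> g) (rowg (B (inv g) v))"
    using g h v by (simp add: transvection_eq' cj_cj)
  also have "B (inv g) v = B (inv (h \<otimes> g)) (B h v)"
    using g h v by (simp add: inv_mult_group B_mult)
  also have "cj (h \<otimes> g) (rowg \<dots>) = transvection (A (h \<otimes> g) e1) (B h v)"
    using g h v by (intro transvection_eq[symmetric]) (simp_all add: A_mult)
  finally show ?thesis using g h by (simp add: A_mult)
qed

lemma transvection_add: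
  assumes u: "u \<in> orbit" and v: "v \<in> cols" "dot v u = \<zero>\<^bsub>R\<^esub>" and w: "w \<in> cols" "dot w u = \<zero>\<^bsub>R\<^esub>"
  shows "transvection u (v \<^bold>+ w) = transvection u v \<otimes> transvection u w"
proof -
  obtain g where g: "g \<in> carrier G" "u = A g e1" using u by (auto simp: orbit_def)
  have "dot (v \<^bold>+ w) u = \<zero>\<^bsub>R\<^esub>"
    using u v w by (simp add: dot_simps orbit_cols)
  moreover have "rowg (B (inv g) v \<^bold>+ B (inv g) w) = rowg (B (inv g) v) \<otimes> rowg (B (inv g) w)"
  proof -
    have "rowg (B (inv g) v \<^bold>+ B (inv g) w) = rowg (\<lambda>j. B (inv g) v j \<boxplus> B (inv g) w j)"
      by (rule rowg_cong) (simp add: column_at)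
    then show ?thesis using g v w by (simp add: rowg_add cols_vec)
  qed
  ultimately show ?thesis
    using g v w by (simp add: transvection_eq' B_add cj_mult)
qed

lemma A_transvection:
  assumes u: "u \<in> orbit" and v: "v \<in> cols" "dot v u = \<zero>\<^bsub>R\<^esub>" and w: "w \<in> cols"
  shows "A (transvection u v) w = w \<^bold>+ u \<^bold>* dot v w"
proof -
  obtain g where g: "g \<in> carrier G" "u = A g e1" using u by (auto simp: orbit_def)
  let ?b = "B (inv g) v"
  have "dot ?b e1 = \<zero>\<^bsub>R\<^esub>"
    using g v by (simp add: dot_B)
  then have b: "?b \<in> cols" "?b 1 = \<zero>\<^bsub>R\<^esub>"
    using g v dot_unit[of ?b 1] by simp_all
  have "A (transvection u v) w = A g (A (rowg ?b) (A (inv g) w))"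
    using g v w by (simp add: transvection_eq' cj_def A_mult)
  also have "\<dots> = w \<^bold>+ u \<^bold>* dot v w"
    using g v w b by (simp add: A_rowg A_linear dot_B del: One_nat_def)
  finally show ?thesis .
qed

lemma transvection_x:
  assumes j: "j \<in> {1..n}" "j \<noteq> 1" and r: "r \<in> carrier R"
  shows "transvection e1 (ucol j \<^bold>* r) = x 1 j r"
proof -
  have "transvection (A \<one> e1) (ucol j \<^bold>* r) = cj \<one> (rowg (B (inv \<one>) (ucol j \<^bold>* r)))"
    using j r by (intro transvection_eq) (simp_all add: dot_simps dot_unit column_at)
  then have "transvection e1 (ucol j \<^bold>* r) = rowg (ucol j \<^bold>* r)"
    using r by simp
  also have "\<dots> = rowg (\<lambda>i. if i = j then r else \<zero>\<^bsub>R\<^esub>)"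
    using r by (intro rowg_cong) (simp add: column_at)
  finally show ?thesis using j by (simp add: rowg_single)
qed

end

section \<open>The Steinberg group acting on columns\<close>

locale steinberg_ring = column_space R n for R (structure) and n +
  assumes n4: "4 \<le> n"
begin

abbreviation St where "St \<equiv> Steinberg n R"

definition xg :: "nat \<Rightarrow> nat \<Rightarrow> 'a \<Rightarrow> (nat \<times> nat \<times> 'a) word set" where
  "xg i j r = (if (i, j, r) \<in> St_gens n R then gen_class (St_gens n R) (St_rels n R) (i, j, r) else \<one>\<^bsub>St\<^esub>)"

sublocale St: group St by (rule group_Steinberg)

lemma gens_iff: "(i, j, r) \<in> St_gens n R \<longleftrightarrow> i \<in> {1..n} \<and> j \<in> {1..n} \<and> i \<noteq> j \<and> r \<in> carrier R"
  by (simp add: St_gens_def)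

lemma xg_closed [simp]: "xg i j r \<in> carrier St"
  using St.one_closed by (simp add: xg_def Steinberg_def gen_class_closed)

lemma update_cols [simp]: "u \<in> cols \<Longrightarrow> i \<in> {1..n} \<Longrightarrow> a \<in> carrier R \<Longrightarrow> u(i := a) \<in> cols"
  by (auto simp: columns_def PiE_iff extensional_def)

text \<open>The universal property with the commutators cleared of inverses. In this form the
  relations can be checked in the semidirect product without computing inverses there;
  \<open>phi\<close> and \<open>psi\<close> are obtained from it as well.\<close>

lemma steinberg_lift:
  fixes H :: "('h, 'm) monoid_scheme" and y :: "nat \<Rightarrow> nat \<Rightarrow> 'a \<Rightarrow> 'h"
  assumes H: "group H"
    and y: "\<And>i j r. (i, j, r) \<in> St_gens n R \<Longrightarrow> y i j r \<in> carrier H"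
    and add: "\<And>i j r s. (i, j, r) \<in> St_gens n R \<Longrightarrow> s \<in> carrier R \<Longrightarrow> y i j (r \<oplus> s) = y i j r \<otimes>\<^bsub>H\<^esub> y i j s"
    and comm: "\<And>i j r h k s. (i, j, r) \<in> St_gens n R \<Longrightarrow> (h, k, s) \<in> St_gens n R \<Longrightarrow> h \<noteq> j \<Longrightarrow> k \<noteq> i \<Longrightarrow>
      y i j r \<otimes>\<^bsub>H\<^esub> y h k s = y h k s \<otimes>\<^bsub>H\<^esub> y i j r"
    and trans: "\<And>i j r k s. (i, j, r) \<in> St_gens n R \<Longrightarrow> (j, k, s) \<in> St_gens n R \<Longrightarrow> i \<noteq> k \<Longrightarrow>
      y i j r \<otimes>\<^bsub>H\<^esub> y j k s = y i k (r \<otimes> s) \<otimes>\<^bsub>H\<^esub> (y j k s \<otimes>\<^bsub>H\<^esub> y i j r)"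
  defines "h \<equiv> presented_lift H (\<lambda>(i, j, r). y i j r)"
  shows "h \<in> hom St H" and "(i, j, r) \<in> St_gens n R \<Longrightarrow> h (xg i j r) = y i j r"
proof -
  interpret H: group H by (rule H)
  let ?y = "\<lambda>(i, j, r). y i j r"
  have c: "?y \<in> St_gens n R \<rightarrow> carrier H" using y by auto
  have comm_eval: "word_eval H ?y (comm_word a b) = ?y a \<otimes>\<^bsub>H\<^esub> ?y b \<otimes>\<^bsub>H\<^esub> inv\<^bsub>H\<^esub> (?y b \<otimes>\<^bsub>H\<^esub> ?y a)"
    if "a \<in> St_gens n R" "b \<in> St_gens n R" for a b
  proof -
    have "?y a \<in> carrier H" "?y b \<in> carrier H" using c that by blast+
    then show ?thesis by (simp add: comm_word_def H.m_assoc H.inv_mult_group)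
  qed
  have rel: "word_eval H ?y v = word_eval H ?y w" if vw: "(v, w) \<in> St_rels n R" for v w
  proof -
    from vw consider
      (1) i j r s where "v = [pos (i, j, r), pos (i, j, s)]" "w = [pos (i, j, r \<oplus> s)]"
        "(i, j, r) \<in> St_gens n R" "(i, j, s) \<in> St_gens n R"
    | (2) i j r h k s where "v = comm_word (i, j, r) (h, k, s)" "w = []"
        "(i, j, r) \<in> St_gens n R" "(h, k, s) \<in> St_gens n R" "h \<noteq> j" "k \<noteq> i"
    | (3) i j r k s where "v = comm_word (i, j, r) (j, k, s)" "w = [pos (i, k, r \<otimes> s)]"
        "(i, j, r) \<in> St_gens n R" "(j, k, s) \<in> St_gens n R" "i \<noteq> k"
      unfolding St_rels_def by blast
    then show ?thesis
    proof cases
      case 1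
      then have "(i, j, r \<oplus> s) \<in> St_gens n R" "s \<in> carrier R" by (auto simp: gens_iff)
      then show ?thesis using 1 y add[of i j r s] by simp
    next
      case 2
      then show ?thesis
        using comm_eval[OF 2(3,4)] comm[of i j r h k s] y[of i j r] y[of h k s] by simp
    next
      case 3
      then have g: "(i, k, r \<otimes> s) \<in> St_gens n R" by (auto simp: gens_iff)
      show ?thesis
        using 3 comm_eval[OF 3(3,4)] trans[of i j r k s] y[of i j r] y[of j k s] y[OF g]
        by (simp add: H.m_assoc)
    qed
  qed
  show "h \<in> hom St H"
    unfolding h_def Steinberg_def by (rule H.presented_lift_hom[OF c rel])
  show "h (xg i j r) = y i j r" if "(i, j, r) \<in> St_gens n R"
    using H.presented_lift_gen[OF c rel that] that by (simp add: h_def xg_def)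
qed

lemma xg_eq: "(i, j, r) \<in> St_gens n R \<Longrightarrow> xg i j r = gen_class (St_gens n R) (St_rels n R) (i, j, r)"
  by (simp add: xg_def)

lemma St_rel:
  assumes "(v, w) \<in> St_rels n R" "v \<in> words (St_gens n R)" "w \<in> words (St_gens n R)"
  shows "word_eval St (gen_class (St_gens n R) (St_rels n R)) v
    = word_eval St (gen_class (St_gens n R) (St_rels n R)) w"
  unfolding Steinberg_def by (rule presented_group_rel[OF assms])

lemma xg_add:
  assumes "r \<in> carrier R" "s \<in> carrier R"
  shows "xg i j (r \<oplus> s) = xg i j r \<otimes>\<^bsub>St\<^esub> xg i j s"
proof (cases "(i, j, r) \<in> St_gens n R")
  case True
  then have g: "(i, j, s) \<in> St_gens n R" "(i, j, r \<oplus> s) \<in> St_gens n R" using assms by (auto simp: gens_iff)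
  have "([pos (i, j, r), pos (i, j, s)], [pos (i, j, r \<oplus> s)]) \<in> St_rels n R"
    unfolding St_rels_def using True g by blast
  from St_rel[OF this] show ?thesis
    using True g xg_closed[of i j r] xg_closed[of i j s] xg_closed[of i j "r \<oplus> s"]
    by (simp add: words_def xg_eq)
next
  case False
  then have "(i, j, s) \<notin> St_gens n R" "(i, j, r \<oplus> s) \<notin> St_gens n R" using assms by (auto simp: gens_iff)
  then show ?thesis using False by (simp add: xg_def)
qed

lemma comm_word_eval:
  assumes "(i, j, r) \<in> St_gens n R" "(h, k, s) \<in> St_gens n R"
  shows "word_eval St (gen_class (St_gens n R) (St_rels n R)) (comm_word (i, j, r) (h, k, s))
    = xg i j r \<otimes>\<^bsub>St\<^esub> xg h k s \<otimes>\<^bsub>St\<^esub> inv\<^bsub>St\<^esub> (xg h k s \<otimes>\<^bsub>St\<^esub> xg i j r)"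
  using assms xg_closed[of i j r] xg_closed[of h k s]
  by (simp add: comm_word_def xg_eq St.m_assoc St.inv_mult_group)

lemma comm_word_words:
  "a \<in> X \<Longrightarrow> b \<in> X \<Longrightarrow> comm_word a b \<in> words X"
  by (simp add: comm_word_def words_def)

lemma xg_commute:
  assumes "h \<noteq> j" "k \<noteq> i"
  shows "xg i j r \<otimes>\<^bsub>St\<^esub> xg h k s = xg h k s \<otimes>\<^bsub>St\<^esub> xg i j r"
proof (cases "(i, j, r) \<in> St_gens n R \<and> (h, k, s) \<in> St_gens n R")
  case True
  then have "(comm_word (i, j, r) (h, k, s), []) \<in> St_rels n R"
    unfolding St_rels_def using assms by blast
  from St_rel[OF this] True
  have "xg i j r \<otimes>\<^bsub>St\<^esub> xg h k s \<otimes>\<^bsub>St\<^esub> inv\<^bsub>St\<^esub> (xg h k s \<otimes>\<^bsub>St\<^esub> xg i j r) = \<one>\<^bsub>St\<^esub>"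
    by (simp add: comm_word_eval comm_word_words words_Nil)
  then show ?thesis
    using St.inv_solve_right'[of "\<one>\<^bsub>St\<^esub>"] by simp
next
  case False
  then have "xg i j r = \<one>\<^bsub>St\<^esub> \<or> xg h k s = \<one>\<^bsub>St\<^esub>" by (auto simp: xg_def)
  then show ?thesis by (elim disjE) simp_all
qed

lemma xg_trans:
  assumes "distinct [i, j, k]" "{i, j, k} \<subseteq> {1..n}" "r \<in> carrier R" "s \<in> carrier R"
  shows "xg i j r \<otimes>\<^bsub>St\<^esub> xg j k s = xg i k (r \<otimes> s) \<otimes>\<^bsub>St\<^esub> (xg j k s \<otimes>\<^bsub>St\<^esub> xg i j r)"
proof -
  have g: "(i, j, r) \<in> St_gens n R" "(j, k, s) \<in> St_gens n R" "(i, k, r \<otimes> s) \<in> St_gens n R" "i \<noteq> k"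
    using assms by (auto simp: gens_iff)
  then have "(comm_word (i, j, r) (j, k, s), [pos (i, k, r \<otimes> s)]) \<in> St_rels n R"
    unfolding St_rels_def by blast
  from St_rel[OF this] g
  have "xg i j r \<otimes>\<^bsub>St\<^esub> xg j k s \<otimes>\<^bsub>St\<^esub> inv\<^bsub>St\<^esub> (xg j k s \<otimes>\<^bsub>St\<^esub> xg i j r)
      = xg i k (r \<otimes> s)"
    using xg_closed[of i k "r \<otimes> s"]
    by (simp add: comm_word_eval comm_word_words words_Cons words_Nil xg_eq[of i k])
  then show ?thesis
    using St.inv_solve_right'[of "xg i k (r \<otimes> s)" "xg i j r \<otimes>\<^bsub>St\<^esub> xg j k s" "xg j k s \<otimes>\<^bsub>St\<^esub> xg i j r"]
    by simp
qed

lemma xg_invalid: "\<not> (i \<in> {1..n} \<and> j \<in> {1..n} \<and> i \<noteq> j) \<Longrightarrow> xg i j r = \<one>\<^bsub>St\<^esub>"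
  by (auto simp: xg_def gens_iff)

sublocale std: steinberg_system St R n xg
proof unfold_locales
  show "4 \<le> n" by (rule n4)
qed (simp_all add: xg_invalid xg_add xg_commute xg_trans)

lemma St_induct [consumes 1, case_names one gen]:
  assumes g: "g \<in> carrier St"
    and one: "P \<one>\<^bsub>St\<^esub>"
    and gen: "\<And>i j r g. (i, j, r) \<in> St_gens n R \<Longrightarrow> g \<in> carrier St \<Longrightarrow> P g \<Longrightarrow> P (xg i j r \<otimes>\<^bsub>St\<^esub> g)"
  shows "P g"
  using g unfolding Steinberg_def
proof (induction rule: presented_group_induct)
  case one
  then show ?case using assms(2) by (simp add: Steinberg_def)
next
  case (gen a g)
  obtain i j r where a: "a = (i, j, r)" by (cases a)
  then show ?case using gen assms(3)[of i j r g] by (simp add: Steinberg_def xg_eq)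
next
  case (inv_gen a g)
  obtain i j r where a: "a = (i, j, r)" by (cases a)
  then have "r \<in> carrier R" "(i, j, \<ominus> r) \<in> St_gens n R" using inv_gen by (auto simp: gens_iff)
  then show ?case
    using inv_gen assms(3)[of i j "\<ominus> r" g] std.x_inv[of r i j, symmetric] a
    by (simp add: Steinberg_def xg_eq)
qed

lemma elem_transv_act_closed [simp]:
  "(i, j, r) \<in> St_gens n R \<Longrightarrow> elem_transv n R i j r \<in> carrier GLn"
  by (simp add: gens_iff)

section \<open>The map to matrices and the two systems of root elements\<close>

definition phi :: "(nat \<times> nat \<times> 'a) word set \<Rightarrow> 'a matrix" where
  "phi = presented_lift GLn (\<lambda>(i, j, r). elem_transv n R i j r)"

text \<open>Matrices are compared through their action on columns, where an elementary transvection
  updates one coordinate and each Steinberg relation becomes an identity of updates.\<close>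

lemma
  shows phi_hom: "phi \<in> hom St GLn"
    and phi_xg: "(i, j, r) \<in> St_gens n R \<Longrightarrow> phi (xg i j r) = elem_transv n R i j r"
proof -
  have e: "elem_transv n R i j r \<in> mats" if "(i, j, r) \<in> St_gens n R" for i j r
    using that by (simp add: GL_mats)
  have a: "act (elem_transv n R i j r) u = u(i := u i \<oplus> r \<otimes> u j)"
    if "(i, j, r) \<in> St_gens n R" "u \<in> cols" for i j r u
    using that by (intro act_elem_transv) (auto simp: gens_iff)
  have 1: "elem_transv n R i j (r \<oplus> s) = elem_transv n R i j r \<otimes>\<^bsub>GLn\<^esub> elem_transv n R i j s"
    if g: "(i, j, r) \<in> St_gens n R" "s \<in> carrier R" for i j r s
    unfolding GL_simps
  proof (rule mats_eqI)
    have g': "(i, j, s) \<in> St_gens n R" "(i, j, r \<oplus> s) \<in> St_gens n R" using g by (auto simp: gens_iff)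
    fix u assume u: "u \<in> cols"
    then have c: "u i \<in> carrier R" "u j \<in> carrier R" using g by (auto simp: gens_iff colsD)
    then have s: "u(i := u i \<oplus> s \<otimes> u j) \<in> cols" using g u by (intro update_cols) (auto simp: gens_iff)
    have "act (elem_transv n R i j r \<otimes>\<^bsub>mat_monoid n R\<^esub> elem_transv n R i j s) u
        = (u(i := u i \<oplus> s \<otimes> u j))(i := u i \<oplus> s \<otimes> u j \<oplus> r \<otimes> u j)"
      using g g' u s by (simp only: act_mult e a) (auto simp: gens_iff)
    also have "\<dots> = act (elem_transv n R i j (r \<oplus> s)) u"
      unfolding a[OF g'(2) u] using g c by (auto simp: gens_iff l_distr a_ac)
    finally show "act (elem_transv n R i j (r \<oplus> s)) u
      = act (elem_transv n R i j r \<otimes>\<^bsub>mat_monoid n R\<^esub> elem_transv n R i j s) u" by (simp only:)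
  qed (use g in \<open>auto simp: gens_iff\<close>)
  have 2: "elem_transv n R i j r \<otimes>\<^bsub>GLn\<^esub> elem_transv n R h k s = elem_transv n R h k s \<otimes>\<^bsub>GLn\<^esub> elem_transv n R i j r"
    if g: "(i, j, r) \<in> St_gens n R" "(h, k, s) \<in> St_gens n R" "h \<noteq> j" "k \<noteq> i" for i j r h k s
    unfolding GL_simps
  proof (rule mats_eqI)
    fix u assume u: "u \<in> cols"
    then have c: "u i \<in> carrier R" "u j \<in> carrier R" "u h \<in> carrier R" "u k \<in> carrier R"
      using g by (auto simp: gens_iff colsD)
    then have s: "u(h := u h \<oplus> s \<otimes> u k) \<in> cols" "u(i := u i \<oplus> r \<otimes> u j) \<in> cols"
      using g u by (auto simp: gens_iff intro!: update_cols)
    show "act (elem_transv n R i j r \<otimes>\<^bsub>mat_monoid n R\<^esub> elem_transv n R h k s) u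
        = act (elem_transv n R h k s \<otimes>\<^bsub>mat_monoid n R\<^esub> elem_transv n R i j r) u"
      unfolding act_mult[OF e[OF g(1)] e[OF g(2)] u] act_mult[OF e[OF g(2)] e[OF g(1)] u]
        a[OF g(1) u] a[OF g(2) u] a[OF g(1) s(1)] a[OF g(2) s(2)]
      using g c by (auto simp: gens_iff a_ac fun_upd_twist)
  qed (use g in \<open>auto simp: gens_iff\<close>)
  have 3: "elem_transv n R i j r \<otimes>\<^bsub>GLn\<^esub> elem_transv n R j k s
      = elem_transv n R i k (r \<otimes> s) \<otimes>\<^bsub>GLn\<^esub> (elem_transv n R j k s \<otimes>\<^bsub>GLn\<^esub> elem_transv n R i j r)"
    if g: "(i, j, r) \<in> St_gens n R" "(j, k, s) \<in> St_gens n R" "i \<noteq> k" for i j r k s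
    unfolding GL_simps
  proof (rule mats_eqI)
    have g': "(i, k, r \<otimes> s) \<in> St_gens n R" using g by (auto simp: gens_iff)
    fix u assume u: "u \<in> cols"
    then have c: "u i \<in> carrier R" "u j \<in> carrier R" "u k \<in> carrier R"
      using g by (auto simp: gens_iff colsD)
    have d: "i \<noteq> j" "j \<noteq> k" using g by (auto simp: gens_iff)
    have s: "u(j := u j \<oplus> s \<otimes> u k) \<in> cols" "u(i := u i \<oplus> r \<otimes> u j) \<in> cols"
      "u(i := u i \<oplus> r \<otimes> u j, j := u j \<oplus> s \<otimes> u k) \<in> cols"
      using g u c by (auto simp: gens_iff intro!: update_cols)
    have "act (elem_transv n R j k s \<otimes>\<^bsub>mat_monoid n R\<^esub> elem_transv n R i j r) u
        = u(i := u i \<oplus> r \<otimes> u j, j := u j \<oplus> s \<otimes> u k)"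
      unfolding act_mult[OF e[OF g(2)] e[OF g(1)] u] a[OF g(1) u] a[OF g(2) s(2)] using g d by simp
    then have "act (elem_transv n R i k (r \<otimes> s) \<otimes>\<^bsub>mat_monoid n R\<^esub> (elem_transv n R j k s \<otimes>\<^bsub>mat_monoid n R\<^esub> elem_transv n R i j r)) u
        = u(i := u i \<oplus> r \<otimes> u j, j := u j \<oplus> s \<otimes> u k, i := u i \<oplus> r \<otimes> u j \<oplus> r \<otimes> s \<otimes> u k)"
      unfolding act_mult[OF e[OF g'] mats_mult[OF e[OF g(2)] e[OF g(1)]] u]
      using g d a[OF g' s(3)] by (simp only:) simp
    moreover have "act (elem_transv n R i j r \<otimes>\<^bsub>mat_monoid n R\<^esub> elem_transv n R j k s) u
        = u(j := u j \<oplus> s \<otimes> u k, i := u i \<oplus> r \<otimes> (u j \<oplus> s \<otimes> u k))"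
      unfolding act_mult[OF e[OF g(1)] e[OF g(2)] u] a[OF g(2) u] a[OF g(1) s(1)] using d by simp
    ultimately show "act (elem_transv n R i j r \<otimes>\<^bsub>mat_monoid n R\<^esub> elem_transv n R j k s) u
        = act (elem_transv n R i k (r \<otimes> s) \<otimes>\<^bsub>mat_monoid n R\<^esub> (elem_transv n R j k s \<otimes>\<^bsub>mat_monoid n R\<^esub> elem_transv n R i j r)) u"
      using g c d by (simp only:) (auto simp: gens_iff r_distr m_assoc a_assoc)
  qed (use g in \<open>auto simp: gens_iff\<close>)
  note lift = steinberg_lift[where H = GLn and y = "elem_transv n R", OF GL.group_axioms elem_transv_act_closed 1 2 3, folded phi_def]
  show "phi \<in> hom St GLn" by (rule lift(1))
  show "(i, j, r) \<in> St_gens n R \<Longrightarrow> phi (xg i j r) = elem_transv n R i j r"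
    by (rule lift(2))
qed

sublocale phi: group_hom St GLn phi
  unfolding group_hom_def group_hom_axioms_def
  using phi_hom St.group_axioms GL.group_axioms by blast

lemma phi_simps [simp]:
  "g \<in> carrier St \<Longrightarrow> phi g \<in> carrier GLn"
  "phi \<one>\<^bsub>St\<^esub> = \<one>\<^bsub>mat_monoid n R\<^esub>"
  "g \<in> carrier St \<Longrightarrow> h \<in> carrier St \<Longrightarrow> phi (g \<otimes>\<^bsub>St\<^esub> h) = phi g \<otimes>\<^bsub>mat_monoid n R\<^esub> phi h"
  using phi.hom_one phi.hom_mult by simp_all

lemma St_generation:
  "carrier St \<subseteq> generate St {xg i j r | i j r. i \<in> {1..n} \<and> j \<in> {1..n} \<and> i \<noteq> j \<and> r \<in> carrier R}"
proof
  fix g assume "g \<in> carrier St"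
  then show "g \<in> generate St {xg i j r | i j r. i \<in> {1..n} \<and> j \<in> {1..n} \<and> i \<noteq> j \<and> r \<in> carrier R}"
  proof (induction rule: St_induct)
    case one
    show ?case by (rule generate.one)
  next
    case (gen i j r g)
    then have "i \<in> {1..n} \<and> j \<in> {1..n} \<and> i \<noteq> j \<and> r \<in> carrier R" by (simp add: gens_iff)
    then show ?case by (intro generate.eng[OF generate.incl gen.IH]) blast
  qed
qed

sublocale std: steinberg_rep St R n xg "\<lambda>g. act (phi g)" "\<lambda>g. coact (phi g)"
proof unfold_locales
  show "act (phi (xg i j r)) u = u(i := u i \<oplus> r \<otimes> u j)"
    if "i \<in> {1..n}" "j \<in> {1..n}" "i \<noteq> j" "r \<in> carrier R" "u \<in> cols" for i j r u
    using that by (simp only: phi_xg gens_iff act_elem_transv simp_thms)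
qed (use St_generation in \<open>simp_all add: act_mult coact_mult coact_add act_add act_scale\<close>)

text \<open>Inverse transposition sends 1 + r e_ij to 1 - r e_ji; this accounts for the swapped
  indices, the sign, and the exchange of \<open>act\<close> and \<open>coact\<close>.\<close>

sublocale dual: steinberg_rep St R n "\<lambda>i j r. xg j i (\<ominus> r)" "\<lambda>g. coact (phi g)" "\<lambda>g. act (phi g)"
proof unfold_locales
  show "4 \<le> n" by (rule n4)
  show "coact (phi (xg j i (\<ominus> r))) u = u(i := u i \<oplus> r \<otimes> u j)"
    if "i \<in> {1..n}" "j \<in> {1..n}" "i \<noteq> j" "r \<in> carrier R" "u \<in> cols" for i j r u
  proof -
    have "coact (elem_transv n R j i (\<ominus> r)) u = u(i := u i \<oplus> \<ominus> (\<ominus> r) \<otimes> u j)"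
      using that by (intro coact_elem_transv) auto
    then show ?thesis using that by (simp only: phi_xg gens_iff simp_thms a_inv_closed minus_minus)
  qed
  show "xg j i (\<ominus> r) = \<one>\<^bsub>St\<^esub>" if "\<not> (i \<in> {1..n} \<and> j \<in> {1..n} \<and> i \<noteq> j)" for i j r
    using that by (intro xg_invalid) auto
  show "carrier St \<subseteq> generate St {xg j i (\<ominus> r) | i j r. i \<in> {1..n} \<and> j \<in> {1..n} \<and> i \<noteq> j \<and> r \<in> carrier R}"
  proof -
    have "{xg i j r | i j r. i \<in> {1..n} \<and> j \<in> {1..n} \<and> i \<noteq> j \<and> r \<in> carrier R}
        \<subseteq> {xg j i (\<ominus> r) | i j r. i \<in> {1..n} \<and> j \<in> {1..n} \<and> i \<noteq> j \<and> r \<in> carrier R}"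
      by (clarify, metis a_inv_closed minus_minus)
    then show ?thesis using St_generation St.mono_generate by blast
  qed
  show "xg j i (\<ominus> r) \<otimes>\<^bsub>St\<^esub> xg k j (\<ominus> s)
      = xg k i (\<ominus> (r \<otimes> s)) \<otimes>\<^bsub>St\<^esub> (xg k j (\<ominus> s) \<otimes>\<^bsub>St\<^esub> xg j i (\<ominus> r))"
    if "distinct [i, j, k]" "{i, j, k} \<subseteq> {1..n}" "r \<in> carrier R" "s \<in> carrier R" for i j k r s
  proof -
    \<comment> \<open>The relation is available with the two factors in the opposite order;
      cancelling the root element with indices (k, i) turns it round.\<close>
    have "xg k j (\<ominus> s) \<otimes>\<^bsub>St\<^esub> xg j i (\<ominus> r)
        = xg k i (s \<otimes> r) \<otimes>\<^bsub>St\<^esub> (xg j i (\<ominus> r) \<otimes>\<^bsub>St\<^esub> xg k j (\<ominus> s))"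
      using xg_trans[of k j i "\<ominus> s" "\<ominus> r"] that by (auto simp: l_minus r_minus)
    then show ?thesis
      using that std.x_cancel(3)[of "s \<otimes> r" _ k i] by (simp add: m_comm)
  qed
qed (simp_all add: xg_add xg_commute minus_add act_mult coact_mult coact_add act_add coact_scale)

end

section \<open>From the second presentation to the Steinberg group\<close>

locale steinberg_ideal = steinberg_ring R n for R (structure) and n +
  fixes I :: "'a set"
  assumes ideal_I: "ideal I R"
begin

lemma I_cols: "u \<in> columns n I \<Longrightarrow> u \<in> cols"
  by (rule ideal_cols[OF ideal_I])

lemma I_carrier: "a \<in> I \<Longrightarrow> a \<in> carrier R"
  by (rule ideal.Icarr[OF ideal_I])

lemma elem_set_eq: "elem_set n R = phi ` carrier St"
proof -
  have e: "{elem_transv n R i j r | i j r. i \<in> {1..n} \<and> j \<in> {1..n} \<and> i \<noteq> j \<and> r \<in> carrier R}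
      = phi ` {xg i j r | i j r. i \<in> {1..n} \<and> j \<in> {1..n} \<and> i \<noteq> j \<and> r \<in> carrier R}" (is "?E = phi ` ?X")
  proof (intro equalityI subsetI)
    fix M assume "M \<in> ?E"
    then obtain i j r where "M = elem_transv n R i j r" and g: "i \<in> {1..n} \<and> j \<in> {1..n} \<and> i \<noteq> j \<and> r \<in> carrier R"
      by blast
    then have "M = phi (xg i j r)" by (simp add: phi_xg gens_iff)
    then show "M \<in> phi ` ?X" using g by blast
  next
    fix M assume "M \<in> phi ` ?X"
    then obtain i j r where "M = phi (xg i j r)" and g: "i \<in> {1..n} \<and> j \<in> {1..n} \<and> i \<noteq> j \<and> r \<in> carrier R"
      by blast
    then have "M = elem_transv n R i j r" by (simp add: phi_xg gens_iff)
    then show "M \<in> ?E" using g by blast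
  qed
  have "?X \<subseteq> carrier St" by auto
  moreover from this have "carrier St = generate St ?X"
    using St_generation St.generate_incl by blast
  ultimately show ?thesis
    unfolding elem_set_def e using phi.generate_img by simp
qed

text \<open>\<open>h\<close> is built as a lift of the inverse transpose of \<open>g\<close>, one
  generator at a time. It shows that e_1 has the same orbit under both actions, as it must, because
  \<open>F\<close> and \<open>S\<close> draw their E(n,R)e_1 column from one set.\<close>

lemma contragredient:
  "g \<in> carrier St \<Longrightarrow> \<exists>h\<in>carrier St. \<forall>u\<in>cols. act (phi h) u = coact (phi g) u \<and> coact (phi h) u = act (phi g) u"
proof (induction rule: St_induct)
  case one
  show ?case by (rule bexI[of _ "\<one>\<^bsub>St\<^esub>"]) simp_all
next
  case (gen i j r g)
  then obtain h where h: "h \<in> carrier St"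
    "\<And>u. u \<in> cols \<Longrightarrow> act (phi h) u = coact (phi g) u \<and> coact (phi h) u = act (phi g) u" by blast
  have g: "i \<in> {1..n}" "j \<in> {1..n}" "i \<noteq> j" "r \<in> carrier R" using gen by (auto simp: gens_iff)
  have "act (phi (xg j i (\<ominus> r))) u = coact (phi (xg i j r)) u" if "u \<in> cols" for u
    using g that std.A_x[of j i "\<ominus> r" u] dual.A_x[of j i "\<ominus> r" u] by (simp only: a_inv_closed minus_minus simp_thms)
  moreover have "coact (phi (xg j i (\<ominus> r))) u = act (phi (xg i j r)) u" if "u \<in> cols" for u
    using g that std.A_x[of i j r u] dual.A_x[of i j r u] by (simp only: simp_thms)
  ultimately show ?case
    using h gen(2) by (intro bexI[of _ "xg j i (\<ominus> r) \<otimes>\<^bsub>St\<^esub> h"]) (simp_all add: act_mult coact_mult)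
qed

lemma elem_cols_eq: "elem_cols n R = std.orbit" "elem_cols n R = dual.orbit"
proof -
  show 1: "elem_cols n R = std.orbit"
    unfolding elem_cols_def elem_set_eq std.orbit_def by blast
  have "std.orbit = dual.orbit"
    unfolding std.orbit_def dual.orbit_def
    using contragredient unit_cols by (intro equalityI subsetI; clarify; metis)
  with 1 show "elem_cols n R = dual.orbit" by simp
qed

lemma orbit_iff: "u \<in> std.orbit \<longleftrightarrow> u \<in> elem_cols n R" "u \<in> dual.orbit \<longleftrightarrow> u \<in> elem_cols n R"
  using elem_cols_eq by simp_all

lemma elem_cols_cols: "u \<in> elem_cols n R \<Longrightarrow> u \<in> cols"
  using std.orbit_cols elem_cols_eq by blast

text \<open>Ordered pairs of distinct indices are connected by changing one entry at a time: (i0,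
  j0), (i0, c), (i, c), (i, j). The spare index c keeps the entries distinct on the way.\<close>

lemma pair_connected:
  assumes base: "P i0 j0" "i0 \<in> {1..n}" "j0 \<in> {1..n}" "i0 \<noteq> j0"
    and left: "\<And>a b c. distinct [a, b, c] \<Longrightarrow> {a, b, c} \<subseteq> {1..n} \<Longrightarrow> P a c \<Longrightarrow> P b c"
    and right: "\<And>a b c. distinct [a, b, c] \<Longrightarrow> {a, b, c} \<subseteq> {1..n} \<Longrightarrow> P c a \<Longrightarrow> P c b"
    and ij: "i \<in> {1..n}" "j \<in> {1..n}" "i \<noteq> j"
  shows "P i j"
proof -
  obtain c where c: "c \<in> {1..n}" "c \<noteq> i0" "c \<noteq> i" "c \<noteq> j" by (rule std.fresh_index)
  have "P i0 c"
    using base c right[of j0 c i0] by (cases "c = j0") auto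
  then have "P i c"
    using base c ij left[of i0 i c] by (cases "i = i0") auto
  then show "P i j"
    using right[of c j i] c ij by auto
qed

section \<open>Transvections of both kinds in the Steinberg group\<close>

definition T :: "(nat \<Rightarrow> 'a) \<Rightarrow> (nat \<Rightarrow> 'a) \<Rightarrow> (nat \<times> nat \<times> 'a) word set" where
  "T u v = std.transvection u v"

text \<open>The dual system acts by inverse transposes, and \<open>(1 + u v\<^sup>t)\<^sup>-\<^sup>t = 1 - v u\<^sup>t\<close>; whence the sign.\<close>

definition T' :: "(nat \<Rightarrow> 'a) \<Rightarrow> (nat \<Rightarrow> 'a) \<Rightarrow> (nat \<times> nat \<times> 'a) word set" where
  "T' u v = dual.transvection v (u \<^bold>* \<ominus> \<one>)"

lemma scale_minus: "u \<in> cols \<Longrightarrow> v \<in> cols \<Longrightarrow> (u \<^bold>+ v) \<^bold>* \<ominus> \<one> = u \<^bold>* \<ominus> \<one> \<^bold>+ v \<^bold>* \<ominus> \<one>"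
  by (rule dot_eqI) (simp_all add: dot_simps l_distr)

lemma T_closed [simp]: "u \<in> elem_cols n R \<Longrightarrow> v \<in> cols \<Longrightarrow> dot u v = \<zero> \<Longrightarrow> T u v \<in> carrier St"
  unfolding T_def by (rule std.transvection_closed) (simp_all add: orbit_iff elem_cols_cols dot_commute)

lemma T'_closed [simp]: "v \<in> elem_cols n R \<Longrightarrow> u \<in> cols \<Longrightarrow> dot u v = \<zero> \<Longrightarrow> T' u v \<in> carrier St"
  unfolding T'_def
  by (rule dual.transvection_closed) (simp_all add: orbit_iff elem_cols_cols dot_simps)

lemma T_add: "u \<in> elem_cols n R \<Longrightarrow> v \<in> cols \<Longrightarrow> w \<in> cols \<Longrightarrow> dot u v = \<zero> \<Longrightarrow> dot u w = \<zero> \<Longrightarrow>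
    T u (v \<^bold>+ w) = T u v \<otimes>\<^bsub>St\<^esub> T u w"
  unfolding T_def by (rule std.transvection_add) (simp_all add: orbit_iff elem_cols_cols dot_commute)

lemma T'_add: "v \<in> elem_cols n R \<Longrightarrow> u \<in> cols \<Longrightarrow> w \<in> cols \<Longrightarrow> dot u v = \<zero> \<Longrightarrow> dot w v = \<zero> \<Longrightarrow>
    T' (u \<^bold>+ w) v = T' u v \<otimes>\<^bsub>St\<^esub> T' w v"
  unfolding T'_def scale_minus
  by (rule dual.transvection_add) (simp_all add: orbit_iff elem_cols_cols dot_simps)

lemma cj_T:
  "g \<in> carrier St \<Longrightarrow> u \<in> elem_cols n R \<Longrightarrow> v \<in> cols \<Longrightarrow> dot u v = \<zero> \<Longrightarrow>
    St.cj g (T u v) = T (act (phi g) u) (coact (phi g) v)"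
  unfolding T_def by (rule std.cj_transvection) (simp_all add: orbit_iff elem_cols_cols dot_commute)

lemma cj_T':
  "g \<in> carrier St \<Longrightarrow> v \<in> elem_cols n R \<Longrightarrow> u \<in> cols \<Longrightarrow> dot u v = \<zero> \<Longrightarrow>
    St.cj g (T' u v) = T' (act (phi g) u) (coact (phi g) v)"
  unfolding T'_def
  by (subst dual.cj_transvection) (simp_all add: orbit_iff elem_cols_cols dot_simps act_scale)

lemma phi_T:
  assumes "u \<in> elem_cols n R" "v \<in> cols" "dot u v = \<zero>"
  shows "phi (T u v) = transv n R u v"
proof (rule mats_eqI)
  show "act (phi (T u v)) w = act (transv n R u v) w" if "w \<in> cols" for w
    unfolding T_def using assms that
    by (simp add: std.A_transvection orbit_iff elem_cols_cols dot_commute act_transv)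
qed (use assms in \<open>simp_all add: elem_cols_cols\<close>)

section \<open>Moving root elements between index pairs\<close>

lemma act_phi_xg:
  "i \<in> {1..n} \<Longrightarrow> j \<in> {1..n} \<Longrightarrow> i \<noteq> j \<Longrightarrow> r \<in> carrier R \<Longrightarrow> u \<in> cols \<Longrightarrow>
    act (phi (xg i j r)) u = u(i := u i \<oplus> r \<otimes> u j)"
  by (rule std.A_x)

lemma coact_phi_xg:
  "i \<in> {1..n} \<Longrightarrow> j \<in> {1..n} \<Longrightarrow> i \<noteq> j \<Longrightarrow> r \<in> carrier R \<Longrightarrow> u \<in> cols \<Longrightarrow>
    coact (phi (xg i j r)) u = u(j := u j \<oplus> \<ominus> r \<otimes> u i)"
  using dual.A_x[of j i "\<ominus> r" u] by simp

text \<open>Two of the three factors of a Weyl element already carry e_a to e_b under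
  \<open>act\<close> and fix e_c under \<open>coact\<close>. In the reverse order they do the same
  with the two actions exchanged, which is \<open>comove\<close>.\<close>

definition move :: "nat \<Rightarrow> nat \<Rightarrow> (nat \<times> nat \<times> 'a) word set" where
  "move a b = xg a b (\<ominus> \<one>) \<otimes>\<^bsub>St\<^esub> xg b a \<one>"

definition comove :: "nat \<Rightarrow> nat \<Rightarrow> (nat \<times> nat \<times> 'a) word set" where
  "comove a b = xg b a \<one> \<otimes>\<^bsub>St\<^esub> xg a b (\<ominus> \<one>)"

lemma move_closed [simp]: "move a b \<in> carrier St" "comove a b \<in> carrier St"
  by (simp_all add: move_def comove_def)

lemma
  assumes d: "distinct [a, b]" "{a, b} \<subseteq> {1..n}" and r: "r \<in> carrier R" "s \<in> carrier R"
    and u: "u \<in> cols"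
  shows act_two: "act (phi (xg a b r \<otimes>\<^bsub>St\<^esub> xg b a s)) u
      = u(b := u b \<oplus> s \<otimes> u a, a := u a \<oplus> r \<otimes> (u b \<oplus> s \<otimes> u a))"
    and coact_two: "coact (phi (xg a b r \<otimes>\<^bsub>St\<^esub> xg b a s)) u
      = u(a := u a \<oplus> \<ominus> s \<otimes> u b, b := u b \<oplus> \<ominus> r \<otimes> (u a \<oplus> \<ominus> s \<otimes> u b))"
proof -
  have c: "u a \<in> carrier R" "u b \<in> carrier R" using d u by (auto simp: colsD)
  have w: "u(b := u b \<oplus> s \<otimes> u a) \<in> cols" "u(a := u a \<oplus> \<ominus> s \<otimes> u b) \<in> cols"
    using d u r c by (auto intro!: update_cols)
  have "act (phi (xg a b r \<otimes>\<^bsub>St\<^esub> xg b a s)) u = act (phi (xg a b r)) (act (phi (xg b a s)) u)"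
    using u by (simp add: act_mult)
  also have "act (phi (xg b a s)) u = u(b := u b \<oplus> s \<otimes> u a)"
    using d u r by (intro act_phi_xg) auto
  also have "act (phi (xg a b r)) \<dots> = u(b := u b \<oplus> s \<otimes> u a, a := u a \<oplus> r \<otimes> (u b \<oplus> s \<otimes> u a))"
    using d w r act_phi_xg[of a b r "u(b := u b \<oplus> s \<otimes> u a)"] by (simp only:) auto
  finally show "act (phi (xg a b r \<otimes>\<^bsub>St\<^esub> xg b a s)) u
      = u(b := u b \<oplus> s \<otimes> u a, a := u a \<oplus> r \<otimes> (u b \<oplus> s \<otimes> u a))" .
  have "coact (phi (xg a b r \<otimes>\<^bsub>St\<^esub> xg b a s)) u = coact (phi (xg a b r)) (coact (phi (xg b a s)) u)"
    using u by (simp add: coact_mult)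
  also have "coact (phi (xg b a s)) u = u(a := u a \<oplus> \<ominus> s \<otimes> u b)"
    using d u r by (intro coact_phi_xg) auto
  also have "coact (phi (xg a b r)) \<dots> = u(a := u a \<oplus> \<ominus> s \<otimes> u b, b := u b \<oplus> \<ominus> r \<otimes> (u a \<oplus> \<ominus> s \<otimes> u b))"
    using d w r coact_phi_xg[of a b r "u(a := u a \<oplus> \<ominus> s \<otimes> u b)"] by (simp only:) auto
  finally show "coact (phi (xg a b r \<otimes>\<^bsub>St\<^esub> xg b a s)) u
      = u(a := u a \<oplus> \<ominus> s \<otimes> u b, b := u b \<oplus> \<ominus> r \<otimes> (u a \<oplus> \<ominus> s \<otimes> u b))" .
qed

lemma
  assumes d: "distinct [a, b, c]" "{a, b, c} \<subseteq> {1..n}"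
  shows act_move: "act (phi (move a b)) (ucol a) = ucol b"
    and coact_move: "coact (phi (move a b)) (ucol c) = ucol c"
    and coact_comove: "coact (phi (comove a b)) (ucol a) = ucol b"
    and act_comove: "act (phi (comove a b)) (ucol c) = ucol c"
proof -
  have ext: "u = ucol h" if "u \<in> cols" "\<And>k. k \<in> {1..n} \<Longrightarrow> u k = (if k = h then \<one> else \<zero>)" for u h
    using that unit_cols
    by (intro cols_eqI[where A = "carrier R" and B = "carrier R"]) (simp_all add: column_at)
  have act_cl: "act (phi g) (ucol h) \<in> cols" "coact (phi g) (ucol h) \<in> cols"
    if "g \<in> carrier St" for g h
    using that by simp_all
  show "act (phi (move a b)) (ucol a) = ucol b"
    by (rule ext[OF act_cl(1)[OF move_closed(1)]], unfold move_def, subst act_two)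
      (use d in \<open>auto simp: column_at l_neg r_neg\<close>)
  show "coact (phi (move a b)) (ucol c) = ucol c"
    by (rule ext[OF act_cl(2)[OF move_closed(1)]], unfold move_def, subst coact_two)
      (use d in \<open>auto simp: column_at l_neg r_neg\<close>)
  show "coact (phi (comove a b)) (ucol a) = ucol b"
    by (rule ext[OF act_cl(2)[OF move_closed(2)]], unfold comove_def, subst coact_two)
      (use d in \<open>auto simp: column_at l_neg r_neg\<close>)
  show "act (phi (comove a b)) (ucol c) = ucol c"
    by (rule ext[OF act_cl(1)[OF move_closed(2)]], unfold comove_def, subst act_two)
      (use d in \<open>auto simp: column_at l_neg r_neg\<close>)
qed

lemma
  assumes d: "distinct [a, b, c]" "{a, b, c} \<subseteq> {1..n}" and s: "s \<in> carrier R"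
  shows cj_move: "St.cj (move a b) (xg a c s) = xg b c s"
    and cj_comove: "St.cj (comove a b) (xg c a s) = xg c b s"
  using d s
  by (simp_all add: move_def comove_def St.cj_mult std.cj_x_left std.cj_x_right std.cj_x_commute
      l_minus r_minus St.m_assoc std.x_commute[of a c c b] std.x_commute[of c b a c] flip: St.cj_cj)

text \<open>Connectedness of index pairs, starting from (1, 2), where the identity serves. This
  supplies the matrix in (R4) for any two distinct unit columns.\<close>

lemma unit_pair:
  assumes "i \<in> {1..n}" "j \<in> {1..n}" "i \<noteq> j"
  shows "\<exists>g\<in>carrier St. act (phi g) (ucol 1) = ucol i \<and> coact (phi g) (ucol 2) = ucol j"
proof (rule pair_connected[of _ 1 2 i j])
  show "\<exists>g\<in>carrier St. act (phi g) (ucol 1) = ucol 1 \<and> coact (phi g) (ucol 2) = ucol 2"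
    by (rule bexI[of _ "\<one>\<^bsub>St\<^esub>"]) simp_all
next
  fix a b c assume d: "distinct [a, b, c]" "{a, b, c} \<subseteq> {1..n}"
  {
    assume "\<exists>g\<in>carrier St. act (phi g) (ucol 1) = ucol a \<and> coact (phi g) (ucol 2) = ucol c"
    then obtain g where g: "g \<in> carrier St" "act (phi g) (ucol 1) = ucol a" "coact (phi g) (ucol 2) = ucol c"
      by blast
    have "act (phi (move a b \<otimes>\<^bsub>St\<^esub> g)) (ucol 1) = ucol b" "coact (phi (move a b \<otimes>\<^bsub>St\<^esub> g)) (ucol 2) = ucol c"
      using d g(1) by (simp_all only: phi_simps act_mult coact_mult GL_mats g(2,3) unit_cols move_closed
          act_move coact_move)
    then show "\<exists>g\<in>carrier St. act (phi g) (ucol 1) = ucol b \<and> coact (phi g) (ucol 2) = ucol c"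
      using g(1) move_closed(1) St.m_closed by blast
  next
    assume "\<exists>g\<in>carrier St. act (phi g) (ucol 1) = ucol c \<and> coact (phi g) (ucol 2) = ucol a"
    then obtain g where g: "g \<in> carrier St" "act (phi g) (ucol 1) = ucol c" "coact (phi g) (ucol 2) = ucol a"
      by blast
    have "act (phi (comove a b \<otimes>\<^bsub>St\<^esub> g)) (ucol 1) = ucol c" "coact (phi (comove a b \<otimes>\<^bsub>St\<^esub> g)) (ucol 2) = ucol b"
      using d g(1) by (simp_all only: phi_simps act_mult coact_mult GL_mats g(2,3) unit_cols move_closed
          act_comove coact_comove)
    then show "\<exists>g\<in>carrier St. act (phi g) (ucol 1) = ucol c \<and> coact (phi g) (ucol 2) = ucol b"
      using g(1) move_closed(2) St.m_closed by blast
  }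
qed (use assms n4 in auto)

lemma unit_elem_cols:
  assumes "i \<in> {1..n}"
  shows "ucol i \<in> elem_cols n R"
proof -
  obtain j where "j \<in> {1..n}" "j \<noteq> i" by (rule std.fresh_index)
  then show ?thesis
    using unit_pair[of i j] assms unfolding elem_cols_eq(1) std.orbit_def by force
qed

lemma T_unit:
  assumes "i \<in> {1..n}" "j \<in> {1..n}" "i \<noteq> j" and s: "s \<in> carrier R"
  shows "T (ucol i) (ucol j \<^bold>* s) = xg i j s"
proof (rule pair_connected[of _ 1 2 i j])
  show "T (ucol 1) (ucol 2 \<^bold>* s) = xg 1 2 s"
    unfolding T_def using s n4 by (intro std.transvection_x) auto
next
  fix a b c assume d: "distinct [a, b, c]" "{a, b, c} \<subseteq> {1..n}"
  {
    assume e: "T (ucol a) (ucol c \<^bold>* s) = xg a c s"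
    have "St.cj (move a b) (T (ucol a) (ucol c \<^bold>* s))
        = T (act (phi (move a b)) (ucol a)) (coact (phi (move a b)) (ucol c \<^bold>* s))"
      using d s by (intro cj_T) (auto simp: unit_elem_cols dot_simps dot_unit_unit)
    then show "T (ucol b) (ucol c \<^bold>* s) = xg b c s"
      using d s by (simp add: e cj_move act_move[of a b c] coact_scale coact_move)
  next
    assume e: "T (ucol c) (ucol a \<^bold>* s) = xg c a s"
    have "St.cj (comove a b) (T (ucol c) (ucol a \<^bold>* s))
        = T (act (phi (comove a b)) (ucol c)) (coact (phi (comove a b)) (ucol a \<^bold>* s))"
      using d s by (intro cj_T) (auto simp: unit_elem_cols dot_simps dot_unit_unit)
    then show "T (ucol c) (ucol b \<^bold>* s) = xg c b s"
      using d s by (simp add: e cj_comove act_comove[of a b c] coact_scale coact_comove[of a b c])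
  }
qed (use assms n4 in auto)

lemma scale_scale: "u \<in> cols \<Longrightarrow> a \<in> carrier R \<Longrightarrow> b \<in> carrier R \<Longrightarrow> u \<^bold>* a \<^bold>* b = u \<^bold>* (a \<otimes> b)"
  by (rule dot_eqI) (simp_all add: dot_simps m_assoc)

lemma T'_unit:
  assumes "i \<in> {1..n}" "j \<in> {1..n}" "i \<noteq> j" and s: "s \<in> carrier R"
  shows "T' (ucol i \<^bold>* s) (ucol j) = xg i j s"
proof (rule pair_connected[of _ 2 1 i j])
  \<comment> \<open>The base pair is (2, 1): dual row elements over e_1 are made of the elements
    \<open>x_j1\<close>, and the sign of the dual system cancels the one in
    \<open>T'\<close>.\<close>
  have "dual.transvection (ucol 1) (ucol 2 \<^bold>* (\<ominus> s)) = xg 2 1 (\<ominus> (\<ominus> s))"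
    using s n4 by (intro dual.transvection_x) auto
  then show "T' (ucol 2 \<^bold>* s) (ucol 1) = xg 2 1 s"
    unfolding T'_def using s by (simp add: scale_scale r_minus)
next
  fix a b c assume d: "distinct [a, b, c]" "{a, b, c} \<subseteq> {1..n}"
  {
    assume e: "T' (ucol a \<^bold>* s) (ucol c) = xg a c s"
    have "St.cj (move a b) (T' (ucol a \<^bold>* s) (ucol c))
        = T' (act (phi (move a b)) (ucol a \<^bold>* s)) (coact (phi (move a b)) (ucol c))"
      using d s by (intro cj_T') (auto simp: unit_elem_cols dot_simps dot_unit_unit)
    then show "T' (ucol b \<^bold>* s) (ucol c) = xg b c s"
      using d s by (simp add: e cj_move act_move[of a b c] act_scale coact_move)
  next
    assume e: "T' (ucol c \<^bold>* s) (ucol a) = xg c a s"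
    have "St.cj (comove a b) (T' (ucol c \<^bold>* s) (ucol a))
        = T' (act (phi (comove a b)) (ucol c \<^bold>* s)) (coact (phi (comove a b)) (ucol a))"
      using d s by (intro cj_T') (auto simp: unit_elem_cols dot_simps dot_unit_unit)
    then show "T' (ucol c \<^bold>* s) (ucol b) = xg c b s"
      using d s by (simp add: e cj_comove act_comove[of a b c] act_scale coact_comove[of a b c])
  }
qed (use assms n4 in auto)

section \<open>The homomorphism out of the second presentation\<close>

abbreviation Star where "Star \<equiv> star_Steinberg n R I"

definition sgen :: "'a star_gen \<Rightarrow> 'a star_gen word set" where
  "sgen = gen_class (star_gens n R I) (star_rels n R I)"

lemma F_gens: "F u v \<in> star_gens n R I \<longleftrightarrow> u \<in> elem_cols n R \<and> v \<in> columns n I \<and> dot u v = \<zero>"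
  by (auto simp: star_gens_def)

lemma S_gens: "S u v \<in> star_gens n R I \<longleftrightarrow> u \<in> columns n I \<and> v \<in> elem_cols n R \<and> dot u v = \<zero>"
  by (auto simp: star_gens_def)

lemma F_gensD: "F u v \<in> star_gens n R I \<Longrightarrow> u \<in> elem_cols n R \<and> u \<in> cols \<and> v \<in> cols \<and> dot u v = \<zero>"
  by (simp add: F_gens I_cols elem_cols_cols)

lemma S_gensD: "S u v \<in> star_gens n R I \<Longrightarrow> v \<in> elem_cols n R \<and> u \<in> cols \<and> v \<in> cols \<and> dot u v = \<zero>"
  by (simp add: S_gens I_cols elem_cols_cols)

text \<open>(R3) appears as an equation between products, with t(v,u)^-1 rewritten as the coaction
  of t(u,v); (R4) is indexed by elements of the Steinberg group because \<open>elem_set\<close> is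
  the image of \<open>phi\<close>.\<close>

lemma star_lift:
  fixes H :: "('h, 'm) monoid_scheme" and f :: "'a star_gen \<Rightarrow> 'h"
  assumes H: "group H"
    and closed: "\<And>z. z \<in> star_gens n R I \<Longrightarrow> f z \<in> carrier H"
    and R1: "\<And>u v w. F u v \<in> star_gens n R I \<Longrightarrow> F u w \<in> star_gens n R I \<Longrightarrow>
      f (F u v) \<otimes>\<^bsub>H\<^esub> f (F u w) = f (F u (v \<^bold>+ w))"
    and R2: "\<And>u v w. S u v \<in> star_gens n R I \<Longrightarrow> S w v \<in> star_gens n R I \<Longrightarrow>
      f (S u v) \<otimes>\<^bsub>H\<^esub> f (S w v) = f (S (u \<^bold>+ w) v)"
    and R3: "\<And>u v u' v'. F u v \<in> star_gens n R I \<Longrightarrow> F u' v' \<in> star_gens n R I \<Longrightarrow>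
      f (F u v) \<otimes>\<^bsub>H\<^esub> f (F u' v')
        = f (F (act (transv n R u v) u') (coact (transv n R u v) v')) \<otimes>\<^bsub>H\<^esub> f (F u v)"
    and R4: "\<And>g a. g \<in> carrier St \<Longrightarrow> a \<in> I \<Longrightarrow>
      f (F (act (phi g) (ucol 1)) (coact (phi g) (ucol 2) \<^bold>* a))
        = f (S (act (phi g) (ucol 1) \<^bold>* a) (coact (phi g) (ucol 2)))"
  defines "h \<equiv> presented_lift H f"
  shows "h \<in> hom Star H" and "z \<in> star_gens n R I \<Longrightarrow> h (sgen z) = f z"
proof -
  interpret H: group H by (rule H)
  have c: "f \<in> star_gens n R I \<rightarrow> carrier H" using closed by blast
  have rels: "word_eval H f v = word_eval H f w"
    if vw: "(v, w) \<in> star_rels n R I" and c: "v \<in> words (star_gens n R I)" "w \<in> words (star_gens n R I)"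
    for v w
  proof -
    from vw consider
      (1) a b b' where "v = [pos (F a b), pos (F a b')]" "w = [pos (F a (b \<^bold>+ b'))]"
    | (2) a b b' where "v = [pos (S b a), pos (S b' a)]" "w = [pos (S (b \<^bold>+ b') a)]"
    | (3) a b a' b' where "v = [pos (F a b), pos (F a' b'), neg (F a b)]"
        "w = [pos (F (act (transv n R a b) a') (act (inv\<^bsub>GLn\<^esub> (transv n R b a)) b'))]"
    | (4) a b s M where "v = [pos (F a (b \<^bold>* s))]" "w = [pos (S (a \<^bold>* s) b)]" "s \<in> I" "M \<in> elem_set n R"
        "a = act M (ucol 1)" "b = coact M (ucol 2)"
      unfolding star_rels_def coact_def by (elim UnE) blast+
    then show ?thesis
    proof cases
      case 1
      then have g: "F a b \<in> star_gens n R I" "F a b' \<in> star_gens n R I" "F a (b \<^bold>+ b') \<in> star_gens n R I"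
        using c by (auto simp: words_Cons)
      show ?thesis using 1 R1[OF g(1,2)] closed[OF g(1)] closed[OF g(2)] closed[OF g(3)] by simp
    next
      case 2
      then have g: "S b a \<in> star_gens n R I" "S b' a \<in> star_gens n R I" "S (b \<^bold>+ b') a \<in> star_gens n R I"
        using c by (auto simp: words_Cons)
      show ?thesis using 2 R2[OF g(1,2)] closed[OF g(1)] closed[OF g(2)] closed[OF g(3)] by simp
    next
      case 3
      let ?z = "F (act (transv n R a b) a') (act (inv\<^bsub>GLn\<^esub> (transv n R b a)) b')"
      have g: "F a b \<in> star_gens n R I" "F a' b' \<in> star_gens n R I" "?z \<in> star_gens n R I"
        using c 3 by (auto simp: words_Cons)
      have ab: "a \<in> cols" "b \<in> cols" "dot a b = \<zero>" "b' \<in> cols"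
        using F_gensD[OF g(1)] F_gensD[OF g(2)] by blast+
      then have "dot b a = \<zero>" using dot_commute[of a b] by simp
      then have "coact (transv n R a b) b' = act (inv\<^bsub>GLn\<^esub> (transv n R b a)) b'"
        using ab by (simp add: coact_transv act_inv_transv)
      then have "f (F a b) \<otimes>\<^bsub>H\<^esub> f (F a' b') = f ?z \<otimes>\<^bsub>H\<^esub> f (F a b)"
        using R3[OF g(1,2)] by simp
      then have "f (F a b) \<otimes>\<^bsub>H\<^esub> f (F a' b') \<otimes>\<^bsub>H\<^esub> inv\<^bsub>H\<^esub> f (F a b) = f ?z"
        using closed[OF g(1)] closed[OF g(3)] by (simp add: H.m_assoc)
      then show ?thesis
        unfolding 3 using closed[OF g(1)] closed[OF g(2)] closed[OF g(3)] by (simp add: H.m_assoc)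
    next
      case 4
      then obtain g where g: "g \<in> carrier St" "M = phi g" unfolding elem_set_eq by blast
      have e: "f (F a (b \<^bold>* s)) = f (S (a \<^bold>* s) b)" using R4[OF g(1) 4(3)] 4 g by simp
      have "F a (b \<^bold>* s) \<in> star_gens n R I" "S (a \<^bold>* s) b \<in> star_gens n R I"
        using c unfolding 4(1,2) by (auto simp: words_Cons)
      from closed[OF this(1)] closed[OF this(2)] e show ?thesis unfolding 4(1,2) by simp
    qed
  qed
  show "h \<in> hom Star H"
    unfolding h_def star_Steinberg_def by (rule H.presented_lift_hom[OF c rels])
  show "h (sgen z) = f z" if "z \<in> star_gens n R I"
    unfolding h_def sgen_def by (rule H.presented_lift_gen[OF c rels that])
qed

definition kappa_gen :: "'a star_gen \<Rightarrow> (nat \<times> nat \<times> 'a) word set" where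
  "kappa_gen z = (case z of F u v \<Rightarrow> T u v | S u v \<Rightarrow> T' u v)"

definition kappa :: "'a star_gen word set \<Rightarrow> (nat \<times> nat \<times> 'a) word set" where
  "kappa = presented_lift St kappa_gen"

lemma kappa_gen_simps [simp]: "kappa_gen (F u v) = T u v" "kappa_gen (S u v) = T' u v"
  by (simp_all add: kappa_gen_def)

lemma
  shows kappa_hom: "kappa \<in> hom Star St"
    and kappa_sgen: "z \<in> star_gens n R I \<Longrightarrow> kappa (sgen z) = kappa_gen z"
proof -
  have closed: "kappa_gen z \<in> carrier St" if "z \<in> star_gens n R I" for z
    using that by (cases z) (auto dest: F_gensD S_gensD)
  have R1: "kappa_gen (F u v) \<otimes>\<^bsub>St\<^esub> kappa_gen (F u w) = kappa_gen (F u (v \<^bold>+ w))"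
    if "F u v \<in> star_gens n R I" "F u w \<in> star_gens n R I" for u v w
    using F_gensD[OF that(1)] F_gensD[OF that(2)] by (simp add: T_add)
  have R2: "kappa_gen (S u v) \<otimes>\<^bsub>St\<^esub> kappa_gen (S w v) = kappa_gen (S (u \<^bold>+ w) v)"
    if "S u v \<in> star_gens n R I" "S w v \<in> star_gens n R I" for u v w
    using S_gensD[OF that(1)] S_gensD[OF that(2)] by (simp add: T'_add)
  have R3: "kappa_gen (F u v) \<otimes>\<^bsub>St\<^esub> kappa_gen (F u' v')
      = kappa_gen (F (act (transv n R u v) u') (coact (transv n R u v) v')) \<otimes>\<^bsub>St\<^esub> kappa_gen (F u v)"
    if "F u v \<in> star_gens n R I" "F u' v' \<in> star_gens n R I" for u v u' v'
  proof -
    have g: "u \<in> elem_cols n R" "v \<in> cols" "dot u v = \<zero>" "u' \<in> elem_cols n R" "v' \<in> cols" "dot u' v' = \<zero>"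
      using F_gensD[OF that(1)] F_gensD[OF that(2)] by blast+
    then have "St.cj (T u v) (T u' v') = T (act (transv n R u v) u') (coact (transv n R u v) v')"
      by (simp add: cj_T phi_T)
    moreover from this have "T (act (transv n R u v) u') (coact (transv n R u v) v') \<in> carrier St"
      using g St.cj_closed[of "T u v" "T u' v'"] by simp
    ultimately show ?thesis
      using g by (simp add: St.cj_eq_iff)
  qed
  have R4: "kappa_gen (F (act (phi g) (ucol 1)) (coact (phi g) (ucol 2) \<^bold>* a))
        = kappa_gen (S (act (phi g) (ucol 1) \<^bold>* a) (coact (phi g) (ucol 2)))"
    if g: "g \<in> carrier St" and "a \<in> I" for g a
  proof -
    have a: "a \<in> carrier R" using that by (simp add: I_carrier)
    have i: "1 \<in> {1..n}" "2 \<in> {1..n}" "(1::nat) \<noteq> 2" using n4 by auto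
    \<comment> \<open>Both sides of (R4) are conjugates by \<open>g\<close> of one element,
      \<open>x_12(a)\<close>, seen once as a value of \<open>T\<close> and once as a value of
      \<open>T'\<close>.\<close>
    have "T (act (phi g) (ucol 1)) (coact (phi g) (ucol 2) \<^bold>* a) = St.cj g (T (ucol 1) (ucol 2 \<^bold>* a))"
      using g a i by (subst cj_T) (auto simp: unit_elem_cols dot_simps dot_unit_unit coact_scale)
    also have "T (ucol 1) (ucol 2 \<^bold>* a) = T' (ucol 1 \<^bold>* a) (ucol 2)"
      using T_unit[OF i a] T'_unit[OF i a] by simp
    also have "St.cj g \<dots> = T' (act (phi g) (ucol 1) \<^bold>* a) (coact (phi g) (ucol 2))"
      using g a i by (subst cj_T') (auto simp: unit_elem_cols dot_simps dot_unit_unit act_scale)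
    finally show ?thesis by simp
  qed
  note lift = star_lift[where H = St and f = kappa_gen, OF St.group_axioms closed R1 R2 R3 R4, folded kappa_def]
  show "kappa \<in> hom Star St" by (rule lift(1))
  show "z \<in> star_gens n R I \<Longrightarrow> kappa (sgen z) = kappa_gen z" by (rule lift(2))
qed

sublocale Star: group Star
  by (simp add: star_Steinberg_def group_presented_group)

sublocale kappa: group_hom Star St kappa
  unfolding group_hom_def group_hom_axioms_def
  using kappa_hom Star.group_axioms St.group_axioms by blast

end

section \<open>The action on the second presentation\<close>

context steinberg_ideal
begin

definition mgen :: "'a matrix \<Rightarrow> 'a star_gen \<Rightarrow> 'a star_gen" where
  "mgen M z = (case z of F u v \<Rightarrow> F (act M u) (coact M v) | S u v \<Rightarrow> S (act M u) (coact M v))"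

lemma mgen_simps [simp]:
  "mgen M (F u v) = F (act M u) (coact M v)" "mgen M (S u v) = S (act M u) (coact M v)"
  by (simp_all add: mgen_def)

lemma sgen_closed [simp]: "z \<in> star_gens n R I \<Longrightarrow> sgen z \<in> carrier Star"
  by (simp add: sgen_def star_Steinberg_def gen_class_closed)

lemma elem_cols_act: "g \<in> carrier St \<Longrightarrow> u \<in> elem_cols n R \<Longrightarrow> act (phi g) u \<in> elem_cols n R"
  using std.orbit_A by (simp add: orbit_iff)

lemma elem_cols_coact: "g \<in> carrier St \<Longrightarrow> u \<in> elem_cols n R \<Longrightarrow> coact (phi g) u \<in> elem_cols n R"
  using dual.orbit_A by (simp add: orbit_iff)

lemma mgen_gens:
  assumes g: "g \<in> carrier St" and z: "z \<in> star_gens n R I"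
  shows "mgen (phi g) z \<in> star_gens n R I"
proof (cases z)
  case (F u v)
  have f: "F u v \<in> star_gens n R I" using z unfolding F .
  have "act (phi g) u \<in> elem_cols n R"
    using f unfolding F_gens by (blast intro: elem_cols_act[OF g])
  moreover have "coact (phi g) v \<in> columns n I"
    using f unfolding F_gens by (blast intro: coact_cols[OF ideal_I phi_simps(1)[OF g]])
  moreover have "dot (act (phi g) u) (coact (phi g) v) = \<zero>"
    using F_gensD[OF f] g by simp
  ultimately show ?thesis unfolding F mgen_simps F_gens by blast
next
  case (S u v)
  have f: "S u v \<in> star_gens n R I" using z unfolding S .
  have "coact (phi g) v \<in> elem_cols n R"
    using f unfolding S_gens by (blast intro: elem_cols_coact[OF g])
  moreover have "act (phi g) u \<in> columns n I"
    using f unfolding S_gens by (blast intro: act_cols[OF ideal_I GL_mats[OF phi_simps(1)[OF g]]])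
  moreover have "dot (act (phi g) u) (coact (phi g) v) = \<zero>"
    using S_gensD[OF f] g by simp
  ultimately show ?thesis unfolding S mgen_simps S_gens by blast
qed

lemma Star_rel:
  assumes "(v, w) \<in> star_rels n R I" "v \<in> words (star_gens n R I)" "w \<in> words (star_gens n R I)"
  shows "word_eval Star sgen v = word_eval Star sgen w"
  unfolding star_Steinberg_def sgen_def by (rule presented_group_rel[OF assms])

lemma star_rels_I:
  "F u v \<in> star_gens n R I \<Longrightarrow> F u w \<in> star_gens n R I \<Longrightarrow>
    ([pos (F u v), pos (F u w)], [pos (F u (v \<^bold>+ w))]) \<in> star_rels n R I"
  "S u v \<in> star_gens n R I \<Longrightarrow> S w v \<in> star_gens n R I \<Longrightarrow>
    ([pos (S u v), pos (S w v)], [pos (S (u \<^bold>+ w) v)]) \<in> star_rels n R I"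
  "F u v \<in> star_gens n R I \<Longrightarrow> F u' v' \<in> star_gens n R I \<Longrightarrow>
    ([pos (F u v), pos (F u' v'), neg (F u v)],
      [pos (F (act (transv n R u v) u') (act (inv\<^bsub>GLn\<^esub> (transv n R v u)) v'))]) \<in> star_rels n R I"
  "a \<in> I \<Longrightarrow> M \<in> elem_set n R \<Longrightarrow> u = act M (ucol 1) \<Longrightarrow> v = coact M (ucol 2) \<Longrightarrow>
    ([pos (F u (v \<^bold>* a))], [pos (S (u \<^bold>* a) v)]) \<in> star_rels n R I"
  unfolding star_rels_def coact_def
  subgoal by (rule UnI1, rule UnI1, rule UnI1) blast
  subgoal by (rule UnI1, rule UnI1, rule UnI2) blast
  subgoal by (rule UnI1, rule UnI2) blast
  subgoal by (rule UnI2) blast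
  done

lemma sgen_R1:
  assumes g: "F u v \<in> star_gens n R I" "F u w \<in> star_gens n R I"
  shows "sgen (F u v) \<otimes>\<^bsub>Star\<^esub> sgen (F u w) = sgen (F u (v \<^bold>+ w))" "F u (v \<^bold>+ w) \<in> star_gens n R I"
proof -
  show s: "F u (v \<^bold>+ w) \<in> star_gens n R I"
    using g F_gensD[OF g(1)] F_gensD[OF g(2)] by (simp add: F_gens add_cols[OF ideal_I] dot_simps)
  from Star_rel[OF star_rels_I(1)[OF g]] show "sgen (F u v) \<otimes>\<^bsub>Star\<^esub> sgen (F u w) = sgen (F u (v \<^bold>+ w))"
    using g s by (simp add: words_Cons words_Nil)
qed

lemma sgen_R2:
  assumes g: "S u v \<in> star_gens n R I" "S w v \<in> star_gens n R I"
  shows "sgen (S u v) \<otimes>\<^bsub>Star\<^esub> sgen (S w v) = sgen (S (u \<^bold>+ w) v)" "S (u \<^bold>+ w) v \<in> star_gens n R I"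
proof -
  show s: "S (u \<^bold>+ w) v \<in> star_gens n R I"
    using g S_gensD[OF g(1)] S_gensD[OF g(2)] by (simp add: S_gens add_cols[OF ideal_I] dot_simps)
  from Star_rel[OF star_rels_I(2)[OF g]] show "sgen (S u v) \<otimes>\<^bsub>Star\<^esub> sgen (S w v) = sgen (S (u \<^bold>+ w) v)"
    using g s by (simp add: words_Cons words_Nil)
qed

lemma sgen_R3:
  assumes g: "F u v \<in> star_gens n R I" "z \<in> star_gens n R I" and z: "z = F u' v'"
  shows "sgen (F u v) \<otimes>\<^bsub>Star\<^esub> sgen z = sgen (mgen (transv n R u v) z) \<otimes>\<^bsub>Star\<^esub> sgen (F u v)"
proof -
  have c: "u \<in> elem_cols n R" "u \<in> cols" "v \<in> cols" "dot u v = \<zero>" using F_gensD[OF g(1)] by blast+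
  then have d: "dot v u = \<zero>" using dot_commute[of u v] by simp
  have v': "v' \<in> cols" using F_gensD g z by blast
  have e: "act (inv\<^bsub>GLn\<^esub> (transv n R v u)) v' = coact (transv n R u v) v'"
    using c d v' by (simp add: coact_transv act_inv_transv)
  have m: "mgen (transv n R u v) z \<in> star_gens n R I"
    using mgen_gens[OF T_closed[OF c(1,3,4)] g(2)] c by (simp add: phi_T)
  have "([pos (F u v), pos (F u' v'), neg (F u v)],
      [pos (F (act (transv n R u v) u') (act (inv\<^bsub>GLn\<^esub> (transv n R v u)) v'))]) \<in> star_rels n R I"
    using g unfolding z by (rule star_rels_I(3))
  then have "([pos (F u v), pos z, neg (F u v)], [pos (mgen (transv n R u v) z)]) \<in> star_rels n R I"
    unfolding e z by simp
  from Star_rel[OF this]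
  have "sgen (F u v) \<otimes>\<^bsub>Star\<^esub> (sgen z \<otimes>\<^bsub>Star\<^esub> inv\<^bsub>Star\<^esub> sgen (F u v)) = sgen (mgen (transv n R u v) z)"
    using g m by (simp add: words_Cons words_Nil)
  then have "Star.cj (sgen (F u v)) (sgen z) = sgen (mgen (transv n R u v) z)"
    using g by (simp add: Star.cj_def Star.m_assoc)
  then show ?thesis using g m by (simp add: Star.cj_eq_iff)
qed

lemma sgen_R4:
  assumes g: "g \<in> carrier St" "act (phi g) (ucol 1) = u" "coact (phi g) (ucol 2) = v" and a: "a \<in> I"
  shows "sgen (F u (v \<^bold>* a)) = sgen (S (u \<^bold>* a) v)"
    "F u (v \<^bold>* a) \<in> star_gens n R I" "S (u \<^bold>* a) v \<in> star_gens n R I"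
proof -
  have i: "1 \<in> {1..n}" "2 \<in> {1..n}" using n4 by auto
  have u: "u \<in> elem_cols n R" "v \<in> elem_cols n R" "u \<in> cols" "v \<in> cols"
    using g elem_cols_act[OF g(1) unit_elem_cols[OF i(1)]] elem_cols_coact[OF g(1) unit_elem_cols[OF i(2)]]
      elem_cols_cols by auto
  have "dot v u = \<zero>"
    unfolding g(2,3)[symmetric] using g(1) i by (simp add: dot_unit_unit)
  then have "dot u v = \<zero>" using u dot_commute by simp
  then show s: "F u (v \<^bold>* a) \<in> star_gens n R I" "S (u \<^bold>* a) v \<in> star_gens n R I"
    using u a I_carrier[OF a] by (simp_all add: F_gens S_gens scale_cols'[OF ideal_I] dot_simps)
  have "phi g \<in> elem_set n R" unfolding elem_set_eq using g by blast
  then have "([pos (F u (v \<^bold>* a))], [pos (S (u \<^bold>* a) v)]) \<in> star_rels n R I"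
    using a g(2,3) by (intro star_rels_I(4)[of a "phi g"]) simp_all
  from Star_rel[OF this] show "sgen (F u (v \<^bold>* a)) = sgen (S (u \<^bold>* a) v)"
    using s by (simp add: words_Cons words_Nil)
qed

text \<open>The action goes through the matrix of \<open>g\<close>. The parameter is nevertheless
  \<open>g\<close> itself, since \<open>kappa_alpha\<close> compares the action with conjugation by
  \<open>g\<close> and the semidirect product is formed with the Steinberg group.\<close>

definition alpha :: "(nat \<times> nat \<times> 'a) word set \<Rightarrow> 'a star_gen word set \<Rightarrow> 'a star_gen word set" where
  "alpha g = presented_lift Star (\<lambda>z. sgen (mgen (phi g) z))"

text \<open>The relations are stable because conjugating t(u,v) by M gives the transvection on M u
  and the contragredient image of v; in (R4) the lift \<open>h\<close> is replaced by the product of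
  \<open>g\<close> and \<open>h\<close>.\<close>

lemma
  assumes g: "g \<in> carrier St"
  shows alpha_hom: "alpha g \<in> hom Star Star"
    and alpha_sgen: "z \<in> star_gens n R I \<Longrightarrow> alpha g (sgen z) = sgen (mgen (phi g) z)"
proof -
  let ?f = "\<lambda>z. sgen (mgen (phi g) z)"
  note M = mgen_gens[OF g]
  have closed: "?f z \<in> carrier Star" if "z \<in> star_gens n R I" for z
    using M[OF that] by simp
  have R1: "?f (F u v) \<otimes>\<^bsub>Star\<^esub> ?f (F u w) = ?f (F u (v \<^bold>+ w))"
    if "F u v \<in> star_gens n R I" "F u w \<in> star_gens n R I" for u v w
    using sgen_R1 M[OF that(1)] M[OF that(2)] F_gensD[OF that(1)] F_gensD[OF that(2)] g
    by (simp add: coact_add)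
  have R2: "?f (S u v) \<otimes>\<^bsub>Star\<^esub> ?f (S w v) = ?f (S (u \<^bold>+ w) v)"
    if "S u v \<in> star_gens n R I" "S w v \<in> star_gens n R I" for u v w
    using sgen_R2 M[OF that(1)] M[OF that(2)] S_gensD[OF that(1)] S_gensD[OF that(2)] g
    by (simp add: act_add)
  have R3: "?f (F u v) \<otimes>\<^bsub>Star\<^esub> ?f (F u' v')
      = ?f (F (act (transv n R u v) u') (coact (transv n R u v) v')) \<otimes>\<^bsub>Star\<^esub> ?f (F u v)"
    if z: "F u v \<in> star_gens n R I" "F u' v' \<in> star_gens n R I" for u v u' v'
  proof -
    have c: "u \<in> cols" "v \<in> cols" "u' \<in> cols" "v' \<in> cols" "dot u v = \<zero>"
      using F_gensD[OF z(1)] F_gensD[OF z(2)] by blast+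
    then have d: "dot v u = \<zero>" using dot_commute[of u v] by simp
    have "act (transv n R (act (phi g) u) (coact (phi g) v)) (act (phi g) u') = act (phi g) (act (transv n R u v) u')"
      using c d g by (simp add: act_transv act_add act_scale)
    moreover have "coact (transv n R (act (phi g) u) (coact (phi g) v)) (coact (phi g) v')
        = coact (phi g) (coact (transv n R u v) v')"
      using c d g by (simp add: coact_transv coact_add coact_scale)
    ultimately show ?thesis
      using sgen_R3[OF _ M[OF z(2)] mgen_simps(1)] M[OF z(1)] by simp
  qed
  have R4: "?f (F (act (phi h) (ucol 1)) (coact (phi h) (ucol 2) \<^bold>* a))
        = ?f (S (act (phi h) (ucol 1) \<^bold>* a) (coact (phi h) (ucol 2)))"
    if h: "h \<in> carrier St" and "a \<in> I" for h a
    using sgen_R4(1)[of "g \<otimes>\<^bsub>St\<^esub> h" _ _ a] that g I_carrier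
    by (simp add: act_mult coact_mult act_scale coact_scale)
  note lift = star_lift[where H = Star and f = ?f, OF Star.group_axioms closed R1 R2 R3 R4, folded alpha_def]
  show "alpha g \<in> hom Star Star" by (rule lift(1))
  show "z \<in> star_gens n R I \<Longrightarrow> alpha g (sgen z) = sgen (mgen (phi g) z)" by (rule lift(2))
qed

lemma alpha_closed [simp]: "g \<in> carrier St \<Longrightarrow> s \<in> carrier Star \<Longrightarrow> alpha g s \<in> carrier Star"
  using alpha_hom by (rule hom_in_carrier)

lemma alpha_mult [simp]:
  "g \<in> carrier St \<Longrightarrow> s \<in> carrier Star \<Longrightarrow> t \<in> carrier Star \<Longrightarrow>
    alpha g (s \<otimes>\<^bsub>Star\<^esub> t) = alpha g s \<otimes>\<^bsub>Star\<^esub> alpha g t"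
  using alpha_hom by (rule hom_mult)

lemma Star_hom_eqI:
  assumes h: "h \<in> hom Star H" and k: "k \<in> hom Star H" and H: "group H"
    and e: "\<And>z. z \<in> star_gens n R I \<Longrightarrow> h (sgen z) = k (sgen z)" and s: "s \<in> carrier Star"
  shows "h s = k s"
  using presented_group_hom_eqI[OF h[unfolded star_Steinberg_def] k[unfolded star_Steinberg_def] H]
    e s unfolding sgen_def star_Steinberg_def by blast

lemma alpha_alpha:
  assumes g: "g \<in> carrier St" and h: "h \<in> carrier St" and s: "s \<in> carrier Star"
  shows "alpha (g \<otimes>\<^bsub>St\<^esub> h) s = alpha g (alpha h s)"
proof -
  have "alpha (g \<otimes>\<^bsub>St\<^esub> h) s = (alpha g \<circ> alpha h) s"
  proof (rule Star_hom_eqI[OF alpha_hom _ Star.group_axioms _ s])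
    show "alpha g \<circ> alpha h \<in> hom Star Star"
      using hom_compose[OF alpha_hom[OF h] alpha_hom[OF g]] by simp
    fix z assume z: "z \<in> star_gens n R I"
    then have "mgen (phi (g \<otimes>\<^bsub>St\<^esub> h)) z = mgen (phi g) (mgen (phi h) z)"
      using g h by (cases z) (auto dest!: F_gensD S_gensD simp: act_mult coact_mult)
    then show "alpha (g \<otimes>\<^bsub>St\<^esub> h) (sgen z) = (alpha g \<circ> alpha h) (sgen z)"
      using g h z mgen_gens[OF h z] by (simp add: alpha_sgen)
  qed (use g h in simp)
  then show ?thesis by simp
qed

lemma alpha_one [simp]:
  assumes s: "s \<in> carrier Star"
  shows "alpha \<one>\<^bsub>St\<^esub> s = s"
proof -
  have "alpha \<one>\<^bsub>St\<^esub> s = id s"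
  proof (rule Star_hom_eqI[OF alpha_hom _ Star.group_axioms _ s])
    show "id \<in> hom Star Star" by (auto simp: hom_def)
    fix z assume z: "z \<in> star_gens n R I"
    then have "mgen (phi \<one>\<^bsub>St\<^esub>) z = z"
      by (cases z) (auto dest!: F_gensD S_gensD)
    then show "alpha \<one>\<^bsub>St\<^esub> (sgen z) = id (sgen z)"
      using z by (simp add: alpha_sgen)
  qed simp
  then show ?thesis by simp
qed

text \<open>Equivariance of \<open>kappa\<close>, read off on generators from \<open>cj_T\<close>
  and \<open>cj_T'\<close>. It is one of the two crossed-module identities; the other one is
  \<open>cj_eq_alpha\<close>.\<close>

lemma kappa_alpha:
  assumes g: "g \<in> carrier St" and s: "s \<in> carrier Star"
  shows "kappa (alpha g s) = St.cj g (kappa s)"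
proof -
  have "(kappa \<circ> alpha g) s = (St.cj g \<circ> kappa) s"
  proof (rule Star_hom_eqI[OF _ _ St.group_axioms _ s])
    show "kappa \<circ> alpha g \<in> hom Star St"
      using hom_compose[OF alpha_hom[OF g] kappa_hom] by simp
    have "St.cj g \<in> hom St St" using g by (auto simp: hom_def St.cj_mult)
    from hom_compose[OF kappa_hom this] show "St.cj g \<circ> kappa \<in> hom Star St" by simp
    fix z assume z: "z \<in> star_gens n R I"
    then have "kappa_gen (mgen (phi g) z) = St.cj g (kappa_gen z)"
      using g by (cases z) (auto dest!: F_gensD S_gensD simp: cj_T cj_T')
    then show "(kappa \<circ> alpha g) (sgen z) = (St.cj g \<circ> kappa) (sgen z)"
      using g z mgen_gens[OF g z] by (simp add: alpha_sgen kappa_sgen)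
  qed
  then show ?thesis by simp
qed

section \<open>Root elements of the second presentation and generation by them\<close>

definition X :: "nat \<Rightarrow> nat \<Rightarrow> 'a \<Rightarrow> 'a star_gen word set" where
  "X i j a = sgen (F (ucol i) (ucol j \<^bold>* a))"

text \<open>(R4) gives a root element two shapes. With the \<open>F\<close> shape a sum in the right
  column is split by (R1), with the \<open>S\<close> shape a sum in the left column is split by
  (R2).\<close>

lemma
  assumes i: "i \<in> {1..n}" "j \<in> {1..n}" "i \<noteq> j" and a: "a \<in> I"
  shows X_eq_S: "X i j a = sgen (S (ucol i \<^bold>* a) (ucol j))"
    and F_unit: "F (ucol i) (ucol j \<^bold>* a) \<in> star_gens n R I"
    and S_unit: "S (ucol i \<^bold>* a) (ucol j) \<in> star_gens n R I"
proof -
  obtain g where g: "g \<in> carrier St" "act (phi g) (ucol 1) = ucol i" "coact (phi g) (ucol 2) = ucol j"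
    using unit_pair[OF i] by blast
  show "X i j a = sgen (S (ucol i \<^bold>* a) (ucol j))"
    and "F (ucol i) (ucol j \<^bold>* a) \<in> star_gens n R I"
    and "S (ucol i \<^bold>* a) (ucol j) \<in> star_gens n R I"
    using sgen_R4[OF g a] by (simp_all add: X_def)
qed

lemma X_closed [simp]:
  "i \<in> {1..n} \<Longrightarrow> j \<in> {1..n} \<Longrightarrow> i \<noteq> j \<Longrightarrow> a \<in> I \<Longrightarrow> X i j a \<in> carrier Star"
  using sgen_closed[OF F_unit] by (simp add: X_def)

lemma kappa_X:
  "i \<in> {1..n} \<Longrightarrow> j \<in> {1..n} \<Longrightarrow> i \<noteq> j \<Longrightarrow> a \<in> I \<Longrightarrow> kappa (X i j a) = xg i j a"
  using F_unit[of i j a] T_unit[of i j a] by (simp add: X_def kappa_sgen I_carrier)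

lemma X_add:
  assumes i: "i \<in> {1..n}" "j \<in> {1..n}" "i \<noteq> j" and a: "a \<in> I" "b \<in> I"
  shows "X i j a \<otimes>\<^bsub>Star\<^esub> X i j b = X i j (a \<oplus> b)"
  using sgen_R1(1)[OF F_unit[OF i a(1)] F_unit[OF i a(2)]] a
  by (simp add: X_def scale_add I_carrier)

text \<open>Zero coordinates are skipped, so the step comes with
  \<open>u j \<noteq> \<zero>\<close>; for a column whose first entry is zero this excludes j = 1.
  The zero column is written as a scaled unit column to match the root elements with coefficient
  zero.\<close>

lemma column_sum_induct [consumes 1, case_names zero step]:
  assumes u: "u \<in> columns n I" and zero: "P (ucol 1 \<^bold>* \<zero>)"
    and step: "\<And>j w. j \<in> {1..n} \<Longrightarrow> u j \<noteq> \<zero> \<Longrightarrow> w \<in> columns n I \<Longrightarrow> (\<And>i. i \<in> {1..n} \<Longrightarrow> w i = \<zero> \<or> w i = u i) \<Longrightarrow>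
      P w \<Longrightarrow> P (ucol j \<^bold>* u j \<^bold>+ w)"
  shows "P u"
proof -
  define w where "w L = (\<lambda>i\<in>{1..n}. if i \<in> set L then u i else \<zero>)" for L
  have zI: "\<zero> \<in> I" by (rule additive_subgroup.zero_closed[OF ideal.axioms(1)[OF ideal_I]])
  have wI: "w L \<in> columns n I" for L
    unfolding w_def restrict_cols_iff using u zI by (simp add: colsD)
  have u': "u j \<in> carrier R" if "j \<in> {1..n}" for j
    using u that by (simp add: colsD I_carrier)
  have "P (w L)" if "distinct L" "set L \<subseteq> {1..n}" for L
    using that
  proof (induction L)
    case Nil
    have "w [] = ucol 1 \<^bold>* \<zero>"
      using I_cols[OF wI[of "[]"]]
      by (rule cols_eqI[where B = "carrier R"]) (auto simp: w_def column_at)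
    then show ?case using zero by simp
  next
    case (Cons j L)
    then have IH: "P (w L)" and j: "j \<in> {1..n}" "j \<notin> set L" by auto
    show ?case
    proof (cases "u j = \<zero>")
      case True
      then have "w (j # L) = w L" by (auto simp: w_def)
      then show ?thesis using IH by simp
    next
      case False
      have "w (j # L) = ucol j \<^bold>* u j \<^bold>+ w L"
        using I_cols[OF wI[of "j # L"]]
      proof (rule cols_eqI[where B = "carrier R"])
        show "ucol j \<^bold>* u j \<^bold>+ w L \<in> cols" using j u' I_cols[OF wI] by simp
        show "w (j # L) i = (ucol j \<^bold>* u j \<^bold>+ w L) i" if "i \<in> {1..n}" for i
          using that j u' by (auto simp: w_def column_at)
      qed
      then show ?thesis
        using step[OF j(1) False wI[of L] _ IH] by (simp add: w_def)
    qed
  qed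
  from this[of "indices n"] have "P (w (indices n))" by simp
  moreover have "w (indices n) = u"
    using wI u by (rule cols_eqI) (simp add: w_def)
  ultimately show ?thesis by simp
qed

text \<open>
  Moving \<open>u\<close> (respectively \<open>v\<close>) to the first basis vector reduces \<open>F u v\<close> and \<open>S u v\<close>
  to products of root elements.
\<close>

lemma star_generated:
  assumes D: "subgroup D Star"
    and XD: "\<And>i j a. i \<in> {1..n} \<Longrightarrow> j \<in> {1..n} \<Longrightarrow> i \<noteq> j \<Longrightarrow> a \<in> I \<Longrightarrow> X i j a \<in> D"
    and aD: "\<And>g s. g \<in> carrier St \<Longrightarrow> s \<in> D \<Longrightarrow> alpha g s \<in> D"
  shows "carrier Star \<subseteq> D"
proof -
  interpret D: subgroup D Star by (rule D)
  have zI: "\<zero> \<in> I" by (rule additive_subgroup.zero_closed[OF ideal.axioms(1)[OF ideal_I]])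
  have two: "1 \<in> {1..n}" "2 \<in> {1..n}" "(1::nat) \<noteq> 2" "(2::nat) \<noteq> 1" using n4 by auto
  have zero_eq: "ucol i \<^bold>* \<zero> = ucol j \<^bold>* \<zero>" for i j
    by (rule dot_eqI) (simp_all add: dot_simps)
  have F1: "F (ucol 1) v \<in> star_gens n R I \<and> sgen (F (ucol 1) v) \<in> D"
    if v: "v \<in> columns n I" "v 1 = \<zero>" for v
    using v(1)
  proof (induction rule: column_sum_induct)
    case zero
    then show ?case
      using F_unit[OF two(1-3) zI] XD[OF two(1-3) zI] unfolding X_def zero_eq[of 2 1] by blast
  next
    case (step j w)
    then have "j \<noteq> 1" using v by auto
    moreover have "v j \<in> I" using v step by (simp add: colsD)
    ultimately have "F (ucol 1) (ucol j \<^bold>* v j) \<in> star_gens n R I" "sgen (F (ucol 1) (ucol j \<^bold>* v j)) \<in> D"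
      using F_unit[of 1 j "v j"] XD[of 1 j "v j"] step two unfolding X_def by auto
    then show ?case
      using sgen_R1[of "ucol 1" "ucol j \<^bold>* v j" w] step D.m_closed by metis
  qed
  have S1: "S u (ucol 1) \<in> star_gens n R I \<and> sgen (S u (ucol 1)) \<in> D"
    if u: "u \<in> columns n I" "u 1 = \<zero>" for u
    using u(1)
  proof (induction rule: column_sum_induct)
    case zero
    then show ?case
      using S_unit[OF two(2,1,4) zI] XD[OF two(2,1,4) zI] X_eq_S[OF two(2,1,4) zI]
      unfolding zero_eq[of 2 1] by metis
  next
    case (step j w)
    then have "j \<noteq> 1" using u by auto
    moreover have "u j \<in> I" using u step by (simp add: colsD)
    ultimately have "S (ucol j \<^bold>* u j) (ucol 1) \<in> star_gens n R I" "sgen (S (ucol j \<^bold>* u j) (ucol 1)) \<in> D"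
      using S_unit[of j 1 "u j"] XD[of j 1 "u j"] X_eq_S[of j 1 "u j"] step two by auto
    then show ?case
      using sgen_R2[of "ucol j \<^bold>* u j" "ucol 1" w] step D.m_closed by metis
  qed
  have gens: "sgen z \<in> D" if z: "z \<in> star_gens n R I" for z
  proof (cases z)
    case (F u v)
    then have c: "u \<in> elem_cols n R" "v \<in> columns n I" "dot u v = \<zero>" "v \<in> cols"
      using z by (auto simp: F_gens I_cols)
    then obtain g where g: "g \<in> carrier St" "u = act (phi g) (ucol 1)"
      unfolding elem_cols_eq(1) std.orbit_def by blast
    let ?v = "coact (phi (inv\<^bsub>St\<^esub> g)) v"
    have v: "?v \<in> columns n I" "?v \<in> cols"
      using g c by (simp_all add: coact_cols[OF ideal_I])
    have "?v 1 = dot ?v (ucol 1)" using v dot_unit[of ?v 1] two by simp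
    also have "\<dots> = dot v u" using std.dot_B(2)[of g "ucol 1" v] g c by simp
    also have "\<dots> = \<zero>" using c g dot_commute[of u v] by simp
    finally have "F (ucol 1) ?v \<in> star_gens n R I \<and> sgen (F (ucol 1) ?v) \<in> D" using F1 v by blast
    moreover from this have "alpha g (sgen (F (ucol 1) ?v)) = sgen z"
      using g c std.B_inv(2)[of g v] by (simp add: alpha_sgen F del: std.B_inv)
    ultimately show ?thesis using aD[OF g(1)] by metis
  next
    case (S u v)
    then have c: "v \<in> elem_cols n R" "u \<in> columns n I" "dot u v = \<zero>" "u \<in> cols"
      using z by (auto simp: S_gens I_cols)
    then obtain g where g: "g \<in> carrier St" "v = coact (phi g) (ucol 1)"
      unfolding elem_cols_eq(2) dual.orbit_def by blast
    let ?u = "act (phi (inv\<^bsub>St\<^esub> g)) u"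
    have u: "?u \<in> columns n I" "?u \<in> cols"
      using g c by (simp_all add: act_cols[OF ideal_I])
    have "?u 1 = dot ?u (ucol 1)" using u dot_unit[of ?u 1] two by simp
    also have "\<dots> = dot u v" using dual.dot_B(2)[of g "ucol 1" u] g c by simp
    finally have "S ?u (ucol 1) \<in> star_gens n R I \<and> sgen (S ?u (ucol 1)) \<in> D" using S1 u c by simp
    moreover from this have "alpha g (sgen (S ?u (ucol 1))) = sgen z"
      using g c dual.B_inv(2)[of g u] by (simp add: alpha_sgen S del: dual.B_inv)
    ultimately show ?thesis using aD[OF g(1)] by metis
  qed
  show ?thesis
  proof
    fix s assume "s \<in> carrier Star"
    then show "s \<in> D"
      unfolding star_Steinberg_def
    proof (induction rule: presented_group_induct)
      case one
      then show ?case using D.one_closed by (simp add: star_Steinberg_def)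
    next
      case (gen z s)
      then show ?case using gens D.m_closed by (simp add: star_Steinberg_def sgen_def)
    next
      case (inv_gen z s)
      then show ?case using gens D.m_closed D.m_inv_closed by (simp add: star_Steinberg_def sgen_def)
    qed
  qed
qed

end

section \<open>Semidirect products\<close>

definition semidirect ::
    "('a, 'c) monoid_scheme \<Rightarrow> ('b, 'd) monoid_scheme \<Rightarrow> ('b \<Rightarrow> 'a \<Rightarrow> 'a) \<Rightarrow> ('a \<times> 'b) monoid" where
  "semidirect N H a =
     \<lparr>carrier = carrier N \<times> carrier H,
      mult = (\<lambda>(s, g) (t, h). (s \<otimes>\<^bsub>N\<^esub> a g t, g \<otimes>\<^bsub>H\<^esub> h)),
      one = (\<one>\<^bsub>N\<^esub>, \<one>\<^bsub>H\<^esub>)\<rparr>"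

lemma semidirect_simps [simp]:
  "carrier (semidirect N H a) = carrier N \<times> carrier H"
  "(s, g) \<otimes>\<^bsub>semidirect N H a\<^esub> (t, h) = (s \<otimes>\<^bsub>N\<^esub> a g t, g \<otimes>\<^bsub>H\<^esub> h)"
  "\<one>\<^bsub>semidirect N H a\<^esub> = (\<one>\<^bsub>N\<^esub>, \<one>\<^bsub>H\<^esub>)"
  by (simp_all add: semidirect_def)

lemma group_semidirect:
  assumes N: "group N" and H: "group H"
    and hom: "\<And>g. g \<in> carrier H \<Longrightarrow> a g \<in> hom N N"
    and mult: "\<And>g h s. g \<in> carrier H \<Longrightarrow> h \<in> carrier H \<Longrightarrow> s \<in> carrier N \<Longrightarrow> a (g \<otimes>\<^bsub>H\<^esub> h) s = a g (a h s)"
    and one: "\<And>s. s \<in> carrier N \<Longrightarrow> a \<one>\<^bsub>H\<^esub> s = s"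
  shows "group (semidirect N H a)"
proof -
  interpret N: group N by (rule N)
  interpret H: group H by (rule H)
  have closed [simp]: "a g s \<in> carrier N" if "g \<in> carrier H" "s \<in> carrier N" for g s
    using hom_in_carrier[OF hom] that by blast
  have hmult [simp]: "a g (s \<otimes>\<^bsub>N\<^esub> t) = a g s \<otimes>\<^bsub>N\<^esub> a g t"
    if "g \<in> carrier H" "s \<in> carrier N" "t \<in> carrier N" for g s t
    using hom_mult[OF hom] that by blast
  show ?thesis
  proof (rule groupI)
    fix x assume "x \<in> carrier (semidirect N H a)"
    then obtain s g where x: "x = (s, g)" "s \<in> carrier N" "g \<in> carrier H" by auto
    have "a (inv\<^bsub>H\<^esub> g) (inv\<^bsub>N\<^esub> s) \<otimes>\<^bsub>N\<^esub> a (inv\<^bsub>H\<^esub> g) s = a (inv\<^bsub>H\<^esub> g) \<one>\<^bsub>N\<^esub>"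
      using x by (simp flip: hmult)
    also have "\<dots> = \<one>\<^bsub>N\<^esub>" using x hom_one[OF hom N N] by simp
    finally have "(a (inv\<^bsub>H\<^esub> g) (inv\<^bsub>N\<^esub> s), inv\<^bsub>H\<^esub> g) \<otimes>\<^bsub>semidirect N H a\<^esub> x = \<one>\<^bsub>semidirect N H a\<^esub>"
      using x by simp
    then show "\<exists>y\<in>carrier (semidirect N H a). y \<otimes>\<^bsub>semidirect N H a\<^esub> x = \<one>\<^bsub>semidirect N H a\<^esub>"
      using x by (intro bexI[of _ "(a (inv\<^bsub>H\<^esub> g) (inv\<^bsub>N\<^esub> s), inv\<^bsub>H\<^esub> g)"]) simp_all
  qed (auto simp: mult one N.m_assoc H.m_assoc)
qed

lemma group_hom_eq_on_generate:
  assumes h: "h \<in> hom G H" and k: "k \<in> hom G H" and G: "group G" and H: "group H"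
    and A: "A \<subseteq> carrier G" and e: "\<And>y. y \<in> A \<Longrightarrow> h y = k y" and x: "x \<in> generate G A"
  shows "h x = k x"
proof -
  interpret h: group_hom G H h using h G H by (simp add: group_hom_def group_hom_axioms_def)
  interpret k: group_hom G H k using k G H by (simp add: group_hom_def group_hom_axioms_def)
  note c = h.G.generate_in_carrier[OF A]
  show ?thesis
    using x
  proof (induction rule: generate.induct)
    case (inv y)
    then show ?case using e A by (auto simp: h.hom_inv k.hom_inv)
  next
    case (eng y z)
    then show ?case using c by simp
  qed (use e in auto)
qed

context steinberg_ideal
begin

definition Fset :: "'a star_gen word set set" where
  "Fset = {sgen (F u v) | u v. F u v \<in> star_gens n R I}"

lemma Fset_closed: "Fset \<subseteq> carrier Star"
  by (auto simp: Fset_def)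

lemma alpha_group_hom: "g \<in> carrier St \<Longrightarrow> group_hom Star Star (alpha g)"
  unfolding group_hom_def group_hom_axioms_def using Star.group_axioms alpha_hom by blast

text \<open>Root elements have the shape \<open>F\<close>, and \<open>alpha\<close> maps
  \<open>Fset\<close> into itself, so \<open>star_generated\<close> applies; the generators
  \<open>S\<close> are thereby expressed through \<open>Fset\<close>.\<close>

lemma Fset_generates: "carrier Star \<subseteq> generate Star Fset"
proof (rule star_generated)
  show "subgroup (generate Star Fset) Star"
    by (rule Star.generate_is_subgroup[OF Fset_closed])
  show "X i j a \<in> generate Star Fset" if "i \<in> {1..n}" "j \<in> {1..n}" "i \<noteq> j" "a \<in> I" for i j a
    unfolding X_def using F_unit[OF that] by (intro generate.incl) (auto simp: Fset_def)
  fix g s assume g: "g \<in> carrier St" and s: "s \<in> generate Star Fset"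
  interpret a: group_hom Star Star "alpha g" by (rule alpha_group_hom[OF g])
  have F: "alpha g y \<in> Fset" if yF: "y \<in> Fset" for y
  proof -
    obtain u v where y: "y = sgen (F u v)" "F u v \<in> star_gens n R I"
      using yF unfolding Fset_def by blast
    then have "alpha g y = sgen (F (act (phi g) u) (coact (phi g) v))"
      "F (act (phi g) u) (coact (phi g) v) \<in> star_gens n R I"
      using alpha_sgen[OF g y(2)] mgen_gens[OF g y(2)] by simp_all
    then show ?thesis unfolding Fset_def by blast
  qed
  show "alpha g s \<in> generate Star Fset"
    using s
  proof (induction rule: generate.induct)
    case one
    then show ?case using generate.one by simp
  next
    case (incl y)
    then show ?case using F by (intro generate.incl)
  next
    case (inv y)
    then show ?case using F[of y] Fset_closed generate.inv[of "alpha g y" Fset Star] by auto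
  next
    case (eng y z)
    then show ?case using Star.generate_in_carrier[OF Fset_closed] generate.eng by (metis a.hom_mult)
  qed
qed

text \<open>Relation (R3) covers only \<open>F\<close>; the elements \<open>F u v\<close> generate the whole group.\<close>

lemma cj_eq_alpha:
  assumes s: "s \<in> carrier Star" and t: "t \<in> carrier Star"
  shows "Star.cj s t = alpha (kappa s) t"
proof -
  have F: "Star.cj s t = alpha (kappa s) t" if s: "s \<in> Fset" and t: "t \<in> carrier Star" for s t
  proof (rule group_hom_eq_on_generate[where h = "Star.cj s" and k = "alpha (kappa s)", OF _ _ Star.group_axioms Star.group_axioms Fset_closed])
    have sc: "s \<in> carrier Star" using s Fset_closed by blast
    show "Star.cj s \<in> hom Star Star" using sc by (auto simp: hom_def Star.cj_mult)
    show "alpha (kappa s) \<in> hom Star Star" using sc by (intro alpha_hom) simp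
    show "t \<in> generate Star Fset" using t Fset_generates by blast
    fix y assume "y \<in> Fset"
    then obtain u' v' where y: "y = sgen (F u' v')" "F u' v' \<in> star_gens n R I"
      unfolding Fset_def by blast
    obtain u v where z: "s = sgen (F u v)" "F u v \<in> star_gens n R I"
      using s unfolding Fset_def by blast
    have c: "u \<in> elem_cols n R" "v \<in> cols" "dot u v = \<zero>" using F_gensD[OF z(2)] by blast+
    have k: "kappa s = T u v" "T u v \<in> carrier St"
      using c z by (simp_all add: kappa_sgen)
    have "alpha (kappa s) y = sgen (mgen (transv n R u v) (F u' v'))"
      "mgen (transv n R u v) (F u' v') \<in> star_gens n R I"
      using alpha_sgen[OF k(2) y(2)] mgen_gens[OF k(2) y(2)] c by (simp_all add: k y(1) phi_T)
    then show "Star.cj s y = alpha (kappa s) y"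
      using sgen_R3[OF z(2) y(2) HOL.refl] z y by (simp add: Star.cj_eq_iff)
  qed
  have "s \<in> generate Star Fset" using s Fset_generates by blast
  then have "\<forall>t\<in>carrier Star. Star.cj s t = alpha (kappa s) t"
  proof (induction rule: generate.induct)
    case one
    then show ?case by simp
  next
    case (incl y)
    then show ?case using F by blast
  next
    case (inv y)
    then have y: "y \<in> carrier Star" using Fset_closed by blast
    show ?case
    proof
      fix t assume t: "t \<in> carrier Star"
      \<comment> \<open>The identity for \<open>y\<close> is applied to the preimage of
        \<open>t\<close>; conjugating back by the inverse of \<open>y\<close> then gives the
        identity for that inverse.\<close>
      have "Star.cj y (alpha (inv\<^bsub>St\<^esub> kappa y) t) = t"
        using F[OF inv, of "alpha (inv\<^bsub>St\<^esub> kappa y) t"] y t by (simp flip: alpha_alpha)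
      then have "Star.cj (inv\<^bsub>Star\<^esub> y) t = Star.cj (inv\<^bsub>Star\<^esub> y) (Star.cj y (alpha (inv\<^bsub>St\<^esub> kappa y) t))"
        by simp
      also have "\<dots> = alpha (inv\<^bsub>St\<^esub> kappa y) t"
        using y t by (simp add: Star.cj_cj)
      finally show "Star.cj (inv\<^bsub>Star\<^esub> y) t = alpha (kappa (inv\<^bsub>Star\<^esub> y)) t"
        using y by simp
    qed
  next
    case (eng y z)
    have c: "y \<in> carrier Star" "z \<in> carrier Star"
      using eng.hyps Star.generate_in_carrier[OF Fset_closed] by auto
    show ?case
    proof
      fix t assume t: "t \<in> carrier Star"
      have "Star.cj (y \<otimes>\<^bsub>Star\<^esub> z) t = Star.cj y (Star.cj z t)"
        using c t by (simp add: Star.cj_cj)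
      also have "\<dots> = alpha (kappa y) (alpha (kappa z) t)"
        using eng.IH c t by simp
      finally show "Star.cj (y \<otimes>\<^bsub>Star\<^esub> z) t = alpha (kappa (y \<otimes>\<^bsub>Star\<^esub> z)) t"
        using c t by (simp add: alpha_alpha)
    qed
  qed
  then show ?thesis using t by blast
qed

section \<open>The action on root elements\<close>

lemma alpha_X_fix:
  assumes "(i, j, b) \<in> St_gens n R" "h \<in> {1..n}" "k \<in> {1..n}" "h \<noteq> k" "a \<in> I" "h \<noteq> j" "k \<noteq> i"
  shows "alpha (xg i j b) (X h k a) = X h k a"
proof -
  have g: "i \<in> {1..n}" "j \<in> {1..n}" "i \<noteq> j" "b \<in> carrier R" using assms by (auto simp: gens_iff)
  have "act (phi (xg i j b)) (ucol h) = ucol h"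
    unfolding act_phi_xg[OF g unit_cols]
    by (rule cols_eqI[where A = "carrier R" and B = "carrier R"])
      (use g assms in \<open>auto simp: column_at\<close>)
  moreover have "coact (phi (xg i j b)) (ucol k) = ucol k"
    unfolding coact_phi_xg[OF g unit_cols]
    by (rule cols_eqI[where A = "carrier R" and B = "carrier R"])
      (use g assms in \<open>auto simp: column_at\<close>)
  ultimately show ?thesis
    unfolding X_def using assms F_unit[of h k a]
    by (simp add: alpha_sgen coact_scale I_carrier)
qed

text \<open>The \<open>S\<close> shape of the root element is chosen because \<open>act\<close>
  changes the left index; (R2) then splits the resulting sum of columns.\<close>

lemma alpha_X_left:
  assumes g: "(i, j, b) \<in> St_gens n R" and k: "k \<in> {1..n}" "k \<noteq> j" "k \<noteq> i" and a: "a \<in> I"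
  shows "alpha (xg i j b) (X j k a) = X j k a \<otimes>\<^bsub>Star\<^esub> X i k (b \<otimes> a)"
proof -
  have g: "i \<in> {1..n}" "j \<in> {1..n}" "i \<noteq> j" "b \<in> carrier R" using assms by (auto simp: gens_iff)
  have aR: "a \<in> carrier R" using a by (rule I_carrier)
  have ba: "b \<otimes> a \<in> I" by (rule ideal.I_l_closed[OF ideal_I a g(4)])
  have c: "ucol j \<^bold>* a \<in> cols" using aR by simp
  have e1: "act (phi (xg i j b)) (ucol j \<^bold>* a) = ucol j \<^bold>* a \<^bold>+ ucol i \<^bold>* (b \<otimes> a)"
    unfolding act_phi_xg[OF g c]
    by (rule cols_eqI[where A = "carrier R" and B = "carrier R"])
      (use g aR in \<open>auto simp: column_at\<close>)
  have e2: "coact (phi (xg i j b)) (ucol k) = ucol k"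
    unfolding coact_phi_xg[OF g unit_cols]
    by (rule cols_eqI[where A = "carrier R" and B = "carrier R"])
      (use g k in \<open>auto simp: column_at\<close>)
  have "alpha (xg i j b) (X j k a) = sgen (S (ucol j \<^bold>* a \<^bold>+ ucol i \<^bold>* (b \<otimes> a)) (ucol k))"
    using g k a S_unit[of j k a] by (simp add: X_eq_S alpha_sgen e1 e2)
  also have "\<dots> = sgen (S (ucol j \<^bold>* a) (ucol k)) \<otimes>\<^bsub>Star\<^esub> sgen (S (ucol i \<^bold>* (b \<otimes> a)) (ucol k))"
    using g k a ba by (intro sgen_R2(1)[symmetric] S_unit) auto
  finally show ?thesis using g k a ba by (simp add: X_eq_S)
qed

text \<open>Here \<open>coact\<close> changes the right index, so the \<open>F\<close> shape and
  (R1) are used; the sign is that of the contragredient action.\<close>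

lemma alpha_X_right:
  assumes g: "(j, k, b) \<in> St_gens n R" and i: "i \<in> {1..n}" "i \<noteq> j" "i \<noteq> k" and a: "a \<in> I"
  shows "alpha (xg j k b) (X i j a) = X i j a \<otimes>\<^bsub>Star\<^esub> X i k (\<ominus> (a \<otimes> b))"
proof -
  have g: "j \<in> {1..n}" "k \<in> {1..n}" "j \<noteq> k" "b \<in> carrier R" using assms by (auto simp: gens_iff)
  have aR: "a \<in> carrier R" using a by (rule I_carrier)
  have "a \<otimes> b \<in> I" using a g(4) by (rule ideal.I_r_closed[OF ideal_I])
  then have ba: "\<ominus> (a \<otimes> b) \<in> I" by (rule additive_subgroup.a_inv_closed[OF ideal.axioms(1)[OF ideal_I]])
  have c: "ucol j \<^bold>* a \<in> cols" using aR by simp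
  have e1: "coact (phi (xg j k b)) (ucol j \<^bold>* a) = ucol j \<^bold>* a \<^bold>+ ucol k \<^bold>* (\<ominus> (a \<otimes> b))"
    unfolding coact_phi_xg[OF g c]
    by (rule cols_eqI[where A = "carrier R" and B = "carrier R"])
      (use g aR in \<open>auto simp: column_at l_minus r_minus m_comm\<close>)
  have e2: "act (phi (xg j k b)) (ucol i) = ucol i"
    unfolding act_phi_xg[OF g unit_cols]
    by (rule cols_eqI[where A = "carrier R" and B = "carrier R"])
      (use g i in \<open>auto simp: column_at\<close>)
  have "alpha (xg j k b) (X i j a) = sgen (F (ucol i) (ucol j \<^bold>* a \<^bold>+ ucol k \<^bold>* (\<ominus> (a \<otimes> b))))"
    using g i a F_unit[of i j a] by (simp add: X_def alpha_sgen e1 e2)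
  also have "\<dots> = X i j a \<otimes>\<^bsub>Star\<^esub> X i k (\<ominus> (a \<otimes> b))"
    unfolding X_def using g i a ba by (intro sgen_R1(1)[symmetric] F_unit) auto
  finally show ?thesis .
qed

end

section \<open>Splitting ideals\<close>

text \<open>The quotient ring is eliminated in favour of the composite of projection and section: an
  endomorphism of R that kills I and agrees with the identity modulo I, hence is idempotent.\<close>

locale steinberg_splitting = steinberg_ideal R n I for R (structure) and n and I +
  fixes rho :: "'a \<Rightarrow> 'a"
  assumes rho_hom: "rho \<in> ring_hom R R"
    and rho_diff: "r \<in> carrier R \<Longrightarrow> r \<oplus> \<ominus> rho r \<in> I"
    and rho_zero: "a \<in> I \<Longrightarrow> rho a = \<zero>"
begin

lemma rho_simps [simp]:
  "r \<in> carrier R \<Longrightarrow> rho r \<in> carrier R"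
  "r \<in> carrier R \<Longrightarrow> s \<in> carrier R \<Longrightarrow> rho (r \<oplus> s) = rho r \<oplus> rho s"
  "r \<in> carrier R \<Longrightarrow> s \<in> carrier R \<Longrightarrow> rho (r \<otimes> s) = rho r \<otimes> rho s"
  using rho_hom by (simp_all add: ring_hom_closed ring_hom_add ring_hom_mult)

section \<open>Decomposition of ring elements along the splitting\<close>

definition delta :: "'a \<Rightarrow> 'a" where
  "delta r = r \<oplus> \<ominus> rho r"

lemma delta_I [simp]: "r \<in> carrier R \<Longrightarrow> delta r \<in> I"
  by (simp add: delta_def rho_diff)

lemma delta_rho: "r \<in> carrier R \<Longrightarrow> delta r \<oplus> rho r = r"
  by (simp add: delta_def a_assoc l_neg)

lemma delta_I_eq: "a \<in> I \<Longrightarrow> delta a = a"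
  by (simp add: delta_def rho_zero I_carrier)

lemma delta_unique:
  assumes "r \<in> carrier R" "c \<in> carrier R" "r = c \<oplus> rho r"
  shows "delta r = c"
proof -
  have "delta r = (c \<oplus> rho r) \<oplus> \<ominus> rho r"
    unfolding delta_def using assms(3) by simp
  then show ?thesis using assms(1,2) by (simp add: a_assoc r_neg)
qed

lemma delta_add:
  assumes "r \<in> carrier R" "s \<in> carrier R"
  shows "delta (r \<oplus> s) = delta r \<oplus> delta s"
proof (rule delta_unique)
  have c: "delta r \<in> carrier R" "delta s \<in> carrier R" using assms I_carrier by simp_all
  then show "delta r \<oplus> delta s \<in> carrier R" by simp
  have "r \<oplus> s = (delta r \<oplus> rho r) \<oplus> (delta s \<oplus> rho s)" using assms by (simp add: delta_rho)
  also have "\<dots> = delta r \<oplus> delta s \<oplus> (rho r \<oplus> rho s)" using assms c by (simp add: a_ac)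
  also have "rho r \<oplus> rho s = rho (r \<oplus> s)" using assms by simp
  finally show "r \<oplus> s = delta r \<oplus> delta s \<oplus> rho (r \<oplus> s)" .
qed (use assms in simp)

text \<open>The three terms have three sources in the semidirect product: a commutator of root
  elements of \<open>Star\<close>, the action of a root element on a left index, and the action on a
  right index.\<close>

lemma delta_mult:
  assumes "r \<in> carrier R" "s \<in> carrier R"
  shows "delta (r \<otimes> s) = delta r \<otimes> delta s \<oplus> rho r \<otimes> delta s \<oplus> delta r \<otimes> rho s"
proof (rule delta_unique)
  have c: "delta r \<in> carrier R" "delta s \<in> carrier R" using assms I_carrier by simp_all
  then show "delta r \<otimes> delta s \<oplus> rho r \<otimes> delta s \<oplus> delta r \<otimes> rho s \<in> carrier R"
    using assms by simp
  have "r \<otimes> s = (delta r \<oplus> rho r) \<otimes> (delta s \<oplus> rho s)" using assms by (simp add: delta_rho)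
  also have "\<dots> = delta r \<otimes> delta s \<oplus> rho r \<otimes> delta s \<oplus> delta r \<otimes> rho s \<oplus> rho r \<otimes> rho s"
    using assms c by (simp add: l_distr r_distr a_ac)
  also have "rho r \<otimes> rho s = rho (r \<otimes> s)" using assms by simp
  finally show "r \<otimes> s = delta r \<otimes> delta s \<oplus> rho r \<otimes> delta s \<oplus> delta r \<otimes> rho s \<oplus> rho (r \<otimes> s)" .
qed (use assms in simp)

section \<open>The embedding of the Steinberg group into the semidirect product\<close>

abbreviation Gam where "Gam \<equiv> semidirect Star St alpha"

sublocale Gam: group Gam
  by (rule group_semidirect) (simp_all add: Star.group_axioms St.group_axioms alpha_hom alpha_alpha)

text \<open>The endomorphism induced by \<open>rho\<close>. It is later recognised as St(n,R) ->
  St(n,R/I) -> St(n,R), the second map coming from the section, and so detects the relative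
  Steinberg group.\<close>

definition psi :: "(nat \<times> nat \<times> 'a) word set \<Rightarrow> (nat \<times> nat \<times> 'a) word set" where
  "psi = presented_lift St (\<lambda>(i, j, r). xg i j (rho r))"

lemma
  shows psi_hom: "psi \<in> hom St St"
    and psi_xg: "(i, j, r) \<in> St_gens n R \<Longrightarrow> psi (xg i j r) = xg i j (rho r)"
proof -
  have 1: "xg i j (rho (r \<oplus> s)) = xg i j (rho r) \<otimes>\<^bsub>St\<^esub> xg i j (rho s)"
    if "(i, j, r) \<in> St_gens n R" "s \<in> carrier R" for i j r s
    using that by (simp add: gens_iff xg_add)
  have 2: "xg i j (rho r) \<otimes>\<^bsub>St\<^esub> xg h k (rho s) = xg h k (rho s) \<otimes>\<^bsub>St\<^esub> xg i j (rho r)"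
    if "(i, j, r) \<in> St_gens n R" "(h, k, s) \<in> St_gens n R" "h \<noteq> j" "k \<noteq> i" for i j r h k s
    using that by (simp add: xg_commute)
  have 3: "xg i j (rho r) \<otimes>\<^bsub>St\<^esub> xg j k (rho s)
      = xg i k (rho (r \<otimes> s)) \<otimes>\<^bsub>St\<^esub> (xg j k (rho s) \<otimes>\<^bsub>St\<^esub> xg i j (rho r))"
    if "(i, j, r) \<in> St_gens n R" "(j, k, s) \<in> St_gens n R" "i \<noteq> k" for i j r k s
  proof -
    have "xg i j (rho r) \<otimes>\<^bsub>St\<^esub> xg j k (rho s)
      = xg i k (rho r \<otimes> rho s) \<otimes>\<^bsub>St\<^esub> (xg j k (rho s) \<otimes>\<^bsub>St\<^esub> xg i j (rho r))"
      by (rule xg_trans) (use that in \<open>auto simp: gens_iff\<close>)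
    then show ?thesis using that by (simp add: gens_iff)
  qed
  note lift = steinberg_lift[where H = St and y = "\<lambda>i j r. xg i j (rho r)",
      OF St.group_axioms xg_closed 1 2 3, folded psi_def]
  show "psi \<in> hom St St" by (rule lift(1))
  show "(i, j, r) \<in> St_gens n R \<Longrightarrow> psi (xg i j r) = xg i j (rho r)" by (rule lift(2))
qed

definition split :: "(nat \<times> nat \<times> 'a) word set \<Rightarrow> 'a star_gen word set \<times> (nat \<times> nat \<times> 'a) word set" where
  "split = presented_lift Gam (\<lambda>(i, j, r). (X i j (delta r), xg i j (rho r)))"

lemma X_conj:
  assumes "i \<in> {1..n}" "j \<in> {1..n}" "i \<noteq> j" "a \<in> I" and t: "t \<in> carrier Star"
  shows "X i j a \<otimes>\<^bsub>Star\<^esub> t = alpha (xg i j a) t \<otimes>\<^bsub>Star\<^esub> X i j a"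
  using cj_eq_alpha[of "X i j a" t] assms by (simp add: kappa_X Star.cj_eq_iff)

lemma X_commute:
  assumes "i \<in> {1..n}" "j \<in> {1..n}" "i \<noteq> j" "a \<in> I"
    and "h \<in> {1..n}" "k \<in> {1..n}" "h \<noteq> k" "b \<in> I" and "h \<noteq> j" "k \<noteq> i"
  shows "X i j a \<otimes>\<^bsub>Star\<^esub> X h k b = X h k b \<otimes>\<^bsub>Star\<^esub> X i j a"
  using X_conj[of i j a "X h k b"] alpha_X_fix[of i j a h k b] assms by (simp add: gens_iff I_carrier)

text \<open>Additivity and commutation hold because the actions involved fix the root elements. In
  the third relation the first components are compared after all factors with indices (i, k), which
  commute with the other two root elements, have been collected on the left.\<close>

lemma
  shows split_hom: "split \<in> hom St Gam"
    and split_xg: "(i, j, r) \<in> St_gens n R \<Longrightarrow> split (xg i j r) = (X i j (delta r), xg i j (rho r))"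
proof -
  let ?y = "\<lambda>i j r. (X i j (delta r), xg i j (rho r))"
  have 0: "?y i j r \<in> carrier Gam" if "(i, j, r) \<in> St_gens n R" for i j r
    using that by (simp add: gens_iff)
  have rg: "(i, j, rho r) \<in> St_gens n R" if "(i, j, r) \<in> St_gens n R" for i j r
    using that by (simp add: gens_iff)
  have 1: "?y i j (r \<oplus> s) = ?y i j r \<otimes>\<^bsub>Gam\<^esub> ?y i j s"
    if g: "(i, j, r) \<in> St_gens n R" "s \<in> carrier R" for i j r s
    using g alpha_X_fix[OF rg[OF g(1)], of i j "delta s"] by (simp add: gens_iff xg_add delta_add X_add)
  have 2: "?y i j r \<otimes>\<^bsub>Gam\<^esub> ?y h k s = ?y h k s \<otimes>\<^bsub>Gam\<^esub> ?y i j r"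
    if g: "(i, j, r) \<in> St_gens n R" "(h, k, s) \<in> St_gens n R" "h \<noteq> j" "k \<noteq> i" for i j r h k s
    using g alpha_X_fix[OF rg[OF g(1)], of h k "delta s"] alpha_X_fix[OF rg[OF g(2)], of i j "delta r"]
    by (simp add: gens_iff xg_commute X_commute)
  have 3: "?y i j r \<otimes>\<^bsub>Gam\<^esub> ?y j k s = ?y i k (r \<otimes> s) \<otimes>\<^bsub>Gam\<^esub> (?y j k s \<otimes>\<^bsub>Gam\<^esub> ?y i j r)"
    if g: "(i, j, r) \<in> St_gens n R" "(j, k, s) \<in> St_gens n R" "i \<noteq> k" for i j r k s
  proof -
    have i: "i \<in> {1..n}" "j \<in> {1..n}" "k \<in> {1..n}" "i \<noteq> j" "j \<noteq> k" "k \<noteq> j" "j \<noteq> i" "k \<noteq> i" "r \<in> carrier R" "s \<in> carrier R"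
      using g by (auto simp: gens_iff)
    \<comment> \<open>So r = a + b and s = a' + b', with a, a' in I and b, b' in the image of
      \<open>rho\<close>.\<close>
    define a b a' b' where d: "a = delta r" "b = rho r" "a' = delta s" "b' = rho s"
    have aI: "a \<in> I" "a' \<in> I" and bR: "b \<in> carrier R" "b' \<in> carrier R" using i by (simp_all add: d)
    have aR: "a \<in> carrier R" "a' \<in> carrier R" using aI I_carrier by simp_all
    have I1: "b \<otimes> a' \<in> I" "a \<otimes> a' \<in> I" "a \<otimes> b' \<in> I"
      using aI bR aR by (simp_all add: ideal.I_l_closed[OF ideal_I] ideal.I_r_closed[OF ideal_I])
    have I2: "\<ominus> (a \<otimes> b') \<in> I"
      using I1(3) by (rule additive_subgroup.a_inv_closed[OF ideal.axioms(1)[OF ideal_I]])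
    let ?P = "X j k a'" and ?Q = "X i j a"
    have c: "?P \<in> carrier Star" "?Q \<in> carrier Star" using i aI by simp_all
    have Xik: "X i k e \<in> carrier Star" if "e \<in> I" for e using i that g by simp
    have ik: "X i k e \<otimes>\<^bsub>Star\<^esub> ?P = ?P \<otimes>\<^bsub>Star\<^esub> X i k e" "X i k e \<otimes>\<^bsub>Star\<^esub> ?Q = ?Q \<otimes>\<^bsub>Star\<^esub> X i k e"
      if "e \<in> I" for e
      using that i g aI by (simp_all add: X_commute)
    have ikPQ: "X i k e \<otimes>\<^bsub>Star\<^esub> (?P \<otimes>\<^bsub>Star\<^esub> ?Q) = (?P \<otimes>\<^bsub>Star\<^esub> ?Q) \<otimes>\<^bsub>Star\<^esub> X i k e" if "e \<in> I" for e
      using c Xik[OF that] ik[OF that] by (intro Star.commute_mult)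
    \<comment> \<open>The Steinberg commutator inside \<open>Star\<close>: conjugation by
      \<open>X i j a\<close> is the action of \<open>xg i j a\<close>, which
      \<open>alpha_X_left\<close> computes.\<close>
    have QP: "?Q \<otimes>\<^bsub>Star\<^esub> ?P = X i k (a \<otimes> a') \<otimes>\<^bsub>Star\<^esub> (?P \<otimes>\<^bsub>Star\<^esub> ?Q)"
    proof -
      have "?Q \<otimes>\<^bsub>Star\<^esub> ?P = alpha (xg i j a) ?P \<otimes>\<^bsub>Star\<^esub> ?Q" using i aI c by (intro X_conj) auto
      also have "alpha (xg i j a) ?P = ?P \<otimes>\<^bsub>Star\<^esub> X i k (a \<otimes> a')"
        using i aI aR g(3) by (intro alpha_X_left) (auto simp: gens_iff)
      finally show ?thesis using c Xik[OF I1(2)] ik[OF I1(2)] ikPQ[OF I1(2)] by (simp add: Star.m_assoc)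
    qed
    have "fst (?y i j r \<otimes>\<^bsub>Gam\<^esub> ?y j k s) = ?Q \<otimes>\<^bsub>Star\<^esub> (?P \<otimes>\<^bsub>Star\<^esub> X i k (b \<otimes> a'))"
      using i g(3) aI bR by (simp add: alpha_X_left gens_iff flip: d)
    also have "\<dots> = (?Q \<otimes>\<^bsub>Star\<^esub> ?P) \<otimes>\<^bsub>Star\<^esub> X i k (b \<otimes> a')"
      using c Xik[OF I1(1)] by (simp add: Star.m_assoc)
    also have "\<dots> = X i k (a \<otimes> a') \<otimes>\<^bsub>Star\<^esub> ((?P \<otimes>\<^bsub>Star\<^esub> ?Q) \<otimes>\<^bsub>Star\<^esub> X i k (b \<otimes> a'))"
      unfolding QP using c Xik[OF I1(1)] Xik[OF I1(2)] by (simp add: Star.m_assoc)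
    also have "\<dots> = X i k (a \<otimes> a') \<otimes>\<^bsub>Star\<^esub> (X i k (b \<otimes> a') \<otimes>\<^bsub>Star\<^esub> (?P \<otimes>\<^bsub>Star\<^esub> ?Q))"
      by (simp only: ikPQ[OF I1(1)])
    also have "\<dots> = X i k (a \<otimes> a' \<oplus> b \<otimes> a') \<otimes>\<^bsub>Star\<^esub> (?P \<otimes>\<^bsub>Star\<^esub> ?Q)"
      using i g(3) I1 c Xik by (simp flip: X_add add: Star.m_assoc)
    finally have L: "fst (?y i j r \<otimes>\<^bsub>Gam\<^esub> ?y j k s) = X i k (a \<otimes> a' \<oplus> b \<otimes> a') \<otimes>\<^bsub>Star\<^esub> (?P \<otimes>\<^bsub>Star\<^esub> ?Q)" .
    have dI: "delta (r \<otimes> s) \<in> I" using i by simp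
    have gik: "(i, k, rho (r \<otimes> s)) \<in> St_gens n R" using i g(3) by (simp add: gens_iff del: rho_simps(3))
    \<comment> \<open>A root element with indices (i, k) fixes all three factors, so the outermost
      twist in the semidirect product disappears.\<close>
    have "alpha (xg i k (rho (r \<otimes> s))) (?P \<otimes>\<^bsub>Star\<^esub> (?Q \<otimes>\<^bsub>Star\<^esub> X i k (\<ominus> (a \<otimes> b'))))
        = ?P \<otimes>\<^bsub>Star\<^esub> (?Q \<otimes>\<^bsub>Star\<^esub> X i k (\<ominus> (a \<otimes> b')))"
      using i g(3) aI I2 c Xik[OF I2]
      by (simp add: alpha_X_fix[OF gik] del: rho_simps(3))
    moreover have "?y j k s \<otimes>\<^bsub>Gam\<^esub> ?y i j r
        = (?P \<otimes>\<^bsub>Star\<^esub> (?Q \<otimes>\<^bsub>Star\<^esub> X i k (\<ominus> (a \<otimes> b'))), xg j k b' \<otimes>\<^bsub>St\<^esub> xg i j b)"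
      using i g(3) aI bR by (simp add: alpha_X_right gens_iff flip: d)
    ultimately have "fst (?y i k (r \<otimes> s) \<otimes>\<^bsub>Gam\<^esub> (?y j k s \<otimes>\<^bsub>Gam\<^esub> ?y i j r))
        = X i k (delta (r \<otimes> s)) \<otimes>\<^bsub>Star\<^esub> (?P \<otimes>\<^bsub>Star\<^esub> (?Q \<otimes>\<^bsub>Star\<^esub> X i k (\<ominus> (a \<otimes> b'))))"
      by (simp del: rho_simps(3))
    also have "\<dots> = X i k (delta (r \<otimes> s)) \<otimes>\<^bsub>Star\<^esub> ((?P \<otimes>\<^bsub>Star\<^esub> ?Q) \<otimes>\<^bsub>Star\<^esub> X i k (\<ominus> (a \<otimes> b')))"
      using c Xik[OF I2] by (simp add: Star.m_assoc)
    also have "\<dots> = X i k (delta (r \<otimes> s)) \<otimes>\<^bsub>Star\<^esub> (X i k (\<ominus> (a \<otimes> b')) \<otimes>\<^bsub>Star\<^esub> (?P \<otimes>\<^bsub>Star\<^esub> ?Q))"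
      by (simp only: ikPQ[OF I2])
    also have "\<dots> = X i k (delta (r \<otimes> s) \<oplus> \<ominus> (a \<otimes> b')) \<otimes>\<^bsub>Star\<^esub> (?P \<otimes>\<^bsub>Star\<^esub> ?Q)"
      using i g(3) dI I2 c Xik by (simp flip: X_add add: Star.m_assoc)
    \<comment> \<open>The third term of \<open>delta_mult\<close> cancels, and what remains is the
      coefficient found on the other side.\<close>
    also have "delta (r \<otimes> s) \<oplus> \<ominus> (a \<otimes> b') = a \<otimes> a' \<oplus> b \<otimes> a'"
      using i aR bR by (simp add: delta_mult a_assoc r_neg flip: d)
    finally have "fst (?y i j r \<otimes>\<^bsub>Gam\<^esub> ?y j k s) = fst (?y i k (r \<otimes> s) \<otimes>\<^bsub>Gam\<^esub> (?y j k s \<otimes>\<^bsub>Gam\<^esub> ?y i j r))"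
      using L by simp
    moreover have "snd (?y i j r \<otimes>\<^bsub>Gam\<^esub> ?y j k s) = snd (?y i k (r \<otimes> s) \<otimes>\<^bsub>Gam\<^esub> (?y j k s \<otimes>\<^bsub>Gam\<^esub> ?y i j r))"
      using i g(3) xg_trans[of i j k "rho r" "rho s"] by simp
    ultimately show ?thesis by (rule prod_eqI)
  qed
  note lift = steinberg_lift[where H = Gam and y = ?y, OF Gam.group_axioms 0 1 2 3, folded split_def]
  show "split \<in> hom St Gam" by (rule lift(1))
  show "(i, j, r) \<in> St_gens n R \<Longrightarrow> split (xg i j r) = (X i j (delta r), xg i j (rho r))" by (rule lift(2))
qed

definition merge :: "'a star_gen word set \<times> (nat \<times> nat \<times> 'a) word set \<Rightarrow> (nat \<times> nat \<times> 'a) word set" where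
  "merge = (\<lambda>(s, h). kappa s \<otimes>\<^bsub>St\<^esub> h)"

text \<open>By equivariance of \<open>kappa\<close>, moving g past kappa(t) turns it into
  kappa(alpha g t), and this twist is the one built into the product of the semidirect
  product.\<close>

lemma merge_hom: "merge \<in> hom Gam St"
proof (rule homI)
  fix y z assume "y \<in> carrier Gam" "z \<in> carrier Gam"
  then obtain s g t h where "y = (s, g)" "z = (t, h)" and c: "s \<in> carrier Star" "g \<in> carrier St"
    "t \<in> carrier Star" "h \<in> carrier St" by auto
  then show "merge (y \<otimes>\<^bsub>Gam\<^esub> z) = merge y \<otimes>\<^bsub>St\<^esub> merge z"
    by (simp add: merge_def kappa_alpha St.cj_def St.m_assoc)
qed (auto simp: merge_def)

lemma St_hom_eqI:
  assumes h: "h \<in> hom St H" and k: "k \<in> hom St H" and H: "group H"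
    and e: "\<And>i j r. (i, j, r) \<in> St_gens n R \<Longrightarrow> h (xg i j r) = k (xg i j r)" and g: "g \<in> carrier St"
  shows "h g = k g"
proof -
  interpret h: group_hom St H h using h H St.group_axioms by (simp add: group_hom_def group_hom_axioms_def)
  interpret k: group_hom St H k using k H St.group_axioms by (simp add: group_hom_def group_hom_axioms_def)
  show ?thesis using g by (induction rule: St_induct) (simp_all add: e)
qed

lemma merge_split: "g \<in> carrier St \<Longrightarrow> merge (split g) = g"
proof -
  assume g: "g \<in> carrier St"
  have "(merge \<circ> split) g = id g"
  proof (rule St_hom_eqI[OF _ _ St.group_axioms _ g])
    show "merge \<circ> split \<in> hom St St" using hom_compose[OF split_hom merge_hom] .
    show "id \<in> hom St St" by (auto simp: hom_def)
    fix i j r assume gen: "(i, j, r) \<in> St_gens n R"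
    then have c: "i \<in> {1..n}" "j \<in> {1..n}" "i \<noteq> j" "r \<in> carrier R" by (auto simp: gens_iff)
    have "(merge \<circ> split) (xg i j r) = xg i j (delta r) \<otimes>\<^bsub>St\<^esub> xg i j (rho r)"
      using c split_xg[OF gen] by (simp add: merge_def kappa_X)
    also have "\<dots> = xg i j (delta r \<oplus> rho r)" using c by (simp add: xg_add I_carrier)
    finally show "(merge \<circ> split) (xg i j r) = id (xg i j r)" using c by (simp add: delta_rho)
  qed
  then show ?thesis by simp
qed

lemma snd_split: "g \<in> carrier St \<Longrightarrow> snd (split g) = psi g"
proof -
  assume g: "g \<in> carrier St"
  have "snd \<in> hom Gam St" by (auto simp: hom_def)
  from hom_compose[OF split_hom this] have "snd \<circ> split \<in> hom St St" .
  from St_hom_eqI[OF this psi_hom St.group_axioms _ g] have "(snd \<circ> split) g = psi g"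
    by (simp add: split_xg psi_xg)
  then show ?thesis by simp
qed

text \<open>The elements s with this property form a subgroup, and it contains the root elements
  since on I \<open>delta\<close> is the identity and \<open>rho\<close> is zero. Stability under
  \<open>alpha\<close> uses g = kappa(t) h, where split g = (t, h): conjugating (s, 1) by (t, h)
  gives (alpha g s, 1), by \<open>cj_eq_alpha\<close> for t.\<close>

lemma split_kappa:
  assumes s: "s \<in> carrier Star"
  shows "split (kappa s) = (s, \<one>\<^bsub>St\<^esub>)"
proof -
  interpret split: group_hom St Gam split
    using split_hom St.group_axioms Gam.group_axioms by (simp add: group_hom_def group_hom_axioms_def)
  define D where "D = {s \<in> carrier Star. split (kappa s) = (s, \<one>\<^bsub>St\<^esub>)}"
  have "carrier Star \<subseteq> D"
  proof (rule star_generated)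
    show "subgroup D Star"
    proof (rule Star.subgroupI)
      have "\<one>\<^bsub>Star\<^esub> \<in> D" using split.hom_one by (simp add: D_def)
      then show "D \<noteq> {}" by blast
    next
      fix s assume s: "s \<in> D"
      then have c: "s \<in> carrier Star" by (simp add: D_def)
      have "split (kappa (inv\<^bsub>Star\<^esub> s)) = inv\<^bsub>Gam\<^esub> (s, \<one>\<^bsub>St\<^esub>)"
        using s c by (simp add: D_def)
      also have "\<dots> = (inv\<^bsub>Star\<^esub> s, \<one>\<^bsub>St\<^esub>)"
        using c by (intro Gam.inv_equality) simp_all
      finally show "inv\<^bsub>Star\<^esub> s \<in> D" using c by (simp add: D_def)
    qed (auto simp: D_def)
    show "X i j a \<in> D" if "i \<in> {1..n}" "j \<in> {1..n}" "i \<noteq> j" "a \<in> I" for i j a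
    proof -
      have "(i, j, a) \<in> St_gens n R" using that by (simp add: gens_iff I_carrier)
      from split_xg[OF this] that show ?thesis
        by (simp add: D_def kappa_X delta_I_eq rho_zero)
    qed
    fix g s assume g: "g \<in> carrier St" and s: "s \<in> D"
    then have c: "s \<in> carrier Star" "split (kappa s) = (s, \<one>\<^bsub>St\<^esub>)" by (simp_all add: D_def)
    obtain t h where th: "split g = (t, h)" by (cases "split g")
    have "split g \<in> carrier Gam" using g by (rule split.hom_closed)
    then have tc: "t \<in> carrier Star" "h \<in> carrier St" by (simp_all add: th)
    have gm: "g = kappa t \<otimes>\<^bsub>St\<^esub> h" using merge_split[OF g] by (simp add: th merge_def)
    have a: "alpha g s \<in> carrier Star" using g c by simp
    have "alpha g s \<otimes>\<^bsub>Star\<^esub> t = t \<otimes>\<^bsub>Star\<^esub> alpha h s"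
      using cj_eq_alpha[of t "alpha h s"] tc c by (simp add: gm alpha_alpha Star.cj_eq_iff)
    then have "(alpha g s, \<one>\<^bsub>St\<^esub>) \<otimes>\<^bsub>Gam\<^esub> split g = split g \<otimes>\<^bsub>Gam\<^esub> (s, \<one>\<^bsub>St\<^esub>)"
      using tc by (simp add: th)
    then have "Gam.cj (split g) (s, \<one>\<^bsub>St\<^esub>) = (alpha g s, \<one>\<^bsub>St\<^esub>)"
      using g c a split.hom_closed[OF g] by (subst Gam.cj_eq_iff) (simp_all)
    moreover have "split (kappa (alpha g s)) = Gam.cj (split g) (split (kappa s))"
      using g c(1) by (simp add: kappa_alpha St.cj_def Gam.cj_def)
    ultimately show "alpha g s \<in> D" using a c by (simp add: D_def)
  qed
  then show ?thesis using s unfolding D_def by blast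
qed

lemma kappa_inj: "inj_on kappa (carrier Star)"
  by (rule inj_onI) (metis split_kappa prod.inject)

text \<open>The second component of \<open>split g\<close> is \<open>psi g\<close>; when it is
  trivial, \<open>merge_split\<close> reads g = kappa(t).\<close>

lemma psi_kernel_kappa:
  assumes g: "g \<in> carrier St" and p: "psi g = \<one>\<^bsub>St\<^esub>"
  shows "g \<in> kappa ` carrier Star"
proof -
  obtain t h where th: "split g = (t, h)" by (cases "split g")
  have "split g \<in> carrier Gam" using split_hom g by (rule hom_in_carrier)
  then have t: "t \<in> carrier Star" by (simp add: th)
  have "h = \<one>\<^bsub>St\<^esub>" using snd_split[OF g] p by (simp add: th)
  then have "g = kappa t" using merge_split[OF g] t by (simp add: th merge_def)
  then show ?thesis using t by blast
qed

end

section \<open>The isomorphism onto the kernel of reduction modulo the ideal\<close>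

theorem proposition3p10:
  fixes R :: "('a, 'b) ring_scheme" and I :: "'a set" and n :: nat
  assumes "cring R"
    and "splitting_ideal I R"
    and "n \<ge> 4"
  shows "star_Steinberg n R I \<cong> relative_Steinberg n R I"
proof -
  interpret R: cring R by (rule assms(1))
  have I: "ideal I R" using assms(2) by (simp add: splitting_ideal_def)
  obtain \<sigma> where \<sigma>: "\<sigma> \<in> ring_hom (R Quot I) R"
    "\<And>x. x \<in> carrier (R Quot I) \<Longrightarrow> I +>\<^bsub>R\<^esub> \<sigma> x = x"
    using assms(2) unfolding splitting_ideal_def by blast
  define \<pi> where "\<pi> r = I +>\<^bsub>R\<^esub> r" for r
  have \<pi>: "\<pi> \<in> ring_hom R (R Quot I)"
    using ideal.rcos_ring_hom[OF I] by (simp add: \<pi>_def[abs_def])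
  have \<pi>_zero: "\<pi> a = \<zero>\<^bsub>R Quot I\<^esub>" if "a \<in> I" for a
    using R.a_rcos_zero[OF I that] by (simp add: \<pi>_def FactRing_def)
  define \<rho> where "\<rho> = \<sigma> \<circ> \<pi>"
  have Q: "cring (R Quot I)" by (rule ideal.quotient_is_cring[OF I assms(1)])
  have \<rho>: "\<rho> \<in> ring_hom R R"
    unfolding \<rho>_def by (rule ring_hom_trans[OF \<pi> \<sigma>(1)])
  have \<rho>_diff: "r \<oplus>\<^bsub>R\<^esub> \<ominus>\<^bsub>R\<^esub> \<rho> r \<in> I" if r: "r \<in> carrier R" for r
  proof -
    have "I +>\<^bsub>R\<^esub> \<rho> r = I +>\<^bsub>R\<^esub> r"
      using \<sigma>(2)[OF ring_hom_closed[OF \<pi> r]] by (simp add: \<rho>_def \<pi>_def)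
    then have "r \<ominus>\<^bsub>R\<^esub> \<rho> r \<in> I"
      using R.quotient_eq_iff_same_a_r_cos[OF I r ring_hom_closed[OF \<rho> r]] by simp
    then show ?thesis by (simp add: a_minus_def)
  qed
  have \<rho>_zero: "\<rho> a = \<zero>\<^bsub>R\<^esub>" if "a \<in> I" for a
    using ring_hom_zero[OF \<sigma>(1) cring.axioms(1)[OF Q] R.ring_axioms] \<pi>_zero[OF that]
    by (simp add: \<rho>_def)
  interpret steinberg_splitting R n I \<rho>
    using assms(1,3) I \<rho> \<rho>_diff \<rho>_zero
    by (simp add: steinberg_splitting_def steinberg_splitting_axioms_def steinberg_ideal_def
        steinberg_ideal_axioms_def steinberg_ring_def steinberg_ring_axioms_def column_space_def)
  interpret Q: steinberg_ring "R Quot I" n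
    using Q assms(3) by (simp add: steinberg_ring_def column_space_def steinberg_ring_axioms_def)
  let ?StQ = "Steinberg n (R Quot I)"
  define p where "p = St_map n (R Quot I) \<pi>"
  have p: "p \<in> hom St ?StQ" unfolding p_def by (rule St_map_hom[OF \<pi>])
  interpret p: group_hom St ?StQ p
    using p St.group_axioms Q.St.group_axioms by (simp add: group_hom_def group_hom_axioms_def)
  have p_xg: "p (xg i j r) = Q.xg i j (\<pi> r)" if g: "(i, j, r) \<in> St_gens n R" for i j r
  proof -
    have "(i, j, \<pi> r) \<in> St_gens n (R Quot I)"
      using g ring_hom_closed[OF \<pi>] by (simp add: St_gens_def)
    then show ?thesis using St_map_gen[OF \<pi> g] g by (simp add: p_def xg_eq Q.xg_eq)
  qed
  \<comment> \<open>\<open>psi\<close> factors through \<open>p\<close>, so an element killed by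
    \<open>p\<close> is killed by \<open>psi\<close> and therefore lies in the image of
    \<open>kappa\<close>.\<close>
  have psi_p: "psi g = St_map n R \<sigma> (p g)" if g: "g \<in> carrier St" for g
  proof -
    have "psi g = (St_map n R \<sigma> \<circ> p) g"
    proof (rule St_hom_eqI[OF psi_hom _ St.group_axioms _ g])
      show "St_map n R \<sigma> \<circ> p \<in> hom St St" by (rule hom_compose[OF p St_map_hom[OF \<sigma>(1)]])
      fix i j r assume g: "(i, j, r) \<in> St_gens n R"
      then have q: "(i, j, \<pi> r) \<in> St_gens n (R Quot I)" "(i, j, \<rho> r) \<in> St_gens n R"
        using ring_hom_closed[OF \<pi>] rho_simps(1) by (simp_all add: St_gens_def)
      have "St_map n R \<sigma> (Q.xg i j (\<pi> r)) = xg i j (\<rho> r)"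
        using St_map_gen[OF \<sigma>(1) q(1)] xg_eq[OF q(2)] Q.xg_eq[OF q(1)] by (simp add: \<rho>_def)
      then show "psi (xg i j r) = (St_map n R \<sigma> \<circ> p) (xg i j r)"
        by (simp add: psi_xg[OF g] p_xg[OF g])
    qed
    then show ?thesis by simp
  qed
  have ker: "kernel St ?StQ p = kappa ` carrier Star"
  proof
    show "kernel St ?StQ p \<subseteq> kappa ` carrier Star"
    proof
      fix g assume g: "g \<in> kernel St ?StQ p"
      then have "psi g = St_map n R \<sigma> \<one>\<^bsub>?StQ\<^esub>" by (simp add: kernel_def psi_p)
      also have "\<dots> = \<one>\<^bsub>St\<^esub>"
        by (rule hom_one[OF St_map_hom[OF \<sigma>(1)] Q.St.group_axioms St.group_axioms])
      finally show "g \<in> kappa ` carrier Star" using g by (intro psi_kernel_kappa) (simp_all add: kernel_def)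
    qed
    interpret pk: group_hom Star ?StQ "p \<circ> kappa"
      using hom_compose[OF kappa_hom p] Star.group_axioms Q.St.group_axioms
      by (simp add: group_hom_def group_hom_axioms_def)
    \<comment> \<open>For the converse inclusion: a root element with coefficient in I dies in
      St(n,R/I), and the kernel of \<open>p\<close> is stable under conjugation, so the kernel of
      the composite is stable under \<open>alpha\<close>.\<close>
    have "carrier Star \<subseteq> kernel Star ?StQ (p \<circ> kappa)"
    proof (rule star_generated)
      show "subgroup (kernel Star ?StQ (p \<circ> kappa)) Star" by (rule pk.subgroup_kernel)
      show "X i j a \<in> kernel Star ?StQ (p \<circ> kappa)"
        if "i \<in> {1..n}" "j \<in> {1..n}" "i \<noteq> j" "a \<in> I" for i j a
        using that by (simp add: kernel_def kappa_X p_xg gens_iff I_carrier \<pi>_zero)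
      show "alpha g s \<in> kernel Star ?StQ (p \<circ> kappa)"
        if "g \<in> carrier St" "s \<in> kernel Star ?StQ (p \<circ> kappa)" for g s
        using that by (simp add: kernel_def kappa_alpha St.cj_def)
    qed
    then show "kappa ` carrier Star \<subseteq> kernel St ?StQ p"
      by (auto simp: kernel_def)
  qed
  have rel: "relative_Steinberg n R I = St\<lparr>carrier := kappa ` carrier Star\<rparr>"
    unfolding relative_Steinberg_def using ker by (simp add: p_def \<pi>_def[abs_def])
  have "kappa \<in> iso Star (relative_Steinberg n R I)"
    unfolding iso_iff rel using kappa_inj kappa_hom by (auto simp: hom_def)
  then show ?thesis by (rule is_isoI)
qed

end
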